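(* The isometry group $\mathrm{Iso}(\mathbb{U})$ of the universal Urysohn metric space $\mathbb{U}$, equipped with its natural Polish topology (the topology of simple, i.e. pointwise, convergence on $\mathbb{U}$), satisfies the Kirchberg property.
   Context: The universal Urysohn metric space $\mathbb{U}$ is characterized, up to isometry, by: (1) $\mathbb{U}$ is a complete separable metric space; (2) $\mathbb{U}$ contains an isometric copy of every separable metric space; (3) every isometry between two finite metric subspaces of $\mathbb{U}$ extends to a global isometry of $\mathbb{U}$ onto itself. $\mathrm{Iso}(\mathbb{U})$ is the group of all isometries of $\mathbb{U}$ onto itself. For a topological group $G$ and a discrete group $\Gamma$, $\mathrm{Rep}(\Gamma,G)$ is the set of all homomorphisms $\Gamma\to G$, considered as a subspace of $G^{\Gamma}$ with the product topology. "Relatively compact" means "with compact closure". The lower Vietoris topology on the set $\mathcal{F}(X)$ of closed subsets of a topological space $X$ has basic open sets $L(V_1,\dots,V_n)=\{F\in\mathcal{F}(X): F\cap V_i\neq\emptyset \text{ for all } i=1,\dots,n\}$, where $V_1,\dots,V_n$ are open in $X$. A topological group $G$ satisfies the Kirchberg property if it satisfies the following properties, which are equivalent to each other: $(\circledast_1)$ If $A$ and $B$ are finite subsets of $G$ and every element of $A$ commutes with every element of $B$, then there exist finite subsets $A'$ and $B'$ of $G$, arbitrarily close to $A$ and $B$ respectively, such that every element of $A'$ commutes with every element of $B'$ and the subgroups of $G$ generated by $A'$ and by $B'$ are relatively compact. Here "arbitrarily close" means: if $A=\{x_1,\dots,x_n\}$ and arbitrary neighbourhoods $O_{x_1},\dots,O_{x_n}$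 of $x_1,\dots,x_n$ are given, then one can take $A'=\{x_1',\dots,x_n'\}$ with $x_i'\in O_{x_i}$, and similarly for $B'$. $(\circledast_2)$ For every pair $H_1,H_2$ of closed subgroups of $G$ such that every element of $H_1$ commutes with every element of $H_2$, there are nets $(K_{1,\alpha})$, $(K_{2,\alpha})$ of compact subgroups of $G$ such that every element of $K_{1,\alpha}$ commutes with every element of $K_{2,\alpha}$, and $K_{i,\alpha}$ converges to $H_i$ in the lower Vietoris topology for $i=1,2$. $(\circledast_3)$ Let $F_\infty$ be the free group on countably many (infinitely many) generators and $\Gamma=F_\infty\times F_\infty$. Then the homomorphisms $h:\Gamma\to G$ with relatively compact range form a dense subset of $\mathrm{Rep}(\Gamma,G)$. *)

theory Defs
  imports "HOL-Analysis.Analysis" "HOL-Algebra.Bij" "HOL-Algebra.Generated_Groups"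
begin

section \<open>The Urysohn space\<close>

definition isometric_embedding ::
    "'a set \<Rightarrow> ('a \<Rightarrow> 'a \<Rightarrow> real) \<Rightarrow> 'b set \<Rightarrow> ('b \<Rightarrow> 'b \<Rightarrow> real) \<Rightarrow> ('a \<Rightarrow> 'b) \<Rightarrow> bool" where
  "isometric_embedding S dS M d f \<longleftrightarrow> f \<in> S \<rightarrow> M \<and> (\<forall>x\<in>S. \<forall>y\<in>S. d (f x) (f y) = dS x y)"

text \<open>The isometries of the space onto itself. They are extensional, so that equality of elements
  is equality of isometries; multiplication is composition.\<close>

definition isometry_group :: "'a set \<Rightarrow> ('a \<Rightarrow> 'a \<Rightarrow> real) \<Rightarrow> ('a \<Rightarrow> 'a) monoid" where
  "isometry_group M d = (BijGroup M)\<lparr>carrier := {g \<in> Bij M. isometric_embedding M d M d g}\<rparr>"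

definition isometry_topology :: "'a set \<Rightarrow> ('a \<Rightarrow> 'a \<Rightarrow> real) \<Rightarrow> ('a \<Rightarrow> 'a) topology" where
  "isometry_topology M d =
     subtopology (product_topology (\<lambda>_. Metric_space.mtopology M d) M)
       (carrier (isometry_group M d))"

text \<open>A formula cannot quantify over types, so universality is stated for separable metric spaces
  whose points are real numbers. A separable metric space has at most continuum many points, so this
  covers all of them; see \<open>urysohn_space_universal\<close> below.\<close>

definition urysohn_space :: "'a set \<Rightarrow> ('a \<Rightarrow> 'a \<Rightarrow> real) \<Rightarrow> bool" where
  "urysohn_space U d \<longleftrightarrow>
     Metric_space U d \<and>
     Metric_space.mcomplete U d \<and>
     separable_space (Metric_space.mtopology U d) \<and>
     (\<forall>(S :: real set) dS.
        Metric_space S dS \<and> separable_space (Metric_space.mtopology S dS) \<longrightarrow>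
        (\<exists>f. isometric_embedding S dS U d f)) \<and>
     (\<forall>A B f.
        finite A \<and> finite B \<and> A \<subseteq> U \<and> B \<subseteq> U \<and> isometric_embedding A d B d f \<and> f ` A = B \<longrightarrow>
        (\<exists>g \<in> carrier (isometry_group U d). \<forall>x\<in>A. g x = f x))"

lemma separable_lepoll_real:
  assumes M: "Metric_space M d" and sep: "separable_space (Metric_space.mtopology M d)"
  shows "\<exists>e :: 'a \<Rightarrow> real. inj_on e M"
proof -
  interpret Metric_space M d by (rule M)
  obtain C where C: "countable C" "C \<subseteq> M" "mtopology closure_of C = M"
    using sep by (auto simp: separable_space_def)
  define h where "h x = to_nat_on (C \<times> (UNIV :: rat set)) ` {(c, q). c \<in> C \<and> d x c < of_rat q}"
    for x
  have "inj_on h M"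
  proof (rule inj_onI, rule ccontr)
    fix x y assume xy: "x \<in> M" "y \<in> M" "h x = h y" "x \<noteq> y"
    then have pos: "d x y > 0" by simp
    from xy(1) C(3) have "x \<in> mtopology closure_of C" by simp
    then obtain c where c: "c \<in> C" "c \<in> M" "d x c < d x y / 2"
      using pos unfolding metric_closure_of by (auto dest!: spec[of _ "d x y / 2"] simp: in_mball)
    obtain q where q: "d x c < of_rat q" "of_rat q < d x y / 2"
      using of_rat_dense[OF c(3)] by auto
    have cnt: "countable (C \<times> (UNIV :: rat set))" using C(1) by auto
    have "to_nat_on (C \<times> (UNIV :: rat set)) (c, q) \<in> h x"
      using c q by (auto simp: h_def)
    then have "to_nat_on (C \<times> (UNIV :: rat set)) (c, q) \<in> h y" using xy by simp
    then obtain c' q' where c': "c' \<in> C" "d y c' < of_rat q'"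
        "to_nat_on (C \<times> (UNIV :: rat set)) (c, q) = to_nat_on (C \<times> (UNIV :: rat set)) (c', q')"
      by (auto simp: h_def)
    have "(c, q) = (c', q')"
      using inj_on_to_nat_on[OF cnt] c' c by (auto dest!: inj_onD)
    then have "d y c < of_rat q" using c' by simp
    then have "d x y < d x y" using q triangle[OF xy(1) c(2) xy(2)] commute[of c y] by linarith
    then show False by simp
  qed
  moreover obtain g :: "nat set \<Rightarrow> real" where "inj g"
    using nat_sets_eqpoll_reals unfolding eqpoll_def bij_betw_def by blast
  ultimately have "inj_on (g \<circ> h) M"
    by (meson comp_inj_on inj_on_subset subset_UNIV)
  then show ?thesis by blast
qed

lemma urysohn_space_universal:
  fixes S :: "'b set"
  assumes U: "urysohn_space U d"
    and S: "Metric_space S dS" "separable_space (Metric_space.mtopology S dS)"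
  shows "\<exists>f. isometric_embedding S dS U d f"
proof -
  obtain e :: "'b \<Rightarrow> real" where e: "inj_on e S" using separable_lepoll_real[OF S] by blast
  define i where "i = inv_into S e"
  define S' where "S' = e ` S"
  define d' where "d' x y = (if x \<in> S' \<and> y \<in> S' then dS (i x) (i y) else 0)" for x y
  have ie: "i (e x) = x" if "x \<in> S" for x using e that by (simp add: i_def)
  interpret A: Metric_space S dS by (rule S)
  have d'e: "d' (e x) (e y) = dS x y" if "x \<in> S" "y \<in> S" for x y
    using that by (simp add: d'_def S'_def ie)
  have M': "Metric_space S' d'"
  proof
    show "0 \<le> d' x y" for x y by (simp add: d'_def)
    show "d' x y = d' y x" for x y by (simp add: d'_def A.commute)
    show "d' x y = 0 \<longleftrightarrow> x = y" if "x \<in> S'" "y \<in> S'" for x y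
      using that by (auto simp: S'_def d'e)
    show "d' x z \<le> d' x y + d' y z" if "x \<in> S'" "y \<in> S'" "z \<in> S'" for x y z
      using that by (auto simp: S'_def d'e A.triangle)
  qed
  interpret B: Metric_space S' d' by (rule M')
  obtain C where C: "countable C" "C \<subseteq> S" "A.mtopology closure_of C = S"
    using S(2) by (auto simp: separable_space_def)
  have "B.mtopology closure_of (e ` C) = S'"
  proof
    show "B.mtopology closure_of (e ` C) \<subseteq> S'"
      using closure_of_subset_topspace[of B.mtopology] by simp
    show "S' \<subseteq> B.mtopology closure_of (e ` C)"
    proof
      fix y assume "y \<in> S'"
      then obtain x where x: "x \<in> S" "y = e x" by (auto simp: S'_def)
      then have "x \<in> A.mtopology closure_of C" using C by simp
      then have "\<forall>r>0. \<exists>c\<in>C. c \<in> S \<and> dS x c < r"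
        using x by (auto simp: A.metric_closure_of A.in_mball)
      then have "\<forall>r>0. \<exists>c\<in>e ` C. c \<in> S' \<and> d' y c < r"
        using x C(2) by (fastforce simp: d'e S'_def)
      then show "y \<in> B.mtopology closure_of (e ` C)"
        using \<open>y \<in> S'\<close> by (fastforce simp: B.metric_closure_of B.in_mball)
    qed
  qed
  then have "separable_space B.mtopology"
    unfolding separable_space_def B.topspace_mtopology
    using C by (intro exI[of _ "e ` C"]) (auto simp: S'_def simp del: B.topspace_mtopology)
  then obtain f where "isometric_embedding S' d' U d f"
    using U M' unfolding urysohn_space_def by blast
  then have "isometric_embedding S dS U d (f \<circ> e)"
    unfolding isometric_embedding_def using d'e by (auto simp: S'_def)
  then show ?thesis by blast
qed


section \<open>Topological groups\<close>

definition topological_group :: "('g, 'm) monoid_scheme \<Rightarrow> 'g topology \<Rightarrow> bool" where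
  "topological_group G T \<longleftrightarrow>
     group G \<and> topspace T = carrier G \<and>
     continuous_map (prod_topology T T) T (\<lambda>(x, y). x \<otimes>\<^bsub>G\<^esub> y) \<and>
     continuous_map T T (\<lambda>x. inv\<^bsub>G\<^esub> x)"

definition elementwise_commute :: "('g, 'm) monoid_scheme \<Rightarrow> 'g set \<Rightarrow> 'g set \<Rightarrow> bool" where
  "elementwise_commute G A B \<longleftrightarrow> (\<forall>a\<in>A. \<forall>b\<in>B. a \<otimes>\<^bsub>G\<^esub> b = b \<otimes>\<^bsub>G\<^esub> a)"

definition relatively_compact :: "'x topology \<Rightarrow> 'x set \<Rightarrow> bool" where
  "relatively_compact X S \<longleftrightarrow> S \<subseteq> topspace X \<and> compactin X (X closure_of S)"

lemma group_isometry_group: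
  assumes "Metric_space M d"
  shows "group (isometry_group M d)"
    and "g \<in> carrier (isometry_group M d) \<Longrightarrow>
      inv\<^bsub>isometry_group M d\<^esub> g = (\<lambda>x\<in>M. inv_into M g x)"
proof -
  let ?H = "{g \<in> Bij M. isometric_embedding M d M d g}"
  interpret B: group "BijGroup M" by (rule group_BijGroup)
  have inv: "inv\<^bsub>BijGroup M\<^esub> g = (\<lambda>x\<in>M. inv_into M g x)" if "g \<in> ?H" for g
    using that by (simp add: inv_BijGroup)
  have invH: "(\<lambda>x\<in>M. inv_into M g x) \<in> ?H" if "g \<in> ?H" for g
  proof -
    have g: "bij_betw g M M" and iso: "\<And>x y. x \<in> M \<Longrightarrow> y \<in> M \<Longrightarrow> d (g x) (g y) = d x y"
      using that by (auto simp: Bij_def isometric_embedding_def)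
    have "d (inv_into M g x) (inv_into M g y) = d x y" if "x \<in> M" "y \<in> M" for x y
      using iso[of "inv_into M g x" "inv_into M g y"] g that
      by (metis bij_betw_def f_inv_into_f inv_into_into)
    then show ?thesis
      using that g restrict_inv_into_Bij[of g M]
      by (auto simp: isometric_embedding_def bij_betw_def intro!: inv_into_into)
  qed
  have sub: "subgroup ?H (BijGroup M)"
  proof (rule B.subgroupI)
    show "?H \<subseteq> carrier (BijGroup M)" by (auto simp: BijGroup_def)
    show "?H \<noteq> {}"
      using id_Bij[of M] by (auto simp: isometric_embedding_def intro!: exI[of _ "\<lambda>x\<in>M. x"])
    show "inv\<^bsub>BijGroup M\<^esub> a \<in> ?H" if "a \<in> ?H" for a using inv[OF that] invH[OF that] by simp
    show "a \<otimes>\<^bsub>BijGroup M\<^esub> b \<in> ?H" if "a \<in> ?H" "b \<in> ?H" for a b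
      using that compose_Bij[of a M b]
      by (auto simp: BijGroup_def isometric_embedding_def compose_def Pi_iff)
  qed
  then show "group (isometry_group M d)"
    unfolding isometry_group_def by (rule subgroup.subgroup_is_group) (rule group_BijGroup)
  show "inv\<^bsub>isometry_group M d\<^esub> g = (\<lambda>x\<in>M. inv_into M g x)"
    if "g \<in> carrier (isometry_group M d)"
    using that B.m_inv_consistent[OF sub, of g] inv by (simp add: isometry_group_def)
qed

lemma topological_group_isometry_group:
  assumes M: "Metric_space M d"
  shows "topological_group (isometry_group M d) (isometry_topology M d)"
proof -
  interpret Metric_space M d by (rule M)
  let ?G = "carrier (isometry_group M d)" and ?T = "isometry_topology M d"
  interpret G: group "isometry_group M d" by (rule group_isometry_group[OF M])
  have memM: "g x \<in> M" if "g \<in> ?G" "x \<in> M" for g x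
    using that by (auto simp: isometry_group_def isometric_embedding_def)
  have ext: "g \<in> extensional M" and bij: "bij_betw g M M" if "g \<in> ?G" for g
    using that by (auto simp: isometry_group_def Bij_def)
  have iso: "d (g x) (g y) = d x y" if "g \<in> ?G" "x \<in> M" "y \<in> M" for g x y
    using that by (auto simp: isometry_group_def isometric_embedding_def)
  have top: "topspace ?T = ?G"
  proof -
    have "?G \<subseteq> M \<rightarrow>\<^sub>E M" using memM ext by (auto simp: PiE_iff extensional_def)
    then show ?thesis by (auto simp: isometry_topology_def)
  qed
  have mult: "(g \<otimes>\<^bsub>isometry_group M d\<^esub> f) x = g (f x)" if "g \<in> ?G" "f \<in> ?G" "x \<in> M" for g f x
    using that by (auto simp: isometry_group_def BijGroup_def compose_def)
  have cont_eval: "continuous_map ?T mtopology (\<lambda>g. g x)" if "x \<in> M" for x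
    unfolding isometry_topology_def
    by (intro continuous_map_from_subtopology continuous_map_product_projection that)
  have nbhd: "openin ?T {h \<in> ?G. h x \<in> mball (g x) e}" if "x \<in> M" for x g e
    using openin_continuous_map_preimage[OF cont_eval[OF that] openin_mball, of "g x" e]
    by (simp add: top)
  have contI: "continuous_map X ?T f"
    if "f \<in> topspace X \<rightarrow> ?G"
      "\<And>x z e. x \<in> M \<Longrightarrow> z \<in> topspace X \<Longrightarrow> e > 0 \<Longrightarrow>
        \<exists>W. openin X W \<and> z \<in> W \<and> (\<forall>w\<in>W. f w x \<in> mball (f z x) e)"
    for X :: "'z topology" and f
    unfolding isometry_topology_def
  proof (rule continuous_map_into_subtopology)
    have "f w \<in> extensional M" if "w \<in> topspace X" for w
      using that \<open>f \<in> topspace X \<rightarrow> ?G\<close> ext by blast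
    then show "continuous_map X (product_topology (\<lambda>_. mtopology) M) f"
      using that(2) by (auto simp: continuous_map_componentwise continuous_map_to_metric)
  qed (rule that(1))
  have "continuous_map (prod_topology ?T ?T) ?T (\<lambda>(g, f). g \<otimes>\<^bsub>isometry_group M d\<^esub> f)"
  proof (rule contI)
    show "(\<lambda>(g, f). g \<otimes>\<^bsub>isometry_group M d\<^esub> f) \<in> topspace (prod_topology ?T ?T) \<rightarrow> ?G"
      by (auto simp: top)
    fix x z and e :: real
    assume x: "x \<in> M" and "z \<in> topspace (prod_topology ?T ?T)" and e: "e > 0"
    then obtain g f where z: "z = (g, f)" "g \<in> ?G" "f \<in> ?G" by (auto simp: top)
    define W where "W = {h \<in> ?G. h (f x) \<in> mball (g (f x)) (e / 2)} \<times>
      {h \<in> ?G. h x \<in> mball (f x) (e / 2)}"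
    have "openin (prod_topology ?T ?T) W"
      unfolding W_def using x memM z by (intro openin_prod_Times_iff[THEN iffD2] disjI2 conjI nbhd)
    moreover have "z \<in> W" using z x e memM by (auto simp: W_def)
    moreover have "d (g (f x)) (g' (f' x)) < e" if "(g', f') \<in> W" for g' f'
    proof -
      have w: "g' \<in> ?G" "f' \<in> ?G" "d (g (f x)) (g' (f x)) < e / 2" "d (f x) (f' x) < e / 2"
        using that by (auto simp: W_def in_mball)
      have "d (g (f x)) (g' (f' x)) \<le> d (g (f x)) (g' (f x)) + d (g' (f x)) (g' (f' x))"
        using w z x memM by (intro triangle) auto
      also have "d (g' (f x)) (g' (f' x)) = d (f x) (f' x)"
        using w z x memM by (intro iso) auto
      finally show ?thesis using w by linarith
    qed
    moreover have "(g', f') \<in> W \<Longrightarrow> g' \<in> ?G \<and> f' \<in> ?G" for g' f' by (auto simp: W_def)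
    ultimately show "\<exists>W. openin (prod_topology ?T ?T) W \<and> z \<in> W \<and>
        (\<forall>w\<in>W. (case w of (g, f) \<Rightarrow> g \<otimes>\<^bsub>isometry_group M d\<^esub> f) x
          \<in> mball ((case z of (g, f) \<Rightarrow> g \<otimes>\<^bsub>isometry_group M d\<^esub> f) x) e)"
      using z x memM by (intro exI[of _ W]) (auto simp: mult in_mball)
  qed
  moreover have "continuous_map ?T ?T (\<lambda>g. inv\<^bsub>isometry_group M d\<^esub> g)"
  proof (rule contI)
    show "(\<lambda>g. inv\<^bsub>isometry_group M d\<^esub> g) \<in> topspace ?T \<rightarrow> ?G" by (auto simp: top)
    fix x g and e :: real assume x: "x \<in> M" and "g \<in> topspace ?T" and e: "e > 0"
    then have g: "g \<in> ?G" by (simp add: top)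
    have inv: "(inv\<^bsub>isometry_group M d\<^esub> h) x \<in> M" "h ((inv\<^bsub>isometry_group M d\<^esub> h) x) = x"
      if "h \<in> ?G" for h
      using bij[OF that] x group_isometry_group(2)[OF M that]
      by (auto simp: bij_betw_def inv_into_into f_inv_into_f)
    define y where "y = (inv\<^bsub>isometry_group M d\<^esub> g) x"
    have y: "y \<in> M" "g y = x" using inv[OF g] by (auto simp: y_def)
    define W where "W = {h \<in> ?G. h y \<in> mball (g y) e}"
    have "(inv\<^bsub>isometry_group M d\<^esub> h) x \<in> mball y e" if "h \<in> W" for h
    proof -
      have h: "h \<in> ?G" "d x (h y) < e" using that y by (auto simp: W_def in_mball)
      have "d y ((inv\<^bsub>isometry_group M d\<^esub> h) x) = d (h y) x"
        using iso[OF h(1) y(1) inv(1)[OF h(1)]] inv(2)[OF h(1)] by simp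
      then show ?thesis using h y inv by (simp add: in_mball commute)
    qed
    moreover have "openin ?T W" unfolding W_def by (rule nbhd) (rule y)
    moreover have "g \<in> W" using g y x e by (auto simp: W_def)
    ultimately show "\<exists>W. openin ?T W \<and> g \<in> W \<and> (\<forall>w\<in>W. (inv\<^bsub>isometry_group M d\<^esub> w) x
        \<in> mball ((inv\<^bsub>isometry_group M d\<^esub> g) x) e)"
      by (auto simp: y_def)
  qed
  ultimately show ?thesis
    unfolding topological_group_def using top G.is_group by blast
qed


section \<open>Nets and the lower Vietoris topology\<close>

definition directed :: "'i set \<Rightarrow> ('i \<Rightarrow> 'i \<Rightarrow> bool) \<Rightarrow> bool" where
  "directed I leq \<longleftrightarrow>
     I \<noteq> {} \<and> (\<forall>i\<in>I. leq i i) \<and>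
     (\<forall>i\<in>I. \<forall>j\<in>I. \<forall>k\<in>I. leq i j \<longrightarrow> leq j k \<longrightarrow> leq i k) \<and>
     (\<forall>i\<in>I. \<forall>j\<in>I. \<exists>k\<in>I. leq i k \<and> leq j k)"

definition net_filter :: "'i set \<Rightarrow> ('i \<Rightarrow> 'i \<Rightarrow> bool) \<Rightarrow> 'i filter" where
  "net_filter I leq = (INF i\<in>I. principal {j \<in> I. leq i j})"

lemma eventually_net_filter:
  assumes "directed I leq"
  shows "eventually P (net_filter I leq) \<longleftrightarrow> (\<exists>i\<in>I. \<forall>j\<in>I. leq i j \<longrightarrow> P j)"
  unfolding net_filter_def
proof (subst eventually_INF_base)
  show "I \<noteq> {}" using assms by (simp add: directed_def)
  fix i j assume ij: "i \<in> I" "j \<in> I"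
  then obtain k where k: "k \<in> I" "leq i k" "leq j k" using assms unfolding directed_def by blast
  have "leq i l" "leq j l" if "l \<in> I" "leq k l" for l
    using assms ij k that unfolding directed_def by meson+
  then show "\<exists>k\<in>I. principal {l \<in> I. leq k l} \<le> inf (principal {l \<in> I. leq i l}) (principal {l \<in> I. leq j l})"
    using k by (intro bexI[of _ k]) auto
qed (auto simp: eventually_principal)

definition hitting :: "'x topology \<Rightarrow> 'x set set \<Rightarrow> 'x set set" where
  "hitting X \<V> = {F. closedin X F \<and> (\<forall>V\<in>\<V>. F \<inter> V \<noteq> {})}"

definition lower_vietoris :: "'x topology \<Rightarrow> 'x set topology" where
  "lower_vietoris X =
     topology_generated_by {hitting X \<V> |\<V>. finite \<V> \<and> (\<forall>V\<in>\<V>. openin X V)}"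

lemma openin_lower_vietoris_hitting:
  assumes "finite \<V>" "\<forall>V\<in>\<V>. openin X V"
  shows "openin (lower_vietoris X) (hitting X \<V>)"
  unfolding lower_vietoris_def
  by (rule topology_generated_by_Basis) (use assms in blast)

lemma openin_lower_vietoris:
  "openin (lower_vietoris X) W \<longleftrightarrow>
     (\<forall>F\<in>W. \<exists>\<V>. finite \<V> \<and> (\<forall>V\<in>\<V>. openin X V) \<and> F \<in> hitting X \<V> \<and> hitting X \<V> \<subseteq> W)"
    (is "_ \<longleftrightarrow> ?R W")
proof
  assume "openin (lower_vietoris X) W"
  then have "generate_topology_on {hitting X \<V> |\<V>. finite \<V> \<and> (\<forall>V\<in>\<V>. openin X V)} W"
    by (simp add: lower_vietoris_def openin_topology_generated_by_iff)
  then show "?R W"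
  proof induction
    case Empty
    show ?case by simp
  next
    case (Int A B)
    show ?case
    proof
      fix F assume F: "F \<in> A \<inter> B"
      obtain \<V> where "finite \<V>" "\<forall>V\<in>\<V>. openin X V" "F \<in> hitting X \<V>" "hitting X \<V> \<subseteq> A"
        using bspec[OF Int.IH(1) IntD1[OF F]] by blast
      moreover obtain \<W> where "finite \<W>" "\<forall>V\<in>\<W>. openin X V" "F \<in> hitting X \<W>" "hitting X \<W> \<subseteq> B"
        using bspec[OF Int.IH(2) IntD2[OF F]] by blast
      moreover have "hitting X (\<V> \<union> \<W>) = hitting X \<V> \<inter> hitting X \<W>" by (auto simp: hitting_def)
      ultimately show "\<exists>\<V>. finite \<V> \<and> (\<forall>V\<in>\<V>. openin X V) \<and> F \<in> hitting X \<V> \<and> hitting X \<V> \<subseteq> A \<inter> B"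
        by (intro exI[of _ "\<V> \<union> \<W>"]) auto
    qed
  next
    case (UN K)
    show ?case
    proof
      fix F assume "F \<in> \<Union>K"
      then obtain A where A: "A \<in> K" "F \<in> A" by blast
      then show "\<exists>\<V>. finite \<V> \<and> (\<forall>V\<in>\<V>. openin X V) \<and> F \<in> hitting X \<V> \<and> hitting X \<V> \<subseteq> \<Union>K"
        using UN.IH[OF A(1)] by (meson Union_upper subset_trans)
    qed
  next
    case (Basis s)
    then show ?case by blast
  qed
next
  assume R: "?R W"
  show "openin (lower_vietoris X) W"
  proof (subst openin_subopen, intro ballI)
    fix F assume "F \<in> W"
    then obtain \<V> where "finite \<V>" "\<forall>V\<in>\<V>. openin X V" "F \<in> hitting X \<V>" "hitting X \<V> \<subseteq> W"
      using R by blast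
    then show "\<exists>T. openin (lower_vietoris X) T \<and> F \<in> T \<and> T \<subseteq> W"
      using openin_lower_vietoris_hitting by (intro exI[of _ "hitting X \<V>"]) blast
  qed
qed

lemma topspace_lower_vietoris: "topspace (lower_vietoris X) = {F. closedin X F}"
proof
  show "topspace (lower_vietoris X) \<subseteq> {F. closedin X F}"
    using openin_topspace[of "lower_vietoris X"] unfolding openin_lower_vietoris
    by (auto simp: hitting_def)
  have "openin (lower_vietoris X) {F. closedin X F}"
    unfolding openin_lower_vietoris by (auto simp: hitting_def intro!: exI[of _ "{}"])
  then show "{F. closedin X F} \<subseteq> topspace (lower_vietoris X)" by (rule openin_subset)
qed

lemma limitin_lower_vietoris:
  "limitin (lower_vietoris X) K H \<F> \<longleftrightarrow>
     closedin X H \<and> eventually (\<lambda>i. closedin X (K i)) \<F> \<and>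
     (\<forall>V. openin X V \<and> H \<inter> V \<noteq> {} \<longrightarrow> eventually (\<lambda>i. K i \<inter> V \<noteq> {}) \<F>)"
proof
  assume L: "limitin (lower_vietoris X) K H \<F>"
  then have cl: "closedin X H" by (auto simp: limitin_def topspace_lower_vietoris)
  have *: "eventually (\<lambda>i. K i \<in> hitting X \<V>) \<F>"
    if "finite \<V>" "\<forall>V\<in>\<V>. openin X V" "H \<in> hitting X \<V>" for \<V>
    using L openin_lower_vietoris_hitting[OF that(1,2)] that(3) by (simp add: limitin_def)
  have "eventually (\<lambda>i. closedin X (K i)) \<F>" using *[of "{}"] cl by (simp add: hitting_def)
  moreover have "eventually (\<lambda>i. K i \<inter> V \<noteq> {}) \<F>" if "openin X V" "H \<inter> V \<noteq> {}" for V
  proof (rule eventually_mono)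
    show "eventually (\<lambda>i. K i \<in> hitting X {V}) \<F>"
      using cl that by (intro *) (auto simp: hitting_def)
  qed (simp add: hitting_def)
  ultimately show "closedin X H \<and> eventually (\<lambda>i. closedin X (K i)) \<F> \<and>
     (\<forall>V. openin X V \<and> H \<inter> V \<noteq> {} \<longrightarrow> eventually (\<lambda>i. K i \<inter> V \<noteq> {}) \<F>)" using cl by blast
next
  assume R: "closedin X H \<and> eventually (\<lambda>i. closedin X (K i)) \<F> \<and>
     (\<forall>V. openin X V \<and> H \<inter> V \<noteq> {} \<longrightarrow> eventually (\<lambda>i. K i \<inter> V \<noteq> {}) \<F>)"
  show "limitin (lower_vietoris X) K H \<F>"
    unfolding limitin_def topspace_lower_vietoris
  proof (intro conjI allI impI)
    show "H \<in> {F. closedin X F}" using R by simp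
    fix W assume "openin (lower_vietoris X) W \<and> H \<in> W"
    then obtain \<V> where V: "finite \<V>" "\<forall>V\<in>\<V>. openin X V" "H \<in> hitting X \<V>" "hitting X \<V> \<subseteq> W"
      unfolding openin_lower_vietoris by blast
    have "eventually (\<lambda>i. \<forall>V\<in>\<V>. K i \<inter> V \<noteq> {}) \<F>"
      using V R by (intro eventually_ball_finite) (auto simp: hitting_def)
    then have "eventually (\<lambda>i. closedin X (K i) \<and> (\<forall>V\<in>\<V>. K i \<inter> V \<noteq> {})) \<F>"
      using R by (simp add: eventually_conj)
    then show "eventually (\<lambda>i. K i \<in> W) \<F>"
      by (rule eventually_mono) (use V(4) in \<open>auto simp: hitting_def\<close>)
  qed
qed


section \<open>Free groups\<close>

text \<open>The free group on \<open>X\<close> consists of the reduced words in the letters \<open>x\<close> and \<open>x\<inverse>\<close> for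
  \<open>x \<in> X\<close>, encoded as \<open>(True, x)\<close> and \<open>(False, x)\<close>. The product is concatenation followed by
  reduction.\<close>

definition cancels :: "bool \<times> 'x \<Rightarrow> bool \<times> 'x \<Rightarrow> bool" where
  "cancels p q \<longleftrightarrow> fst p \<noteq> fst q \<and> snd p = snd q"

fun cons_reduce :: "bool \<times> 'x \<Rightarrow> (bool \<times> 'x) list \<Rightarrow> (bool \<times> 'x) list" where
  "cons_reduce p [] = [p]"
| "cons_reduce p (q # w) = (if cancels p q then w else p # q # w)"

definition free_group :: "'x set \<Rightarrow> (bool \<times> 'x) list monoid" where
  "free_group X =
     \<lparr>carrier = {w. snd ` set w \<subseteq> X \<and> successively (\<lambda>p q. \<not> cancels p q) w},
      mult = foldr cons_reduce,
      one = []\<rparr>"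

lemma free_group_cons_reduce:
  assumes "w \<in> carrier (free_group X)" "snd p \<in> X"
  shows "cons_reduce p w \<in> carrier (free_group X)"
    and "cancels p q \<Longrightarrow> cons_reduce q (cons_reduce p w) = w"
proof -
  show "cons_reduce p w \<in> carrier (free_group X)"
    using assms by (cases w) (auto simp: free_group_def successively_Cons)
  show "cons_reduce q (cons_reduce p w) = w" if "cancels p q"
  proof (cases w)
    case Nil
    then show ?thesis using that by (auto simp: cancels_def)
  next
    case (Cons r v)
    then show ?thesis using assms that
      by (cases v) (auto simp: free_group_def cancels_def successively_Cons prod_eq_iff)
  qed
qed

lemma free_group_reduced_word:
  assumes "w \<in> carrier (free_group X)"
  shows "foldr cons_reduce w [] = w"
  using assms
proof (induction w)
  case (Cons p w)
  then show ?case by (cases w) (auto simp: free_group_def)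
qed simp

lemma free_group_foldr_closed:
  assumes "snd ` set u \<subseteq> X" "v \<in> carrier (free_group X)"
  shows "foldr cons_reduce u v \<in> carrier (free_group X)"
  using assms by (induction u) (auto simp: free_group_cons_reduce)

lemma free_group_foldr_assoc:
  assumes "snd ` set u \<subseteq> X" "v \<in> carrier (free_group X)" "w \<in> carrier (free_group X)"
  shows "foldr cons_reduce (foldr cons_reduce u v) w = foldr cons_reduce u (foldr cons_reduce v w)"
proof -
  have V: "snd ` set v \<subseteq> X" if "v \<in> carrier (free_group X)" for v
    using that by (simp add: free_group_def)
  have *: "foldr cons_reduce (cons_reduce p v) w = cons_reduce p (foldr cons_reduce v w)"
    if "snd p \<in> X" "v \<in> carrier (free_group X)" for p v
  proof (cases v)
    case (Cons q v')
    show ?thesis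
    proof (cases "cancels p q")
      case True
      then have "cancels q p" by (auto simp: cancels_def)
      moreover have "foldr cons_reduce v' w \<in> carrier (free_group X)" "snd q \<in> X"
        using V[OF that(2)] Cons assms(3) by (auto intro!: free_group_foldr_closed)
      ultimately show ?thesis using free_group_cons_reduce(2) Cons True by fastforce
    qed (simp add: Cons)
  qed simp
  show ?thesis using assms(1)
    by (induction u) (auto simp: * free_group_foldr_closed assms(2))
qed

lemma group_free_group: "group (free_group X)"
proof (rule groupI)
  have V: "snd ` set v \<subseteq> X" if "v \<in> carrier (free_group X)" for v
    using that by (simp add: free_group_def)
  have mult: "u \<otimes>\<^bsub>free_group X\<^esub> v = foldr cons_reduce u v" for u v by (simp add: free_group_def)
  have one: "\<one>\<^bsub>free_group X\<^esub> = []" by (simp add: free_group_def)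
  show nil: "\<one>\<^bsub>free_group X\<^esub> \<in> carrier (free_group X)" by (simp add: free_group_def)
  show "x \<otimes>\<^bsub>free_group X\<^esub> y \<in> carrier (free_group X)"
    if "x \<in> carrier (free_group X)" "y \<in> carrier (free_group X)" for x y
    using that V by (simp add: mult free_group_foldr_closed)
  show "x \<otimes>\<^bsub>free_group X\<^esub> y \<otimes>\<^bsub>free_group X\<^esub> z = x \<otimes>\<^bsub>free_group X\<^esub> (y \<otimes>\<^bsub>free_group X\<^esub> z)"
    if "x \<in> carrier (free_group X)" "y \<in> carrier (free_group X)" "z \<in> carrier (free_group X)" for x y z
    using free_group_foldr_assoc[OF V[OF that(1)] that(2,3)] by (simp add: mult)
  show "\<one>\<^bsub>free_group X\<^esub> \<otimes>\<^bsub>free_group X\<^esub> x = x" for x by (simp add: mult one)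
  have "\<exists>y. snd ` set y \<subseteq> X \<and> foldr cons_reduce y (foldr cons_reduce u []) = []"
    if "snd ` set u \<subseteq> X" for u
    using that
  proof (induction u)
    case Nil
    then show ?case by (intro exI[of _ "[]"]) simp
  next
    case (Cons p u)
    then obtain y where y: "snd ` set y \<subseteq> X" "foldr cons_reduce y (foldr cons_reduce u []) = []"
      by auto
    have "foldr cons_reduce u [] \<in> carrier (free_group X)"
      using Cons.prems nil by (intro free_group_foldr_closed) (auto simp: one)
    then have "cons_reduce (\<not> fst p, snd p) (cons_reduce p (foldr cons_reduce u []))
        = foldr cons_reduce u []"
      using Cons.prems by (intro free_group_cons_reduce(2)[of _ X]) (auto simp: cancels_def)
    then show ?case
      using y Cons.prems by (intro exI[of _ "y @ [(\<not> fst p, snd p)]"]) auto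
  qed
  then have inv: "\<exists>y. snd ` set y \<subseteq> X \<and> foldr cons_reduce y x = []" if "x \<in> carrier (free_group X)" for x
    using V[OF that] free_group_reduced_word[OF that] by metis
  show "\<exists>y\<in>carrier (free_group X). y \<otimes>\<^bsub>free_group X\<^esub> x = \<one>\<^bsub>free_group X\<^esub>"
    if x: "x \<in> carrier (free_group X)" for x
  proof -
    obtain y where y: "snd ` set y \<subseteq> X" "foldr cons_reduce y x = []" using inv[OF x] by blast
    have "foldr cons_reduce (foldr cons_reduce y []) x = foldr cons_reduce y (foldr cons_reduce [] x)"
      using y x nil by (intro free_group_foldr_assoc) (auto simp: one)
    then show ?thesis
      using y nil
      by (intro bexI[of _ "foldr cons_reduce y []"] free_group_foldr_closed) (auto simp: mult one)
  qed
qed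

lemma free_group_universal:
  fixes f :: "'x \<Rightarrow> 'g"
  assumes G: "group G" and f: "f \<in> X \<rightarrow> carrier G"
  shows "\<exists>h \<in> hom (free_group X) G. \<forall>x\<in>X. h [(True, x)] = f x"
proof -
  interpret group G by (rule G)
  define val where "val p = (if fst p then f (snd p) else inv\<^bsub>G\<^esub> f (snd p))" for p :: "bool \<times> 'x"
  define h where "h w = foldr (\<lambda>p y. val p \<otimes>\<^bsub>G\<^esub> y) w \<one>\<^bsub>G\<^esub>" for w
  have val: "val p \<in> carrier G" if "snd p \<in> X" for p using f that by (auto simp: val_def)
  have h: "h w \<in> carrier G" if "snd ` set w \<subseteq> X" for w
    using that by (induction w) (auto simp: h_def val)
  have canc: "val p \<otimes>\<^bsub>G\<^esub> (val q \<otimes>\<^bsub>G\<^esub> y) = y" if "cancels p q" "snd p \<in> X" "y \<in> carrier G" for p q y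
  proof -
    have "f (snd q) \<in> carrier G" using that f by (auto simp: cancels_def)
    then show ?thesis using that
      by (auto simp: cancels_def val_def m_assoc[symmetric])
  qed
  have step: "h (cons_reduce p w) = val p \<otimes>\<^bsub>G\<^esub> h w" if "snd p \<in> X" "snd ` set w \<subseteq> X" for p w
  proof (cases w)
    case (Cons q v)
    then show ?thesis using that h[of v] canc[of p q "h v"] by (auto simp: h_def)
  qed (simp add: h_def)
  have red: "snd ` set (foldr cons_reduce u v) \<subseteq> X" if "snd ` set u \<subseteq> X" "v \<in> carrier (free_group X)" for u v
    using free_group_foldr_closed[OF that] by (simp add: free_group_def)
  have "h (foldr cons_reduce u v) = h u \<otimes>\<^bsub>G\<^esub> h v"
    if "snd ` set u \<subseteq> X" "v \<in> carrier (free_group X)" for u v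
    using that(1)
  proof (induction u)
    case Nil
    have "h v \<in> carrier G" using that(2) by (intro h) (simp add: free_group_def)
    then show ?case by (simp add: h_def)
  next
    case (Cons p u)
    have "h v \<in> carrier G" using that(2) by (intro h) (simp add: free_group_def)
    then show ?case
      using Cons step[of p "foldr cons_reduce u v"] red[OF _ that(2), of u] h[of u] val[of p]
      by (auto simp: m_assoc h_def)
  qed
  then have "h \<in> hom (free_group X) G"
    using h by (auto simp: hom_def free_group_def)
  moreover have "h [(True, x)] = f x" if "x \<in> X" for x
    using val[of "(True, x)"] that by (simp add: h_def val_def)
  ultimately show ?thesis by blast
qed

lemma free_group_generated:
  "generate (free_group X) ((\<lambda>x. [(True, x)]) ` X) = carrier (free_group X)"
proof
  interpret group "free_group X" by (rule group_free_group)
  let ?S = "(\<lambda>x. [(True, x)]) ` X"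
  show "generate (free_group X) ?S \<subseteq> carrier (free_group X)"
    by (rule generate_incl) (auto simp: free_group_def)
  have letter: "[p] \<in> generate (free_group X) ?S" if "snd p \<in> X" for p
  proof (cases "fst p")
    case True
    then show ?thesis using that by (cases p) (auto intro!: generate.incl)
  next
    case False
    have "inv\<^bsub>free_group X\<^esub> [(True, snd p)] = [(False, snd p)]"
      using that by (intro inv_equality) (auto simp: free_group_def cancels_def)
    then show ?thesis
      using that False generate.inv[of "[(True, snd p)]" ?S "free_group X"] by (cases p) auto
  qed
  have "w \<in> generate (free_group X) ?S" if "w \<in> carrier (free_group X)" for w
    using that
  proof (induction w)
    case Nil
    have "\<one>\<^bsub>free_group X\<^esub> \<in> generate (free_group X) ?S" by (rule generate.one)
    then show ?case by (simp add: free_group_def)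
  next
    case (Cons p w)
    then have "snd p \<in> X" "w \<in> carrier (free_group X)"
      by (auto simp: free_group_def successively_Cons)
    moreover have "p # w = [p] \<otimes>\<^bsub>free_group X\<^esub> w"
      using Cons.prems by (cases w) (auto simp: free_group_def)
    ultimately show ?case using generate.eng[OF letter Cons.IH, of p] by simp
  qed
  then show "carrier (free_group X) \<subseteq> generate (free_group X) ?S" by blast
qed


section \<open>The Kirchberg property\<close>

definition kirchberg_finite_sets :: "('g, 'm) monoid_scheme \<Rightarrow> 'g topology \<Rightarrow> bool" where
  "kirchberg_finite_sets G T \<longleftrightarrow>
     (\<forall>A B. finite A \<and> finite B \<and> A \<subseteq> carrier G \<and> B \<subseteq> carrier G \<and> elementwise_commute G A B \<longrightarrow>
       (\<forall>OA OB. (\<forall>x\<in>A. openin T (OA x) \<and> x \<in> OA x) \<and> (\<forall>x\<in>B. openin T (OB x) \<and> x \<in> OB x) \<longrightarrow>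
         (\<exists>a b. (\<forall>x\<in>A. a x \<in> OA x) \<and> (\<forall>x\<in>B. b x \<in> OB x) \<and>
           elementwise_commute G (a ` A) (b ` B) \<and>
           relatively_compact T (generate G (a ` A)) \<and>
           relatively_compact T (generate G (b ` B)))))"

definition commuting_compact_net ::
    "('g, 'm) monoid_scheme \<Rightarrow> 'g topology \<Rightarrow> 'g set \<Rightarrow> 'g set \<Rightarrow>
     'i set \<Rightarrow> ('i \<Rightarrow> 'i \<Rightarrow> bool) \<Rightarrow> ('i \<Rightarrow> 'g set) \<Rightarrow> ('i \<Rightarrow> 'g set) \<Rightarrow> bool" where
  "commuting_compact_net G T H1 H2 I leq K1 K2 \<longleftrightarrow>
     directed I leq \<and>
     (\<forall>i\<in>I. subgroup (K1 i) G \<and> compactin T (K1 i) \<and> subgroup (K2 i) G \<and> compactin T (K2 i) \<and>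
        elementwise_commute G (K1 i) (K2 i)) \<and>
     limitin (lower_vietoris T) K1 H1 (net_filter I leq) \<and>
     limitin (lower_vietoris T) K2 H2 (net_filter I leq)"

text \<open>The type of the index set has to be fixed in the formula. Pairs of families of sets suffice:
  by \<open>commuting_compact_net_canonical\<close> below, a net with an index set of any type can be replaced
  by one whose index set is of this type.\<close>

definition kirchberg_subgroups :: "('g, 'm) monoid_scheme \<Rightarrow> 'g topology \<Rightarrow> bool" where
  "kirchberg_subgroups G T \<longleftrightarrow>
     (\<forall>H1 H2. subgroup H1 G \<and> closedin T H1 \<and> subgroup H2 G \<and> closedin T H2 \<and>
        elementwise_commute G H1 H2 \<longrightarrow>
       (\<exists>(I :: ('g set set \<times> 'g set set) set) leq K1 K2.
          commuting_compact_net G T H1 H2 I leq K1 K2))"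

lemma commuting_compact_net_canonical:
  fixes K1 :: "'i \<Rightarrow> 'g set"
  assumes net: "commuting_compact_net G T H1 H2 I leq K1 K2"
  shows "\<exists>(J :: ('g set set \<times> 'g set set) set) leq' L1 L2.
    commuting_compact_net G T H1 H2 J leq' L1 L2"
proof -
  define fam where "fam H = {\<V>. finite \<V> \<and> (\<forall>V\<in>\<V>. openin T V \<and> H \<inter> V \<noteq> {})}" for H
  define J where "J = fam H1 \<times> fam H2"
  define leq' where "leq' p q \<longleftrightarrow> fst p \<subseteq> fst q \<and> snd p \<subseteq> snd q"
    for p q :: "'g set set \<times> 'g set set"
  let ?F = "net_filter I leq"
  have dir: "directed I leq" and lim: "limitin (lower_vietoris T) K1 H1 ?F"
      "limitin (lower_vietoris T) K2 H2 ?F"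
    and K: "\<And>i. i \<in> I \<Longrightarrow> subgroup (K1 i) G \<and> compactin T (K1 i) \<and> subgroup (K2 i) G \<and>
      compactin T (K2 i) \<and> elementwise_commute G (K1 i) (K2 i)"
    using net by (auto simp: commuting_compact_net_def)
  have ev: "eventually (\<lambda>i. closedin T (K i) \<and> (\<forall>V\<in>\<V>. K i \<inter> V \<noteq> {})) ?F"
    if "limitin (lower_vietoris T) K H ?F" "\<V> \<in> fam H" for K H \<V>
    using that unfolding limitin_lower_vietoris
    by (intro eventually_conj eventually_ball_finite) (auto simp: fam_def)
  have "\<exists>i\<in>I. closedin T (K1 i) \<and> (\<forall>V\<in>fst p. K1 i \<inter> V \<noteq> {}) \<and>
      closedin T (K2 i) \<and> (\<forall>V\<in>snd p. K2 i \<inter> V \<noteq> {})" if "p \<in> J" for p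
  proof -
    have "eventually (\<lambda>i. (closedin T (K1 i) \<and> (\<forall>V\<in>fst p. K1 i \<inter> V \<noteq> {})) \<and>
        (closedin T (K2 i) \<and> (\<forall>V\<in>snd p. K2 i \<inter> V \<noteq> {}))) ?F"
      using that by (intro eventually_conj ev[OF lim(1)] ev[OF lim(2)]) (auto simp: J_def)
    then obtain i where "i \<in> I" "\<forall>j\<in>I. leq i j \<longrightarrow> (closedin T (K1 j) \<and> (\<forall>V\<in>fst p. K1 j \<inter> V \<noteq> {})) \<and>
        (closedin T (K2 j) \<and> (\<forall>V\<in>snd p. K2 j \<inter> V \<noteq> {}))"
      unfolding eventually_net_filter[OF dir] by (rule bexE)
    moreover have "leq i i" using dir \<open>i \<in> I\<close> by (simp add: directed_def)
    ultimately show ?thesis by (intro bexI[of _ i]) simp_all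
  qed
  then obtain s where s: "\<And>p. p \<in> J \<Longrightarrow> s p \<in> I \<and> closedin T (K1 (s p)) \<and>
      (\<forall>V\<in>fst p. K1 (s p) \<inter> V \<noteq> {}) \<and> closedin T (K2 (s p)) \<and> (\<forall>V\<in>snd p. K2 (s p) \<inter> V \<noteq> {})"
    by metis
  have base: "({}, {}) \<in> J" by (simp add: J_def fam_def)
  have dir': "directed J leq'"
    unfolding directed_def
  proof (intro conjI ballI impI)
    show "J \<noteq> {}" using base by blast
    fix p q assume pq: "p \<in> J" "q \<in> J"
    show "\<exists>r\<in>J. leq' p r \<and> leq' q r"
      using pq by (intro bexI[of _ "(fst p \<union> fst q, snd p \<union> snd q)"])
        (auto simp: leq'_def J_def fam_def)
  qed (auto simp: leq'_def)
  have lims: "limitin (lower_vietoris T) (\<lambda>p. K1 (s p)) H1 (net_filter J leq')"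
    "limitin (lower_vietoris T) (\<lambda>p. K2 (s p)) H2 (net_filter J leq')"
    unfolding limitin_lower_vietoris eventually_net_filter[OF dir']
  proof -
    have cl: "closedin T H1" "closedin T H2" using lim by (auto simp: limitin_lower_vietoris)
    have c: "\<exists>i\<in>J. \<forall>j\<in>J. leq' i j \<longrightarrow> closedin T (K1 (s j))"
        "\<exists>i\<in>J. \<forall>j\<in>J. leq' i j \<longrightarrow> closedin T (K2 (s j))"
      using s base by blast+
    have "\<exists>i\<in>J. \<forall>j\<in>J. leq' i j \<longrightarrow> K1 (s j) \<inter> V \<noteq> {}" if "openin T V" "H1 \<inter> V \<noteq> {}" for V
    proof (intro bexI[of _ "({V}, {})"] ballI impI)
      fix j assume "j \<in> J" "leq' ({V}, {}) j"
      then show "K1 (s j) \<inter> V \<noteq> {}" using s[of j] by (auto simp: leq'_def)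
    qed (use that in \<open>auto simp: J_def fam_def\<close>)
    then show "closedin T H1 \<and> (\<exists>i\<in>J. \<forall>j\<in>J. leq' i j \<longrightarrow> closedin T (K1 (s j))) \<and>
        (\<forall>V. openin T V \<and> H1 \<inter> V \<noteq> {} \<longrightarrow> (\<exists>i\<in>J. \<forall>j\<in>J. leq' i j \<longrightarrow> K1 (s j) \<inter> V \<noteq> {}))"
      using cl c by blast
    have "\<exists>i\<in>J. \<forall>j\<in>J. leq' i j \<longrightarrow> K2 (s j) \<inter> V \<noteq> {}" if "openin T V" "H2 \<inter> V \<noteq> {}" for V
    proof (intro bexI[of _ "({}, {V})"] ballI impI)
      fix j assume "j \<in> J" "leq' ({}, {V}) j"
      then show "K2 (s j) \<inter> V \<noteq> {}" using s[of j] by (auto simp: leq'_def)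
    qed (use that in \<open>auto simp: J_def fam_def\<close>)
    then show "closedin T H2 \<and> (\<exists>i\<in>J. \<forall>j\<in>J. leq' i j \<longrightarrow> closedin T (K2 (s j))) \<and>
        (\<forall>V. openin T V \<and> H2 \<inter> V \<noteq> {} \<longrightarrow> (\<exists>i\<in>J. \<forall>j\<in>J. leq' i j \<longrightarrow> K2 (s j) \<inter> V \<noteq> {}))"
      using cl c by blast
  qed
  have "commuting_compact_net G T H1 H2 J leq' (\<lambda>p. K1 (s p)) (\<lambda>p. K2 (s p))"
    unfolding commuting_compact_net_def using dir' lims s K by blast
  then show ?thesis by blast
qed

definition rep_space ::
    "('c, 'n) monoid_scheme \<Rightarrow> ('g, 'm) monoid_scheme \<Rightarrow> 'g topology \<Rightarrow> ('c \<Rightarrow> 'g) topology" where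
  "rep_space \<Gamma> G T = subtopology (product_topology (\<lambda>_. T) (carrier \<Gamma>)) (hom \<Gamma> G)"

definition kirchberg_representations :: "('g, 'm) monoid_scheme \<Rightarrow> 'g topology \<Rightarrow> bool" where
  "kirchberg_representations G T \<longleftrightarrow>
     (let F = free_group (UNIV :: nat set); R = rep_space (F \<times>\<times> F) G T
      in R closure_of {h \<in> topspace R. relatively_compact T (h ` carrier (F \<times>\<times> F))} = topspace R)"

text \<open>The three conditions are equivalent to each other for topological groups; the property is
  stated as their conjunction.\<close>

definition kirchberg_property :: "('g, 'm) monoid_scheme \<Rightarrow> 'g topology \<Rightarrow> bool" where
  "kirchberg_property G T \<longleftrightarrow>
     topological_group G T \<and>
     kirchberg_finite_sets G T \<and> kirchberg_subgroups G T \<and> kirchberg_representations G T"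

end

theory Submission
  imports Defs
begin

text \<open>The proof gives more than the Kirchberg property asks for: commuting finite sets of isometries of
  \<open>U\<close> are approximated by commuting finite sets that generate \<^emph>\<open>finite\<close> groups.

  Commuting finite sets \<open>A\<close> and \<open>B\<close> amount to a representation \<open>\<sigma>\<close> of \<open>\<Gamma> = F(A) \<times> F(B)\<close> on \<open>U\<close>, and
  \<open>\<Gamma>\<close> has enough finite quotients to separate any finite set of elements from the identity
  (\<open>free_group_product_finite_quotient\<close>). So it suffices that every
  representation by isometries of \<open>U\<close> of such a group is a limit of representations with finite
  image (\<open>finite_representations_dense\<close>).

  Let a finite set \<open>X \<subseteq> U\<close> and a finite set \<open>T \<subseteq> \<Gamma>\<close> be given. The orbit map sends \<open>(\<gamma>, x)\<close> to
  \<open>\<sigma> \<gamma> x\<close> and pulls the metric of \<open>U\<close> back to an invariant pseudometric on \<open>\<Gamma> \<times> X\<close>. Replace it by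
  a path metric: a step by a letter of \<open>T\<close> costs the distance in \<open>U\<close> plus a toll \<open>\<epsilon>\<close>. This path metric
  descends to \<open>H \<times> X\<close> along a homomorphism \<open>\<theta>\<close> from \<open>\<Gamma>\<close> to a finite group \<open>H\<close>. Identifications
  of points by \<open>\<theta>\<close> are harmless as soon as they need long words, since the toll makes long paths
  expensive; hence if \<open>\<theta>\<close> kills no short word that is nontrivial in \<open>\<Gamma>\<close>, distances in the part \<open>\<theta> ` T \<times> X\<close> differ from those in
  \<open>U\<close> by at most \<open>2 * \<epsilon>\<close>.

  The space \<open>H \<times> X\<close> is finite and \<open>H\<close> acts on it by left translations. Universality and
  homogeneity of \<open>U\<close> place it in \<open>U\<close> such that \<open>(\<theta> t, x)\<close> is near \<open>\<sigma> t x\<close>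
  (\<open>glue_approximate_isometry\<close>, \<open>urysohn_space_finite_extension\<close>). Finally, an action of a finite group
  on a finite subset of \<open>U\<close> extends to all of \<open>U\<close>
  (\<open>finite_action_extends_to_urysohn_space\<close>): the points of a dense sequence are added one by
  one, each with a whole orbit, and these orbits are realized by distance functions. The action of \<open>\<theta> t\<close> on \<open>U\<close> is then near \<open>\<sigma> t\<close> on \<open>X\<close>.\<close>

section \<open>Isometries of a metric space\<close>

lemma carrier_isometry_group_iff:
  "g \<in> carrier (isometry_group M d) \<longleftrightarrow>
     g \<in> extensional M \<and> bij_betw g M M \<and> (\<forall>x\<in>M. \<forall>y\<in>M. d (g x) (g y) = d x y)"
  by (auto simp: isometry_group_def Bij_def isometric_embedding_def bij_betw_def)

lemma isometry_group_apply_in: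
  "g \<in> carrier (isometry_group M d) \<Longrightarrow> x \<in> M \<Longrightarrow> g x \<in> M"
  by (auto simp: carrier_isometry_group_iff bij_betw_def)

lemma isometry_group_dist:
  "g \<in> carrier (isometry_group M d) \<Longrightarrow> x \<in> M \<Longrightarrow> y \<in> M \<Longrightarrow> d (g x) (g y) = d x y"
  by (auto simp: carrier_isometry_group_iff)

lemma isometry_group_mult_apply:
  "g \<in> carrier (isometry_group M d) \<Longrightarrow> f \<in> carrier (isometry_group M d) \<Longrightarrow> x \<in> M \<Longrightarrow>
     (g \<otimes>\<^bsub>isometry_group M d\<^esub> f) x = g (f x)"
  by (auto simp: isometry_group_def BijGroup_def compose_def)

lemma isometry_group_one_apply: "x \<in> M \<Longrightarrow> \<one>\<^bsub>isometry_group M d\<^esub> x = x"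
  by (auto simp: isometry_group_def BijGroup_def)

lemma isometry_group_eqI:
  assumes "g \<in> carrier (isometry_group M d)" "f \<in> carrier (isometry_group M d)"
    and "\<And>x. x \<in> M \<Longrightarrow> g x = f x"
  shows "g = f"
  using assms by (auto simp: carrier_isometry_group_iff intro: extensionalityI)

context Metric_space
begin

lemma isometries_eq_on_dense:
  assumes D: "D \<subseteq> M" "\<And>x e. x \<in> M \<Longrightarrow> e > 0 \<Longrightarrow> \<exists>p\<in>D. d x p < e"
    and f: "isometric_embedding M d M d f" and g: "isometric_embedding M d M d g"
    and eq: "\<And>p. p \<in> D \<Longrightarrow> f p = g p" and x: "x \<in> M"
  shows "f x = g x"
proof (rule ccontr)
  assume ne: "f x \<noteq> g x"
  have fM: "f y \<in> M" and gM: "g y \<in> M" if "y \<in> M" for y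
    using f g that by (auto simp: isometric_embedding_def)
  have pos: "d (f x) (g x) > 0" using ne fM gM x by simp
  then obtain p where p: "p \<in> D" "d x p < d (f x) (g x) / 2" using D(2)[OF x, of "d (f x) (g x) / 2"] by auto
  have pM: "p \<in> M" using p D by auto
  have "d (f x) (g x) \<le> d (f x) (f p) + d (f p) (g x)" using x pM fM gM by (intro triangle) auto
  also have "d (f x) (f p) = d x p" using f x pM by (simp add: isometric_embedding_def)
  also have "d (f p) (g x) = d p x" using g x pM eq[OF p(1)] by (simp add: isometric_embedding_def)
  finally show False using p(2) commute[of x p] by linarith
qed

text \<open>The image of \<open>x\<close> is the limit of the images of points of \<open>D\<close> that approximate \<open>x\<close>. It is
  pinned down by its distances to the points of \<open>f ` D\<close>, and these determine the distances between
  the images.\<close>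

lemma isometry_extends_from_dense:
  assumes complete: mcomplete
    and D: "D \<subseteq> M" "\<And>x e. x \<in> M \<Longrightarrow> e > 0 \<Longrightarrow> \<exists>p\<in>D. d x p < e"
    and f: "isometric_embedding D d M d f"
  shows "\<exists>g. isometric_embedding M d M d g \<and> (\<forall>p\<in>D. g p = f p)"
proof -
  have fM: "f p \<in> M" if "p \<in> D" for p using f that by (auto simp: isometric_embedding_def)
  have fd: "d (f p) (f q) = d p q" if "p \<in> D" "q \<in> D" for p q
    using f that by (simp add: isometric_embedding_def)
  have "\<exists>y\<in>M. \<forall>p\<in>D. d y (f p) = d x p" if x: "x \<in> M" for x
  proof -
    have "\<exists>a. \<forall>n. a n \<in> D \<and> d x (a n) < inverse (real (Suc n))"
      using D(2)[OF x] by (intro choice allI) (auto simp: Bex_def)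
    then obtain a where a: "\<And>n. a n \<in> D" "\<And>n. d x (a n) < inverse (real (Suc n))" by blast
    have aM: "a n \<in> M" for n using a D by auto
    have lim: "limitin mtopology a x sequentially"
      unfolding limitin_metric_dist_null
    proof (intro conjI x)
      show "\<forall>\<^sub>F n in sequentially. a n \<in> M" using aM by simp
      show "(\<lambda>n. d (a n) x) \<longlonglongrightarrow> 0"
      proof (rule tendsto_sandwich[OF _ _ tendsto_const LIMSEQ_inverse_real_of_nat])
        show "\<forall>\<^sub>F n in sequentially. d (a n) x \<le> inverse (real (Suc n))"
          using a(2) by (simp add: commute less_imp_le)
      qed simp
    qed
    then have "MCauchy a" using aM by (intro convergent_imp_MCauchy) auto
    then have "MCauchy (f \<circ> a)"
      using a(1) fM by (auto simp: MCauchy_def fd)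
    then obtain y where y: "limitin mtopology (f \<circ> a) y sequentially"
      using complete by (auto simp: mcomplete_def)
    then have yM: "y \<in> M" by (simp add: limitin_metric)
    have "d x p = d y (f p)" if p: "p \<in> D" for p
    proof (rule LIMSEQ_unique)
      have pM: "p \<in> M" "f p \<in> M" using p D fM by auto
      have conv: "(\<lambda>n. d (b n) q) \<longlonglongrightarrow> d z q"
        if "limitin mtopology b z sequentially" "q \<in> M" "\<And>n. b n \<in> M" for b z q
      proof (rule LIM_zero_cancel)
        have zM: "z \<in> M" using that(1) by (simp add: limitin_metric)
        show "(\<lambda>n. d (b n) q - d z q) \<longlonglongrightarrow> 0"
        proof (rule Lim_null_comparison)
          show "(\<lambda>n. d (b n) z) \<longlonglongrightarrow> 0" using that(1) by (simp add: limitin_metric_dist_null)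
          show "\<forall>\<^sub>F n in sequentially. norm (d (b n) q - d z q) \<le> d (b n) z"
            using mdist_reverse_triangle[OF zM \<open>q \<in> M\<close> that(3)] commute
            by (intro always_eventually allI) (smt (verit) real_norm_def)
        qed
      qed
      show "(\<lambda>n. d (a n) p) \<longlonglongrightarrow> d x p" using conv[OF lim pM(1) aM] .
      have "(\<lambda>n. d ((f \<circ> a) n) (f p)) \<longlonglongrightarrow> d y (f p)" using conv[OF y pM(2)] a(1) fM by simp
      then show "(\<lambda>n. d (a n) p) \<longlonglongrightarrow> d y (f p)" using a(1) p by (simp add: fd)
    qed
    then show ?thesis using yM by force
  qed
  then have "\<forall>x\<in>M. \<exists>y. y \<in> M \<and> (\<forall>p\<in>D. d y (f p) = d x p)" by blast
  then obtain g where g: "\<And>x. x \<in> M \<Longrightarrow> g x \<in> M" "\<And>x p. x \<in> M \<Longrightarrow> p \<in> D \<Longrightarrow> d (g x) (f p) = d x p"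
    by metis
  have "d (g x) (g y) = d x y" if xy: "x \<in> M" "y \<in> M" for x y
  proof -
    have "\<bar>d (g x) (g y) - d x y\<bar> \<le> e" if e: "e > 0" for e
    proof -
      obtain p where p: "p \<in> D" "d x p < e / 2" using D(2)[OF xy(1), of "e / 2"] e by auto
      have pM: "p \<in> M" "f p \<in> M" using p D fM by auto
      have "\<bar>d (g x) (g y) - d (g y) (f p)\<bar> \<le> d (g x) (f p)"
        using mdist_reverse_triangle[of "g x" "g y" "f p"] xy pM g by simp
      moreover have "\<bar>d x y - d y p\<bar> \<le> d x p"
        using mdist_reverse_triangle[of x y p] xy pM by simp
      ultimately show ?thesis using g(2)[OF xy(1) p(1)] g(2)[OF xy(2) p(1)] p(2) by linarith
    qed
    then show ?thesis by (metis abs_le_zero_iff eq_iff_diff_eq_0 field_le_epsilon add_0)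
  qed
  moreover have "g p = f p" if "p \<in> D" for p
    using g[of p] fM D that by (metis mdist_zero subsetD zero)
  ultimately show ?thesis using g(1) by (intro exI[of _ g]) (auto simp: isometric_embedding_def)
qed

lemma finite_imp_separable_space: "finite M \<Longrightarrow> separable_space mtopology"
  unfolding separable_space_def by (intro exI[of _ M]) (auto simp: countable_finite closure_of_topspace[of mtopology, simplified])

end

section \<open>Extending finite actions over the Urysohn space\<close>

text \<open>Universality puts a copy of \<open>E\<close> somewhere into \<open>U\<close>, and homogeneity moves this copy so that the
  part that comes from \<open>F\<close> lands where \<open>\<phi>\<close> prescribes.\<close>

lemma urysohn_space_finite_extension:
  assumes U: "urysohn_space U d"
    and E: "Metric_space E dE" "finite E" and F: "F \<subseteq> E"
    and \<phi>: "isometric_embedding F dE U d \<phi>"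
  shows "\<exists>j. isometric_embedding E dE U d j \<and> (\<forall>x\<in>F. j x = \<phi> x)"
proof -
  interpret U: Metric_space U d using U by (simp add: urysohn_space_def)
  interpret E: Metric_space E dE by (rule E)
  obtain i where i: "isometric_embedding E dE U d i"
    using urysohn_space_universal[OF U E(1)] E.finite_imp_separable_space[OF E(2)] by blast
  have iU: "i x \<in> U" and \<phi>U: "x \<in> F \<Longrightarrow> \<phi> x \<in> U" if "x \<in> E" for x
    using i \<phi> that by (auto simp: isometric_embedding_def)
  have id: "d (i x) (i y) = dE x y" if "x \<in> E" "y \<in> E" for x y
    using i that by (simp add: isometric_embedding_def)
  have \<phi>d: "d (\<phi> x) (\<phi> y) = dE x y" if "x \<in> F" "y \<in> F" for x y
    using \<phi> that by (simp add: isometric_embedding_def)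
  have inj: "inj_on i F"
    using id iU F by (intro inj_onI) (metis E.zero U.mdist_zero subsetD)
  define f where "f = \<phi> \<circ> inv_into F i"
  have fi: "f (i x) = \<phi> x" if "x \<in> F" for x using inj that by (simp add: f_def)
  have "finite F" using E F finite_subset by blast
  moreover have "isometric_embedding (i ` F) d (\<phi> ` F) d f"
    using F by (auto simp: isometric_embedding_def fi \<phi>d id subset_iff)
  moreover have "f ` i ` F = \<phi> ` F" using fi by force
  moreover have "i ` F \<subseteq> U" "\<phi> ` F \<subseteq> U" using F iU \<phi>U by auto
  ultimately obtain g where g: "g \<in> carrier (isometry_group U d)" "\<And>x. x \<in> i ` F \<Longrightarrow> g x = f x"
    using U unfolding urysohn_space_def by (metis finite_imageI)
  have "isometric_embedding E dE U d (g \<circ> i)"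
    using iU id g(1) by (auto simp: isometric_embedding_def isometry_group_dist isometry_group_apply_in)
  moreover have "(g \<circ> i) x = \<phi> x" if "x \<in> F" for x using that g(2) fi by simp
  ultimately show ?thesis by blast
qed

definition isometric_action_on ::
    "('h, 'm) monoid_scheme \<Rightarrow> 'a set \<Rightarrow> ('a \<Rightarrow> 'a \<Rightarrow> real) \<Rightarrow> ('h \<Rightarrow> 'a \<Rightarrow> 'a) \<Rightarrow> bool" where
  "isometric_action_on H Z d \<alpha> \<longleftrightarrow>
     (\<forall>h\<in>carrier H. isometric_embedding Z d Z d (\<alpha> h)) \<and>
     (\<forall>x\<in>Z. \<alpha> \<one>\<^bsub>H\<^esub> x = x) \<and>
     (\<forall>h\<in>carrier H. \<forall>k\<in>carrier H. \<forall>x\<in>Z. \<alpha> (h \<otimes>\<^bsub>H\<^esub> k) x = \<alpha> h (\<alpha> k x))"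

lemma isometric_action_onD:
  assumes "isometric_action_on H Z d \<alpha>"
  shows "h \<in> carrier H \<Longrightarrow> x \<in> Z \<Longrightarrow> \<alpha> h x \<in> Z"
    and "h \<in> carrier H \<Longrightarrow> x \<in> Z \<Longrightarrow> y \<in> Z \<Longrightarrow> d (\<alpha> h x) (\<alpha> h y) = d x y"
    and "x \<in> Z \<Longrightarrow> \<alpha> \<one>\<^bsub>H\<^esub> x = x"
    and "h \<in> carrier H \<Longrightarrow> k \<in> carrier H \<Longrightarrow> x \<in> Z \<Longrightarrow> \<alpha> (h \<otimes>\<^bsub>H\<^esub> k) x = \<alpha> h (\<alpha> k x)"
  using assms by (auto simp: isometric_action_on_def isometric_embedding_def)

text \<open>The element \<open>0\<close> is the value for empty \<open>Z\<close>; otherwise it does not affect the maximum.\<close>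

definition sup_dist :: "'a set \<Rightarrow> ('a \<Rightarrow> real) \<Rightarrow> ('a \<Rightarrow> real) \<Rightarrow> real" where
  "sup_dist Z f g = Max (insert 0 ((\<lambda>x. \<bar>f x - g x\<bar>) ` Z))"

lemma sup_dist_le_iff:
  assumes "finite Z"
  shows "sup_dist Z f g \<le> r \<longleftrightarrow> 0 \<le> r \<and> (\<forall>x\<in>Z. \<bar>f x - g x\<bar> \<le> r)"
  using assms unfolding sup_dist_def by (subst Max_le_iff) auto

lemma sup_dist_ge:
  assumes "finite Z" "x \<in> Z"
  shows "\<bar>f x - g x\<bar> \<le> sup_dist Z f g"
  using sup_dist_le_iff[OF assms(1), of f g "sup_dist Z f g"] assms(2) by simp

lemma Metric_space_sup_dist:
  assumes Z: "finite Z" and E: "E \<subseteq> extensional Z"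
  shows "Metric_space E (sup_dist Z)"
proof
  show nn: "0 \<le> sup_dist Z f g" for f g
    using sup_dist_le_iff[OF Z, of f g "sup_dist Z f g"] by simp
  show "sup_dist Z f g = sup_dist Z g f" for f g by (simp add: sup_dist_def abs_minus_commute)
  show "sup_dist Z f g = 0 \<longleftrightarrow> f = g" if "f \<in> E" "g \<in> E" for f g
  proof
    assume "sup_dist Z f g = 0"
    then have "f x = g x" if "x \<in> Z" for x using sup_dist_ge[OF Z that, of f g] by simp
    then show "f = g" using that E by (intro extensionalityI[of f Z g]) auto
  next
    assume "f = g"
    then show "sup_dist Z f g = 0"
      using sup_dist_le_iff[OF Z, of f g 0] nn[of f g] by auto
  qed
  show "sup_dist Z f h \<le> sup_dist Z f g + sup_dist Z g h" for f g h
    unfolding sup_dist_le_iff[OF Z]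
  proof (intro conjI ballI)
    show "0 \<le> sup_dist Z f g + sup_dist Z g h" using nn[of f g] nn[of g h] by simp
    fix x assume "x \<in> Z"
    then show "\<bar>f x - h x\<bar> \<le> sup_dist Z f g + sup_dist Z g h"
      using sup_dist_ge[OF Z, of x f g] sup_dist_ge[OF Z, of x g h] by linarith
  qed
qed

text \<open>The new orbit is found among the functions on \<open>Z\<close>. In the supremum metric a point \<open>v\<close> of
  \<open>Z \<union> {u}\<close> can be replaced by its distance function \<open>x \<mapsto> d v x\<close> on \<open>Z\<close> without changing the
  distances, and the group acts on the functions by translation. The translates of the distance
  functions form a finite metric space with an action, which embeds into \<open>U\<close> over \<open>Z \<union> {u}\<close>.\<close>

lemma finite_action_absorbs_point:
  assumes U: "urysohn_space U d" and H: "group H" "finite (carrier H)"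
    and Z: "finite Z" "Z \<subseteq> U" and \<alpha>: "isometric_action_on H Z d \<alpha>" and u: "u \<in> U"
  shows "\<exists>Z' \<alpha>'. finite Z' \<and> insert u Z \<subseteq> Z' \<and> Z' \<subseteq> U \<and> isometric_action_on H Z' d \<alpha>' \<and>
    (\<forall>h\<in>carrier H. \<forall>x\<in>Z. \<alpha>' h x = \<alpha> h x)"
proof -
  interpret U: Metric_space U d using U by (simp add: urysohn_space_def)
  interpret H: group H by (rule H)
  note \<alpha>D = isometric_action_onD[OF \<alpha>]
  define \<kappa> where "\<kappa> v = (\<lambda>x\<in>Z. d v x)" for v
  define act where "act h f = (\<lambda>x\<in>Z. f (\<alpha> (inv\<^bsub>H\<^esub> h) x))" for h and f :: "'a \<Rightarrow> real"
  define E where "E = (\<lambda>(h, v). act h (\<kappa> v)) ` (carrier H \<times> insert u Z)"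
  have inv1: "\<alpha> h (\<alpha> (inv\<^bsub>H\<^esub> h) x) = x" "\<alpha> (inv\<^bsub>H\<^esub> h) (\<alpha> h x) = x" if "h \<in> carrier H" "x \<in> Z" for h x
    using \<alpha>D(4)[of h "inv\<^bsub>H\<^esub> h" x] \<alpha>D(4)[of "inv\<^bsub>H\<^esub> h" h x] that by (simp_all add: \<alpha>D(3))
  have act_mult: "act (h \<otimes>\<^bsub>H\<^esub> k) f = act h (act k f)"
    if "h \<in> carrier H" "k \<in> carrier H" for h k f
    using that by (auto simp: act_def H.inv_mult_group \<alpha>D intro!: restrict_ext)
  have act_one: "act \<one>\<^bsub>H\<^esub> f = f" if "f \<in> extensional Z" for f
    using that by (auto simp: act_def \<alpha>D(3) extensional_def)
  have E_ext: "E \<subseteq> extensional Z" by (auto simp: E_def act_def)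
  interpret E: Metric_space E "sup_dist Z" by (rule Metric_space_sup_dist[OF Z(1) E_ext])
  have finE: "finite E" using H(2) Z(1) by (auto simp: E_def)
  have actE: "act h f \<in> E" if "h \<in> carrier H" "f \<in> E" for h f
    using that by (force simp: E_def act_mult[symmetric])
  have \<kappa>E: "\<kappa> v \<in> E" if "v \<in> insert u Z" for v
    unfolding E_def using that by (intro image_eqI[of _ _ "(\<one>\<^bsub>H\<^esub>, v)"]) (auto simp: act_one \<kappa>_def)
  have act\<kappa>: "act h (\<kappa> z) = \<kappa> (\<alpha> h z)" if "h \<in> carrier H" "z \<in> Z" for h z
  proof -
    have "d z (\<alpha> (inv\<^bsub>H\<^esub> h) x) = d (\<alpha> h z) x" if x: "x \<in> Z" for x
      using \<alpha>D(2)[of h z "\<alpha> (inv\<^bsub>H\<^esub> h) x"] inv1(1)[of h x] \<alpha>D(1)[of "inv\<^bsub>H\<^esub> h" x] that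
        \<open>h \<in> carrier H\<close> \<open>z \<in> Z\<close> by simp
    then show ?thesis using that \<alpha>D(1)[of "inv\<^bsub>H\<^esub> h"] by (auto simp: act_def \<kappa>_def intro!: restrict_ext)
  qed
  have act_iso: "sup_dist Z (act h f) (act h g) = sup_dist Z f g" if h: "h \<in> carrier H" for h f g
  proof -
    have le: "sup_dist Z (act k f') (act k g') \<le> sup_dist Z f' g'" if k: "k \<in> carrier H" for k f' g'
      unfolding sup_dist_le_iff[OF Z(1)]
    proof (intro conjI ballI)
      show "0 \<le> sup_dist Z f' g'" using sup_dist_le_iff[OF Z(1), of f' g' "sup_dist Z f' g'"] by simp
      fix x assume "x \<in> Z"
      then show "\<bar>act k f' x - act k g' x\<bar> \<le> sup_dist Z f' g'"
        using sup_dist_ge[OF Z(1), of "\<alpha> (inv\<^bsub>H\<^esub> k) x" f' g'] \<alpha>D(1)[of "inv\<^bsub>H\<^esub> k" x] k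
        by (simp add: act_def)
    qed
    have "act (inv\<^bsub>H\<^esub> h) (act h f') = restrict f' Z" for f'
      using h inv1[of h] \<alpha>D(1)[of h] by (auto simp: act_def intro!: restrict_ext)
    then have "sup_dist Z (restrict f Z) (restrict g Z) \<le> sup_dist Z (act h f) (act h g)"
      using le[of "inv\<^bsub>H\<^esub> h" "act h f" "act h g"] h by simp
    moreover have "sup_dist Z (restrict f Z) (restrict g Z) = sup_dist Z f g"
      by (simp add: sup_dist_def cong: image_cong)
    ultimately show ?thesis using le[OF h, of f g] by simp
  qed
  have \<kappa>_iso: "sup_dist Z (\<kappa> v) (\<kappa> w) = d v w" if vw: "v \<in> insert u Z" "w \<in> insert u Z" for v w
  proof (rule antisym)
    have vwU: "v \<in> U" "w \<in> U" using vw u Z by auto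
    show "sup_dist Z (\<kappa> v) (\<kappa> w) \<le> d v w"
      unfolding sup_dist_le_iff[OF Z(1)]
    proof (intro conjI ballI)
      fix x assume "x \<in> Z"
      then show "\<bar>\<kappa> v x - \<kappa> w x\<bar> \<le> d v w"
        using U.mdist_reverse_triangle[of v x w] vwU Z U.commute[of w x] by (auto simp: \<kappa>_def subset_iff)
    qed simp
    consider "v = w" | "v \<in> Z" | "w \<in> Z" using vw by auto
    then show "d v w \<le> sup_dist Z (\<kappa> v) (\<kappa> w)"
    proof cases
      case 1
      then show ?thesis using vwU sup_dist_le_iff[OF Z(1), of "\<kappa> v" "\<kappa> w" "sup_dist Z (\<kappa> v) (\<kappa> w)"] by simp
    next
      case 2
      then show ?thesis using sup_dist_ge[OF Z(1), of v "\<kappa> v" "\<kappa> w"] vwU by (simp add: \<kappa>_def U.commute)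
    next
      case 3
      then show ?thesis using sup_dist_ge[OF Z(1), of w "\<kappa> v" "\<kappa> w"] vwU by (simp add: \<kappa>_def U.commute)
    qed
  qed
  have inj: "inj_on \<kappa> (insert u Z)"
  proof (rule inj_onI)
    fix v w assume vw: "v \<in> insert u Z" "w \<in> insert u Z" "\<kappa> v = \<kappa> w"
    then have "d v w = 0" using \<kappa>_iso[of v w] \<kappa>E by simp
    then show "v = w" using vw u Z by (subst (asm) U.zero) auto
  qed
  define \<phi> where "\<phi> = inv_into (insert u Z) \<kappa>"
  have \<phi>: "\<phi> (\<kappa> v) = v" if "v \<in> insert u Z" for v using inv_into_f_f[OF inj that] by (simp add: \<phi>_def)
  have "isometric_embedding (\<kappa> ` insert u Z) (sup_dist Z) U d \<phi>"
    unfolding isometric_embedding_def using u Z \<phi> \<kappa>_iso by (auto simp: Pi_iff)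
  moreover have "\<kappa> ` insert u Z \<subseteq> E" using \<kappa>E by blast
  ultimately obtain j where j: "isometric_embedding E (sup_dist Z) U d j"
      "\<And>f. f \<in> \<kappa> ` insert u Z \<Longrightarrow> j f = \<phi> f"
    using urysohn_space_finite_extension[OF U E.Metric_space_axioms finE] by metis
  have j\<kappa>: "j (\<kappa> v) = v" if "v \<in> insert u Z" for v using j(2)[of "\<kappa> v"] \<phi> that by auto
  have jU: "j f \<in> U" if "f \<in> E" for f using j(1) that by (auto simp: isometric_embedding_def)
  have jd: "d (j f) (j g) = sup_dist Z f g" if "f \<in> E" "g \<in> E" for f g
    using j(1) that by (simp add: isometric_embedding_def)
  have injj: "inj_on j E"
    using jd jU by (intro inj_onI) (metis E.zero U.mdist_zero)
  define \<alpha>' where "\<alpha>' h y = j (act h (inv_into E j y))" for h y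
  have \<alpha>'j: "\<alpha>' h (j f) = j (act h f)" if "f \<in> E" for h f
    using that injj by (simp add: \<alpha>'_def)
  have "isometric_action_on H (j ` E) d \<alpha>'"
    unfolding isometric_action_on_def isometric_embedding_def
    using E_ext by (auto simp: \<alpha>'j actE jd act_iso act_mult act_one subset_iff)
  moreover have "insert u Z \<subseteq> j ` E" using j\<kappa> \<kappa>E by (metis image_eqI subsetI)
  moreover have "\<alpha>' h x = \<alpha> h x" if "h \<in> carrier H" "x \<in> Z" for h x
    using \<alpha>'j[of "\<kappa> x" h] j\<kappa>[of x] j\<kappa>[of "\<alpha> h x"] \<kappa>E[of x] act\<kappa>[OF that] \<alpha>D(1)[OF that] that by simp
  ultimately show ?thesis using finE jU by (intro exI[of _ "j ` E"] exI[of _ \<alpha>']) auto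
qed

text \<open>Absorbing the members of a dense sequence one after the other, the action of \<open>H\<close> extends to
  a dense subset of \<open>U\<close>; by completeness it extends further to all of \<open>U\<close>.\<close>

theorem finite_action_extends_to_urysohn_space:
  assumes U: "urysohn_space U d" and H: "group H" "finite (carrier H)"
    and Z: "finite Z" "Z \<subseteq> U" and \<alpha>: "isometric_action_on H Z d \<alpha>"
  shows "\<exists>\<tau> \<in> hom H (isometry_group U d). \<forall>h\<in>carrier H. \<forall>x\<in>Z. \<tau> h x = \<alpha> h x"
proof -
  interpret U: Metric_space U d using U by (simp add: urysohn_space_def)
  interpret H: group H by (rule H)
  obtain C where C: "countable C" "C \<subseteq> U" "U.mtopology closure_of C = U"
    using U by (auto simp: urysohn_space_def separable_space_def)
  \<comment> \<open>A one-point space embeds into \<open>U\<close>, so \<open>U\<close> has points and a dense sequence.\<close>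
  have "\<exists>f. isometric_embedding {0::real} (\<lambda>x y. 0) U d f"
  proof (rule urysohn_space_universal[OF U])
    show S: "Metric_space {0::real} (\<lambda>x y. 0)" by unfold_locales auto
    show "separable_space (Metric_space.mtopology {0::real} (\<lambda>x y. 0))"
      by (rule Metric_space.finite_imp_separable_space[OF S]) simp
  qed
  then have "U \<noteq> {}" by (auto simp: isometric_embedding_def)
  then have "C \<noteq> {}" using C by auto
  then obtain c :: "nat \<Rightarrow> 'a" where c: "range c = C" using C(1) by (metis uncountable_def)
  define good where "good p \<longleftrightarrow> finite (fst p) \<and> fst p \<subseteq> U \<and> isometric_action_on H (fst p) d (snd p)"
    for p :: "'a set \<times> ('b \<Rightarrow> 'a \<Rightarrow> 'a)"
  define extends where "extends n p q \<longleftrightarrow> insert (c n) (fst p) \<subseteq> fst q \<and>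
      (\<forall>h\<in>carrier H. \<forall>x\<in>fst p. snd q h x = snd p h x)"
    for n and p q :: "'a set \<times> ('b \<Rightarrow> 'a \<Rightarrow> 'a)"
  have "\<exists>s. \<forall>n. (good (s n) \<and> (n = 0 \<longrightarrow> s n = (Z, \<alpha>))) \<and> extends n (s n) (s (Suc n))"
  proof (rule dependent_nat_choice)
    show "\<exists>p. good p \<and> (0 = (0::nat) \<longrightarrow> p = (Z, \<alpha>))"
      using Z \<alpha> by (auto simp: good_def)
    fix p and n :: nat assume p: "good p \<and> (n = 0 \<longrightarrow> p = (Z, \<alpha>))"
    have "c n \<in> U" using c C by auto
    then obtain Z' \<alpha>' where "finite Z'" "insert (c n) (fst p) \<subseteq> Z'" "Z' \<subseteq> U"
        "isometric_action_on H Z' d \<alpha>'" "\<forall>h\<in>carrier H. \<forall>x\<in>fst p. \<alpha>' h x = snd p h x"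
      using finite_action_absorbs_point[OF U H, of "fst p" "snd p" "c n"] p by (auto simp: good_def)
    then show "\<exists>q. (good q \<and> (Suc n = 0 \<longrightarrow> q = (Z, \<alpha>))) \<and> extends n p q"
      by (intro exI[of _ "(Z', \<alpha>')"]) (auto simp: good_def extends_def)
  qed
  then obtain s where s: "\<And>n. good (s n)" "s 0 = (Z, \<alpha>)" "\<And>n. extends n (s n) (s (Suc n))"
    by metis
  define Zs where "Zs n = fst (s n)" for n
  define \<alpha>s where "\<alpha>s n = snd (s n)" for n
  have mono: "Zs m \<subseteq> Zs n \<and> (\<forall>h\<in>carrier H. \<forall>x\<in>Zs m. \<alpha>s n h x = \<alpha>s m h x)" if "m \<le> n" for m n
    using that
  proof (induction n rule: dec_induct)
    case (step n)
    then show ?case using s(3)[of n] by (auto simp: extends_def Zs_def \<alpha>s_def subset_iff)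
  qed simp
  note act = s(1)[unfolded good_def, folded Zs_def \<alpha>s_def, THEN conjunct2, THEN conjunct2]
  define D where "D = (\<Union>n. Zs n)"
  have DU: "D \<subseteq> U" using s(1) by (auto simp: D_def Zs_def good_def)
  have "C \<subseteq> D" using s(3) c by (fastforce simp: D_def Zs_def extends_def)
  have dense: "\<exists>p\<in>D. d x p < e" if x: "x \<in> U" and "e > 0" for x e
  proof -
    have "x \<in> U.mtopology closure_of C" using x C by simp
    then obtain p where "p \<in> C" "d x p < e"
      using \<open>e > 0\<close> unfolding U.metric_closure_of by auto
    then show ?thesis using \<open>C \<subseteq> D\<close> by blast
  qed
  define \<beta> where "\<beta> h x = \<alpha>s (LEAST n. x \<in> Zs n) h x" for h x
  have \<beta>: "\<beta> h x = \<alpha>s n h x" if "h \<in> carrier H" "x \<in> Zs n" for h x n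
  proof -
    have "x \<in> Zs (LEAST n. x \<in> Zs n)" using that(2) by (rule LeastI)
    moreover have "(LEAST n. x \<in> Zs n) \<le> n" using that(2) by (rule Least_le)
    ultimately show ?thesis using mono that by (auto simp: \<beta>_def)
  qed
  have common: "\<exists>n. x \<in> Zs n \<and> y \<in> Zs n" if xy: "x \<in> D" "y \<in> D" for x y
  proof -
    obtain m n where "x \<in> Zs m" "y \<in> Zs n" using xy by (auto simp: D_def)
    then have "x \<in> Zs (max m n)" "y \<in> Zs (max m n)"
      using mono[of m "max m n"] mono[of n "max m n"] by auto
    then show ?thesis by blast
  qed
  have \<beta>D: "\<beta> h x \<in> D" if h: "h \<in> carrier H" and x: "x \<in> D" for h x
  proof -
    obtain n where "x \<in> Zs n" using x by (auto simp: D_def)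
    then show ?thesis using \<beta>[of h x n] isometric_action_onD(1)[OF act[of n]] h by (auto simp: D_def)
  qed
  have \<beta>d: "d (\<beta> h x) (\<beta> h y) = d x y" if h: "h \<in> carrier H" and xy: "x \<in> D" "y \<in> D" for h x y
  proof -
    obtain n where "x \<in> Zs n" "y \<in> Zs n" using common[OF xy] by blast
    then show ?thesis using \<beta>[of h _ n] isometric_action_onD(2)[OF act[of n]] h by auto
  qed
  have \<beta>1: "\<beta> \<one>\<^bsub>H\<^esub> x = x" if x: "x \<in> D" for x
  proof -
    obtain n where "x \<in> Zs n" using x by (auto simp: D_def)
    then show ?thesis using \<beta>[of _ x n] isometric_action_onD(3)[OF act[of n]] by auto
  qed
  have \<beta>m: "\<beta> (h \<otimes>\<^bsub>H\<^esub> k) x = \<beta> h (\<beta> k x)" if hk: "h \<in> carrier H" "k \<in> carrier H" and x: "x \<in> D" for h k x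
  proof -
    obtain n where n: "x \<in> Zs n" using x by (auto simp: D_def)
    have "\<alpha>s n k x \<in> Zs n" using isometric_action_onD(1)[OF act[of n]] hk n by auto
    then show ?thesis using \<beta>[of _ _ n] isometric_action_onD(4)[OF act[of n]] hk n by auto
  qed
  have "\<exists>g. isometric_embedding U d U d g \<and> (\<forall>p\<in>D. g p = \<beta> h p)" if h: "h \<in> carrier H" for h
    using U DU dense \<beta>D[OF h] \<beta>d[OF h]
    by (intro U.isometry_extends_from_dense) (auto simp: urysohn_space_def isometric_embedding_def)
  then obtain g where g: "\<And>h. h \<in> carrier H \<Longrightarrow> isometric_embedding U d U d (g h)"
      "\<And>h p. h \<in> carrier H \<Longrightarrow> p \<in> D \<Longrightarrow> g h p = \<beta> h p"
    by metis
  have gU: "g h x \<in> U" and gd: "y \<in> U \<Longrightarrow> d (g h x) (g h y) = d x y"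
    if "h \<in> carrier H" "x \<in> U" for h x y
    using g(1)[OF that(1)] that by (auto simp: isometric_embedding_def)
  have gm: "g (h \<otimes>\<^bsub>H\<^esub> k) x = g h (g k x)" if hk: "h \<in> carrier H" "k \<in> carrier H" and x: "x \<in> U" for h k x
  proof (rule U.isometries_eq_on_dense[OF DU dense _ _ _ x])
    show "isometric_embedding U d U d (g (h \<otimes>\<^bsub>H\<^esub> k))" using g hk by simp
    show "isometric_embedding U d U d (\<lambda>x. g h (g k x))"
      using hk gU gd by (auto simp: isometric_embedding_def)
    show "g (h \<otimes>\<^bsub>H\<^esub> k) p = g h (g k p)" if "p \<in> D" for p
      using that hk \<beta>D by (simp add: g(2) \<beta>m)
  qed
  have g1: "g \<one>\<^bsub>H\<^esub> x = x" if x: "x \<in> U" for x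
  proof (rule U.isometries_eq_on_dense[OF DU dense _ _ _ x])
    show "isometric_embedding U d U d (g \<one>\<^bsub>H\<^esub>)" using g by simp
    show "isometric_embedding U d U d (\<lambda>x. x)" by (simp add: isometric_embedding_def)
    show "g \<one>\<^bsub>H\<^esub> p = p" if "p \<in> D" for p using that \<beta>1 g(2) by simp
  qed
  define \<tau> where "\<tau> h = restrict (g h) U" for h
  have \<tau>: "\<tau> h \<in> carrier (isometry_group U d)" if h: "h \<in> carrier H" for h
  proof -
    have "bij_betw (g h) U U"
      using h gm[of h "inv\<^bsub>H\<^esub> h"] gm[of "inv\<^bsub>H\<^esub> h" h] gU
      by (intro bij_betw_byWitness[where f' = "g (inv\<^bsub>H\<^esub> h)"]) (auto simp: g1)
    then show ?thesis using h gd by (auto simp: carrier_isometry_group_iff \<tau>_def)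
  qed
  have "\<tau> \<in> hom H (isometry_group U d)"
  proof (rule homI)
    show "\<tau> h \<in> carrier (isometry_group U d)" if "h \<in> carrier H" for h using \<tau>[OF that] .
    interpret G: group "isometry_group U d" by (rule group_isometry_group) (rule U.Metric_space_axioms)
    show "\<tau> (h \<otimes>\<^bsub>H\<^esub> k) = \<tau> h \<otimes>\<^bsub>isometry_group U d\<^esub> \<tau> k" if "h \<in> carrier H" "k \<in> carrier H" for h k
      using that \<tau> gU gm
      by (intro isometry_group_eqI[of _ U d]) (auto simp: isometry_group_mult_apply, auto simp: \<tau>_def)
  qed
  moreover have "\<tau> h x = \<alpha> h x" if "h \<in> carrier H" "x \<in> Z" for h x
  proof -
    have "x \<in> Zs 0" using that s(2) by (simp add: Zs_def)
    then show ?thesis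
      using that Z g(2)[of h x] \<beta>[of h x 0] s(2) by (auto simp: \<tau>_def D_def \<alpha>s_def)
  qed
  ultimately show ?thesis by blast
qed

section \<open>Gluing two metric spaces along an approximate isometry\<close>

text \<open>Points of the two spaces are compared by the shortest way through a matched pair \<open>p c\<close>, \<open>q c\<close>,
  where the passage from \<open>p c\<close> to \<open>q c\<close> costs \<open>\<delta>\<close>. A way from one space to the other and back crosses
  twice, which pays for the distortion \<open>2 * \<delta>\<close>.\<close>

lemma glue_approximate_isometry:
  fixes D :: "'z \<Rightarrow> 'z \<Rightarrow> real" and d :: "'y \<Rightarrow> 'y \<Rightarrow> real" and p :: "'c \<Rightarrow> 'z"
  assumes Z: "Metric_space Z D" and Y: "Metric_space Y d"
    and C: "finite C" "C \<noteq> {}" and p: "p \<in> C \<rightarrow> Z" and q: "q \<in> C \<rightarrow> Y" and \<delta>: "\<delta> > 0"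
    and dist: "\<And>c c'. c \<in> C \<Longrightarrow> c' \<in> C \<Longrightarrow> \<bar>D (p c) (p c') - d (q c) (q c')\<bar> \<le> 2 * \<delta>"
  shows "\<exists>E. Metric_space (Z <+> Y) E \<and>
    (\<forall>z z'. E (Inl z) (Inl z') = D z z') \<and> (\<forall>y y'. E (Inr y) (Inr y') = d y y') \<and>
    (\<forall>c\<in>C. E (Inl (p c)) (Inr (q c)) \<le> \<delta>)"
proof -
  interpret Z: Metric_space Z D by (rule Z)
  interpret Y: Metric_space Y d by (rule Y)
  have pZ: "p c \<in> Z" and qY: "q c \<in> Y" if "c \<in> C" for c using p q that by auto
  define cross where "cross z y = Min ((\<lambda>c. D z (p c) + \<delta> + d (q c) y) ` C)" for z y
  have cross_le: "cross z y \<le> D z (p c) + \<delta> + d (q c) y" if "c \<in> C" for z y c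
    unfolding cross_def using C that by (intro Min_le) auto
  have cross_ex: "\<exists>c\<in>C. cross z y = D z (p c) + \<delta> + d (q c) y" for z y
  proof -
    have "cross z y \<in> (\<lambda>c. D z (p c) + \<delta> + d (q c) y) ` C"
      unfolding cross_def using C by (intro Min_in) auto
    then show ?thesis by blast
  qed
  have cross_ge: "\<delta> \<le> cross z y" for z y
  proof -
    obtain c where "cross z y = D z (p c) + \<delta> + d (q c) y" using cross_ex by blast
    then show ?thesis using Z.nonneg[of z "p c"] Y.nonneg[of "q c" y] by linarith
  qed
  have ZZ: "D z z' \<le> cross z y + cross z' y" if zz': "z \<in> Z" "z' \<in> Z" and y: "y \<in> Y" for z z' y
  proof -
    obtain c c' where c: "c \<in> C" "cross z y = D z (p c) + \<delta> + d (q c) y"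
      and c': "c' \<in> C" "cross z' y = D z' (p c') + \<delta> + d (q c') y"
      using cross_ex by meson
    have "D z z' \<le> D z (p c) + D (p c) z'" using zz' pZ c by (intro Z.triangle) auto
    moreover have "D (p c) z' \<le> D (p c) (p c') + D z' (p c')"
      using zz' pZ c c' by (intro Z.triangle') auto
    moreover have "d (q c) (q c') \<le> d (q c) y + d (q c') y"
      using y qY c c' by (intro Y.triangle') auto
    ultimately show ?thesis using c c' dist[OF c(1) c'(1)] by linarith
  qed
  have YY: "d y y' \<le> cross z y + cross z y'" if yy': "y \<in> Y" "y' \<in> Y" and z: "z \<in> Z" for z y y'
  proof -
    obtain c c' where c: "c \<in> C" "cross z y = D z (p c) + \<delta> + d (q c) y"
      and c': "c' \<in> C" "cross z y' = D z (p c') + \<delta> + d (q c') y'"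
      using cross_ex by meson
    have "d y y' \<le> d (q c) y + d (q c) y'" using yy' qY c by (intro Y.triangle'') auto
    moreover have "d (q c) y' \<le> d (q c) (q c') + d (q c') y'"
      using yy' qY c c' by (intro Y.triangle) auto
    moreover have "D (p c) (p c') \<le> D z (p c) + D z (p c')"
      using z pZ c c' by (intro Z.triangle'') auto
    ultimately show ?thesis using c c' dist[OF c(1) c'(1)] by linarith
  qed
  have ZY: "cross z y \<le> D z z' + cross z' y" if zz': "z \<in> Z" "z' \<in> Z" for z z' y
  proof -
    obtain c where c: "c \<in> C" "cross z' y = D z' (p c) + \<delta> + d (q c) y" using cross_ex by blast
    have "D z (p c) \<le> D z z' + D z' (p c)" using zz' pZ c by (intro Z.triangle) auto
    then show ?thesis using cross_le[OF c(1), of z y] c by linarith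
  qed
  have YZ: "cross z y \<le> cross z y' + d y' y" if yy': "y \<in> Y" "y' \<in> Y" for z y y'
  proof -
    obtain c where c: "c \<in> C" "cross z y' = D z (p c) + \<delta> + d (q c) y'" using cross_ex by blast
    have "d (q c) y \<le> d (q c) y' + d y' y" using yy' qY c by (intro Y.triangle) auto
    then show ?thesis using cross_le[OF c(1), of z y] c by linarith
  qed
  have ZY': "cross z y \<le> cross z' y + D z' z" if "z \<in> Z" "z' \<in> Z" for z z' y
    using ZY[OF that, of y] Z.commute[of z z'] by simp
  have YZ': "cross z y \<le> d y y' + cross z y'" if "y \<in> Y" "y' \<in> Y" for z y y'
    using YZ[OF that, of z] Y.commute[of y y'] by simp
  define E where "E s t = (case s of Inl z \<Rightarrow> (case t of Inl z' \<Rightarrow> D z z' | Inr y \<Rightarrow> cross z y)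
      | Inr y \<Rightarrow> (case t of Inl z \<Rightarrow> cross z y | Inr y' \<Rightarrow> d y y'))" for s t
  have pos: "0 < cross z y" for z y using cross_ge[of z y] \<delta> by linarith
  have "Metric_space (Z <+> Y) E"
  proof
    show "0 \<le> E s t" for s t by (auto simp: E_def less_imp_le[OF pos] split: sum.split)
    show "E s t = E t s" for s t by (auto simp: E_def Z.commute Y.commute split: sum.split)
    show "E s t = 0 \<longleftrightarrow> s = t" if "s \<in> Z <+> Y" "t \<in> Z <+> Y" for s t
      using that less_imp_neq[OF pos] by (auto simp: E_def)
    show "E s r \<le> E s t + E t r" if "s \<in> Z <+> Y" "t \<in> Z <+> Y" "r \<in> Z <+> Y" for s t r
      using that ZZ YY ZY YZ ZY' YZ' Z.triangle Y.triangle by (auto simp: E_def)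
  qed
  moreover have "E (Inl (p c)) (Inr (q c)) \<le> \<delta>" if "c \<in> C" for c
    using cross_le[OF that, of "p c" "q c"] pZ[OF that] qY[OF that] by (simp add: E_def)
  ultimately show ?thesis by (intro exI[of _ E]) (simp add: E_def)
qed

section \<open>Perturbing a representation to one that factors through a finite group\<close>

definition word_product :: "('c, 'm) monoid_scheme \<Rightarrow> 'c list \<Rightarrow> 'c" where
  "word_product \<Gamma> l = foldr (\<lambda>s t. s \<otimes>\<^bsub>\<Gamma>\<^esub> t) l \<one>\<^bsub>\<Gamma>\<^esub>"

lemma word_product_simps [simp]:
  "word_product \<Gamma> [] = \<one>\<^bsub>\<Gamma>\<^esub>"
  "word_product \<Gamma> (s # l) = s \<otimes>\<^bsub>\<Gamma>\<^esub> word_product \<Gamma> l"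
  by (simp_all add: word_product_def)

context group
begin

lemma word_product_closed: "set l \<subseteq> carrier G \<Longrightarrow> word_product G l \<in> carrier G"
  by (induction l) auto

lemma word_product_append:
  "set l \<subseteq> carrier G \<Longrightarrow> set l' \<subseteq> carrier G \<Longrightarrow>
    word_product G (l @ l') = word_product G l \<otimes> word_product G l'"
  by (induction l) (auto simp: word_product_closed m_assoc)

lemma word_product_inverse:
  "set l \<subseteq> carrier G \<Longrightarrow> word_product G (rev (map (\<lambda>s. inv s) l)) = inv word_product G l"
proof (induction l)
  case (Cons s l)
  have "set (rev (map (\<lambda>s. inv s) l)) \<subseteq> carrier G" using Cons.prems by auto
  then show ?case using Cons by (simp add: word_product_append word_product_closed inv_mult_group)
qed simp

end

text \<open>The setting of the perturbation: a representation \<open>\<sigma>\<close> of \<open>\<Gamma>\<close> on \<open>U\<close>, a quotient map \<open>\<theta>\<close>,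
  letters \<open>T\<close>, the toll \<open>\<epsilon>\<close> for a letter, and an upper bound \<open>M\<close> for the new distances.\<close>

locale represented_quotient =
  \<Gamma>: group \<Gamma> + H: group H + U: Metric_space U d
  for \<Gamma> :: "('c, 'm) monoid_scheme" and H :: "('h, 'n) monoid_scheme"
    and U :: "'a set" and d :: "'a \<Rightarrow> 'a \<Rightarrow> real" +
  fixes \<sigma> :: "'c \<Rightarrow> 'a \<Rightarrow> 'a" and \<theta> :: "'c \<Rightarrow> 'h" and T :: "'c set" and \<epsilon> M :: real
  assumes \<sigma>: "\<sigma> \<in> hom \<Gamma> (isometry_group U d)" and \<theta>: "\<theta> \<in> hom \<Gamma> H"
    and T: "T \<subseteq> carrier \<Gamma>" and T_inv: "\<And>s. s \<in> T \<Longrightarrow> inv\<^bsub>\<Gamma>\<^esub> s \<in> T"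
    and \<epsilon>: "\<epsilon> > 0" and M: "M > 0"
begin

lemma \<sigma>_in: "\<gamma> \<in> carrier \<Gamma> \<Longrightarrow> x \<in> U \<Longrightarrow> \<sigma> \<gamma> x \<in> U"
  using hom_in_carrier[OF \<sigma>] isometry_group_apply_in by metis

lemma \<sigma>_dist: "\<gamma> \<in> carrier \<Gamma> \<Longrightarrow> x \<in> U \<Longrightarrow> y \<in> U \<Longrightarrow> d (\<sigma> \<gamma> x) (\<sigma> \<gamma> y) = d x y"
  using hom_in_carrier[OF \<sigma>] isometry_group_dist by metis

lemma \<sigma>_mult: "\<gamma> \<in> carrier \<Gamma> \<Longrightarrow> \<delta> \<in> carrier \<Gamma> \<Longrightarrow> x \<in> U \<Longrightarrow> \<sigma> (\<gamma> \<otimes>\<^bsub>\<Gamma>\<^esub> \<delta>) x = \<sigma> \<gamma> (\<sigma> \<delta> x)"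
  using hom_in_carrier[OF \<sigma>] by (simp add: hom_mult[OF \<sigma>] isometry_group_mult_apply)

lemma \<sigma>_one: "x \<in> U \<Longrightarrow> \<sigma> \<one>\<^bsub>\<Gamma>\<^esub> x = x"
  using hom_one[OF \<sigma> \<Gamma>.is_group group_isometry_group(1)[OF U.Metric_space_axioms]]
  by (simp add: isometry_group_one_apply)

lemma \<sigma>_dist_inv:
  assumes "\<gamma> \<in> carrier \<Gamma>" "x \<in> U" "y \<in> U"
  shows "d x (\<sigma> (inv\<^bsub>\<Gamma>\<^esub> \<gamma>) y) = d (\<sigma> \<gamma> x) y"
  using assms \<sigma>_dist[of \<gamma> x "\<sigma> (inv\<^bsub>\<Gamma>\<^esub> \<gamma>) y"] \<sigma>_mult[of \<gamma> "inv\<^bsub>\<Gamma>\<^esub> \<gamma>" y]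
  by (simp add: \<sigma>_in \<sigma>_one)

lemma word_in: "l \<in> lists T \<Longrightarrow> word_product \<Gamma> l \<in> carrier \<Gamma>"
  using T by (intro \<Gamma>.word_product_closed) auto

text \<open>A word \<open>l\<close> in the letters \<open>T\<close> leads from \<open>(h, x)\<close> to \<open>(k, y)\<close> if it carries \<open>h\<close> to \<open>k\<close> in the
  quotient; the cost is the distance in \<open>U\<close> that it leaves, plus \<open>\<epsilon>\<close> per letter. The toll on the
  letters makes every long word expensive, so that long relations of the quotient that do not come
  from \<open>\<Gamma>\<close> do not shorten distances. The element \<open>M\<close> provides for pairs that no word connects.\<close>

definition costs :: "'h \<times> 'a \<Rightarrow> 'h \<times> 'a \<Rightarrow> real set" where
  "costs z w = insert M {d (snd z) (\<sigma> (word_product \<Gamma> l) (snd w)) + \<epsilon> * real (length l) |l.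
     l \<in> lists T \<and> fst z \<otimes>\<^bsub>H\<^esub> \<theta> (word_product \<Gamma> l) = fst w}"

text \<open>The distance is \<open>0\<close> off the carrier because the locale \<open>Metric_space\<close> demands symmetry of
  the distance on the whole type.\<close>

definition qdist :: "'h \<times> 'a \<Rightarrow> 'h \<times> 'a \<Rightarrow> real" where
  "qdist z w = (if z \<in> carrier H \<times> U \<and> w \<in> carrier H \<times> U then Inf (costs z w) else 0)"

lemma costs_nonneg: "a \<in> costs z w \<Longrightarrow> 0 \<le> a"
  using M \<epsilon> by (auto simp: costs_def)

lemma costs_bdd: "bdd_below (costs z w)"
  by (rule bdd_belowI[of _ 0]) (rule costs_nonneg)

lemma qdist_le: "a \<in> costs z w \<Longrightarrow> qdist z w \<le> a"
  using costs_nonneg by (auto simp: qdist_def intro!: cInf_lower costs_bdd)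

lemma qdist_ge:
  assumes "z \<in> carrier H \<times> U" "w \<in> carrier H \<times> U" "\<And>a. a \<in> costs z w \<Longrightarrow> r \<le> a"
  shows "r \<le> qdist z w"
  using assms by (auto simp: qdist_def costs_def intro!: cInf_greatest)

text \<open>The inverse word leads back at the same cost, since \<open>\<sigma>\<close> acts by isometries.\<close>

lemma costs_sym:
  assumes z: "z \<in> carrier H \<times> U" and w: "w \<in> carrier H \<times> U"
  shows "costs z w \<subseteq> costs w z"
proof
  fix a assume "a \<in> costs z w"
  then consider "a = M"
    | l where "a = d (snd z) (\<sigma> (word_product \<Gamma> l) (snd w)) + \<epsilon> * real (length l)"
        "l \<in> lists T" "fst z \<otimes>\<^bsub>H\<^esub> \<theta> (word_product \<Gamma> l) = fst w"
    by (auto simp: costs_def)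
  then show "a \<in> costs w z"
  proof cases
    case (2 l)
    let ?l = "rev (map (\<lambda>s. inv\<^bsub>\<Gamma>\<^esub> s) l)"
    have zw: "fst z \<in> carrier H" "snd z \<in> U" "fst w \<in> carrier H" "snd w \<in> U" using z w by auto
    note wl = word_in[OF 2(2)]
    have inv: "word_product \<Gamma> ?l = inv\<^bsub>\<Gamma>\<^esub> word_product \<Gamma> l"
      using 2(2) T by (intro \<Gamma>.word_product_inverse) auto
    have "?l \<in> lists T" using 2(2) T_inv by auto
    moreover have "fst w \<otimes>\<^bsub>H\<^esub> \<theta> (word_product \<Gamma> ?l) = fst z"
    proof -
      have "group_hom \<Gamma> H \<theta>" using \<theta> by (simp add: group_hom_def group_hom_axioms_def \<Gamma>.is_group H.is_group)
      then have "\<theta> (word_product \<Gamma> ?l) = inv\<^bsub>H\<^esub> \<theta> (word_product \<Gamma> l)"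
        using wl by (simp add: inv group_hom.hom_inv)
      then show ?thesis using 2(3)[symmetric] zw hom_in_carrier[OF \<theta> wl] by (simp add: H.m_assoc)
    qed
    moreover have "a = d (snd w) (\<sigma> (word_product \<Gamma> ?l) (snd z)) + \<epsilon> * real (length ?l)"
      using 2(1) \<sigma>_dist_inv[OF wl zw(4,2)] U.commute by (simp add: inv)
    ultimately show ?thesis unfolding costs_def by blast
  qed (simp add: costs_def)
qed

text \<open>The concatenated word leads all the way, and its toll is the sum of the tolls.\<close>

lemma costs_triangle:
  assumes z: "z \<in> carrier H \<times> U" and w: "w \<in> carrier H \<times> U" and v: "v \<in> carrier H \<times> U"
    and a: "a \<in> costs z w" and b: "b \<in> costs w v"
  shows "qdist z v \<le> a + b"
proof -
  have zwv: "fst z \<in> carrier H" "snd z \<in> U" "fst w \<in> carrier H" "snd w \<in> U" "fst v \<in> carrier H" "snd v \<in> U"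
    using z w v by auto
  have ab: "0 \<le> a" "0 \<le> b" using a b costs_nonneg by blast+
  have M: "qdist z v \<le> M" by (rule qdist_le) (simp add: costs_def)
  consider "a = M" | "b = M"
    | l l' where "a = d (snd z) (\<sigma> (word_product \<Gamma> l) (snd w)) + \<epsilon> * real (length l)"
        "l \<in> lists T" "fst z \<otimes>\<^bsub>H\<^esub> \<theta> (word_product \<Gamma> l) = fst w"
        "b = d (snd w) (\<sigma> (word_product \<Gamma> l') (snd v)) + \<epsilon> * real (length l')"
        "l' \<in> lists T" "fst w \<otimes>\<^bsub>H\<^esub> \<theta> (word_product \<Gamma> l') = fst v"
    using a b unfolding costs_def by blast
  then show ?thesis
  proof cases
    case (3 l l')
    note wl = word_in[OF 3(2)] and wl' = word_in[OF 3(5)]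
    have app: "word_product \<Gamma> (l @ l') = word_product \<Gamma> l \<otimes>\<^bsub>\<Gamma>\<^esub> word_product \<Gamma> l'"
      using 3 T by (intro \<Gamma>.word_product_append) auto
    have "fst z \<otimes>\<^bsub>H\<^esub> \<theta> (word_product \<Gamma> (l @ l')) = fst v"
      unfolding app hom_mult[OF \<theta> wl wl'] 3(6)[symmetric] 3(3)[symmetric]
      using zwv hom_in_carrier[OF \<theta> wl] hom_in_carrier[OF \<theta> wl'] by (simp add: H.m_assoc)
    then have "d (snd z) (\<sigma> (word_product \<Gamma> (l @ l')) (snd v)) + \<epsilon> * real (length (l @ l')) \<in> costs z v"
      using 3(2,5) unfolding costs_def
      by (intro insertI2 CollectI exI[of _ "l @ l'"]) simp
    then have "qdist z v \<le> d (snd z) (\<sigma> (word_product \<Gamma> (l @ l')) (snd v)) + \<epsilon> * real (length (l @ l'))"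
      by (rule qdist_le)
    also have "d (snd z) (\<sigma> (word_product \<Gamma> (l @ l')) (snd v)) \<le>
        d (snd z) (\<sigma> (word_product \<Gamma> l) (snd w)) + d (snd w) (\<sigma> (word_product \<Gamma> l') (snd v))"
    proof -
      have "d (\<sigma> (word_product \<Gamma> l) (snd w)) (\<sigma> (word_product \<Gamma> l) (\<sigma> (word_product \<Gamma> l') (snd v)))
          = d (snd w) (\<sigma> (word_product \<Gamma> l') (snd v))"
        using wl wl' zwv by (simp add: \<sigma>_dist \<sigma>_in)
      then show ?thesis
        using U.triangle[of "snd z" "\<sigma> (word_product \<Gamma> l) (snd w)"
            "\<sigma> (word_product \<Gamma> l) (\<sigma> (word_product \<Gamma> l') (snd v))"] wl wl' zwv
        by (simp add: app \<sigma>_mult \<sigma>_in)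
    qed
    finally show ?thesis using 3(1,4) by (simp add: distrib_left)
  qed (use M ab in linarith)+
qed

lemma Metric_space_qdist: "Metric_space (carrier H \<times> U) qdist"
proof
  show "0 \<le> qdist z w" for z w
    using qdist_ge[of z w 0] costs_nonneg by (cases "z \<in> carrier H \<times> U \<and> w \<in> carrier H \<times> U")
      (auto simp: qdist_def)
  show "qdist z w = qdist w z" for z w
    using costs_sym[of z w] costs_sym[of w z] by (auto simp: qdist_def)
  show "qdist z w = 0 \<longleftrightarrow> z = w" if zw: "z \<in> carrier H \<times> U" "w \<in> carrier H \<times> U" for z w
  proof
    assume "z = w"
    have "0 \<in> costs z z"
      using zw hom_one[OF \<theta> \<Gamma>.is_group H.is_group] unfolding costs_def
      by (auto intro!: exI[of _ "[]"] simp: \<sigma>_one)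
    then have "qdist z z \<le> 0" by (rule qdist_le)
    moreover have "0 \<le> qdist z z" using zw costs_nonneg by (intro qdist_ge) auto
    ultimately show "qdist z w = 0" using \<open>z = w\<close> by simp
  next
    assume 0: "qdist z w = 0"
    show "z = w"
    proof (rule ccontr)
      assume ne: "z \<noteq> w"
      \<comment> \<open>A nonempty word costs at least \<open>\<epsilon>\<close>; the empty word only connects points of the same fibre
        \<open>{h} \<times> U\<close>.\<close>
      define r where "r = (if snd z = snd w then 1 else d (snd z) (snd w))"
      have r: "r > 0" using zw by (auto simp: r_def)
      have "min M (min \<epsilon> r) \<le> qdist z w"
      proof (rule qdist_ge[OF zw])
        fix a assume "a \<in> costs z w"
        then consider "a = M"
          | l where "a = d (snd z) (\<sigma> (word_product \<Gamma> l) (snd w)) + \<epsilon> * real (length l)"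
              "l \<in> lists T" "fst z \<otimes>\<^bsub>H\<^esub> \<theta> (word_product \<Gamma> l) = fst w"
          by (auto simp: costs_def)
        then show "min M (min \<epsilon> r) \<le> a"
        proof cases
          case (2 l)
          show ?thesis
          proof (cases l)
            case Nil
            then have "fst z = fst w" "a = d (snd z) (snd w)"
              using 2 zw hom_one[OF \<theta> \<Gamma>.is_group H.is_group] by (auto simp: \<sigma>_one)
            then have "a = r" using ne by (auto simp: r_def prod_eq_iff)
            then show ?thesis by simp
          next
            case (Cons s l')
            have "\<epsilon> * 1 \<le> \<epsilon> * real (length l)" using \<epsilon> Cons by (intro mult_left_mono) auto
            then have "\<epsilon> \<le> a" using 2(1) U.nonneg[of "snd z" "\<sigma> (word_product \<Gamma> l) (snd w)"] by linarith
            then show ?thesis by simp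
          qed
        qed simp
      qed
      then show False using 0 r \<epsilon> M by (auto simp: min_def split: if_splits)
    qed
  qed
  show "qdist z v \<le> qdist z w + qdist w v"
    if zwv: "z \<in> carrier H \<times> U" "w \<in> carrier H \<times> U" "v \<in> carrier H \<times> U" for z w v
  proof -
    have "qdist z v - qdist z w \<le> b" if b: "b \<in> costs w v" for b
    proof -
      have "qdist z v - b \<le> qdist z w"
        using costs_triangle[OF zwv] b by (intro qdist_ge zwv) (simp add: diff_le_eq)
      then show ?thesis by linarith
    qed
    then have "qdist z v - qdist z w \<le> qdist w v" by (intro qdist_ge zwv)
    then show ?thesis by linarith
  qed
qed

lemma qdist_left_invariant:
  assumes "g \<in> carrier H" "h \<in> carrier H" "k \<in> carrier H" "x \<in> U" "y \<in> U"
  shows "qdist (g \<otimes>\<^bsub>H\<^esub> h, x) (g \<otimes>\<^bsub>H\<^esub> k, y) = qdist (h, x) (k, y)"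
proof -
  have "g \<otimes>\<^bsub>H\<^esub> h \<otimes>\<^bsub>H\<^esub> \<theta> (word_product \<Gamma> l) = g \<otimes>\<^bsub>H\<^esub> k \<longleftrightarrow> h \<otimes>\<^bsub>H\<^esub> \<theta> (word_product \<Gamma> l) = k"
    if "l \<in> lists T" for l
    using assms hom_in_carrier[OF \<theta> word_in[OF that]] by (simp add: H.m_assoc)
  then have "costs (g \<otimes>\<^bsub>H\<^esub> h, x) (g \<otimes>\<^bsub>H\<^esub> k, y) = costs (h, x) (k, y)"
    unfolding costs_def by (auto cong: conj_cong)
  then show ?thesis using assms by (simp add: qdist_def)
qed

lemma \<sigma>_dist_quotient:
  assumes "s \<in> carrier \<Gamma>" "t \<in> carrier \<Gamma>" "x \<in> U" "y \<in> U"
  shows "d x (\<sigma> (inv\<^bsub>\<Gamma>\<^esub> s \<otimes>\<^bsub>\<Gamma>\<^esub> t) y) = d (\<sigma> s x) (\<sigma> t y)"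
  using assms by (simp add: \<sigma>_mult \<sigma>_in \<sigma>_dist_inv)

lemma qdist_upper:
  assumes s: "s \<in> T" and t: "t \<in> T" and x: "x \<in> U" and y: "y \<in> U"
  shows "qdist (\<theta> s, x) (\<theta> t, y) \<le> d (\<sigma> s x) (\<sigma> t y) + 2 * \<epsilon>"
proof (rule qdist_le)
  let ?l = "[inv\<^bsub>\<Gamma>\<^esub> s, t]"
  have st: "s \<in> carrier \<Gamma>" "t \<in> carrier \<Gamma>" using s t T by auto
  have "\<theta> s \<otimes>\<^bsub>H\<^esub> \<theta> (word_product \<Gamma> ?l) = \<theta> t"
    using st by (simp add: hom_mult[OF \<theta>, symmetric] \<Gamma>.m_assoc[symmetric])
  moreover have "d x (\<sigma> (word_product \<Gamma> ?l) y) = d (\<sigma> s x) (\<sigma> t y)"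
    using st x y by (simp add: \<sigma>_dist_quotient)
  moreover have "?l \<in> lists T" using s t T_inv by simp
  ultimately show "d (\<sigma> s x) (\<sigma> t y) + 2 * \<epsilon> \<in> costs (\<theta> s, x) (\<theta> t, y)"
    unfolding costs_def by (intro insertI2 CollectI exI[of _ ?l]) simp
qed

text \<open>If \<open>l\<close> leads from \<open>\<theta> s\<close> to \<open>\<theta> t\<close>, then \<open>s l t\<inverse>\<close> is a word of length \<open>length l + 2\<close> in the
  kernel of \<open>\<theta>\<close>. So either \<open>l\<close> is long, and the toll alone is at least \<open>M\<close>, or \<open>l = s\<inverse> t\<close> already in
  \<open>\<Gamma>\<close>.\<close>

lemma qdist_lower:
  assumes sep: "\<And>l. l \<in> lists T \<Longrightarrow> length l \<le> n + 2 \<Longrightarrow> \<theta> (word_product \<Gamma> l) = \<one>\<^bsub>H\<^esub> \<Longrightarrow>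
      word_product \<Gamma> l = \<one>\<^bsub>\<Gamma>\<^esub>"
    and n: "M \<le> \<epsilon> * real n" and s: "s \<in> T" and t: "t \<in> T" and x: "x \<in> U" and y: "y \<in> U"
    and le: "d (\<sigma> s x) (\<sigma> t y) \<le> M"
  shows "d (\<sigma> s x) (\<sigma> t y) \<le> qdist (\<theta> s, x) (\<theta> t, y)"
proof (rule qdist_ge)
  have st: "s \<in> carrier \<Gamma>" "t \<in> carrier \<Gamma>" using s t T by auto
  show "(\<theta> s, x) \<in> carrier H \<times> U" "(\<theta> t, y) \<in> carrier H \<times> U"
    using st x y hom_in_carrier[OF \<theta>] by auto
  fix a assume "a \<in> costs (\<theta> s, x) (\<theta> t, y)"
  then consider "a = M"
    | l where "a = d x (\<sigma> (word_product \<Gamma> l) y) + \<epsilon> * real (length l)"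
        "l \<in> lists T" "\<theta> s \<otimes>\<^bsub>H\<^esub> \<theta> (word_product \<Gamma> l) = \<theta> t"
    by (auto simp: costs_def)
  then show "d (\<sigma> s x) (\<sigma> t y) \<le> a"
  proof cases
    case (2 l)
    note wl = word_in[OF 2(2)]
    show ?thesis
    proof (cases "length l \<le> n")
      case True
      let ?l = "s # l @ [inv\<^bsub>\<Gamma>\<^esub> t]"
      have lT: "set l \<subseteq> carrier \<Gamma>" using 2(2) T by auto
      have wp: "word_product \<Gamma> ?l = s \<otimes>\<^bsub>\<Gamma>\<^esub> word_product \<Gamma> l \<otimes>\<^bsub>\<Gamma>\<^esub> inv\<^bsub>\<Gamma>\<^esub> t"
        using st wl lT by (simp add: \<Gamma>.word_product_append \<Gamma>.m_assoc)
      have "\<theta> (word_product \<Gamma> ?l) = \<theta> t \<otimes>\<^bsub>H\<^esub> \<theta> (inv\<^bsub>\<Gamma>\<^esub> t)"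
        unfolding wp using st wl 2(3) by (simp add: hom_mult[OF \<theta>])
      also have "\<dots> = \<one>\<^bsub>H\<^esub>"
        using st hom_one[OF \<theta> \<Gamma>.is_group H.is_group] by (simp add: hom_mult[OF \<theta>, symmetric])
      finally have "word_product \<Gamma> ?l = \<one>\<^bsub>\<Gamma>\<^esub>"
        using True 2(2) s t T_inv by (intro sep) auto
      then have "s \<otimes>\<^bsub>\<Gamma>\<^esub> word_product \<Gamma> l = t"
        unfolding wp using st wl by (metis \<Gamma>.inv_closed \<Gamma>.inv_equality \<Gamma>.inv_inv \<Gamma>.m_closed)
      then have "word_product \<Gamma> l = inv\<^bsub>\<Gamma>\<^esub> s \<otimes>\<^bsub>\<Gamma>\<^esub> t"
        using st wl by (metis \<Gamma>.inv_solve_left)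
      then show ?thesis using 2(1) \<sigma>_dist_quotient[OF st x y] \<epsilon> by simp
    next
      case False
      then have "\<epsilon> * real n \<le> \<epsilon> * real (length l)" using \<epsilon> by (intro mult_left_mono) auto
      then show ?thesis using 2(1) n le U.nonneg[of x "\<sigma> (word_product \<Gamma> l) y"] by linarith
    qed
  qed (use le in simp)
qed

end

text \<open>The hypothesis on the finite sets \<open>K\<close> is residual finiteness of \<open>\<Gamma>\<close>; it is applied to the
  products of short words in a set \<open>T\<close> of letters. Then the quotient metric on \<open>\<theta> ` T \<times> X\<close> differs from the metric of the points \<open>\<sigma> t x\<close> in \<open>U\<close> by at most \<open>2 * \<epsilon>\<close>, so \<open>H \<times> X\<close>
  can be placed in \<open>U\<close> with \<open>(\<theta> t, x)\<close> close to \<open>\<sigma> t x\<close>, and the left translations of \<open>H\<close> extend to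
  isometries of \<open>U\<close>.\<close>

theorem finite_representations_dense:
  fixes \<Gamma> :: "('c, 'm) monoid_scheme" and U :: "'a set"
  assumes U: "urysohn_space U d" and \<Gamma>: "group \<Gamma>"
    and separation: "\<And>K. finite K \<Longrightarrow> K \<subseteq> carrier \<Gamma> \<Longrightarrow>
      \<exists>(H :: 'h monoid) \<theta>. group H \<and> finite (carrier H) \<and> \<theta> \<in> hom \<Gamma> H \<and>
        (\<forall>\<gamma>\<in>K. \<theta> \<gamma> = \<one>\<^bsub>H\<^esub> \<longrightarrow> \<gamma> = \<one>\<^bsub>\<Gamma>\<^esub>)"
    and \<sigma>: "\<sigma> \<in> hom \<Gamma> (isometry_group U d)"
    and S: "finite S" "S \<subseteq> carrier \<Gamma>" and X: "finite X" "X \<subseteq> U" and e: "e > 0"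
  shows "\<exists>\<tau> \<in> hom \<Gamma> (isometry_group U d). finite (\<tau> ` carrier \<Gamma>) \<and>
    (\<forall>s\<in>S. \<forall>x\<in>X. d (\<tau> s x) (\<sigma> s x) < e)"
proof (cases "X = {}")
  case True
  interpret G: group "isometry_group U d"
    using U by (intro group_isometry_group) (simp add: urysohn_space_def)
  have "(\<lambda>_. \<one>\<^bsub>isometry_group U d\<^esub>) \<in> hom \<Gamma> (isometry_group U d)" by (auto intro: homI)
  then show ?thesis using True by (intro bexI[of _ "\<lambda>_. \<one>\<^bsub>isometry_group U d\<^esub>"]) (auto simp: image_constant_conv)
next
  case False
  interpret \<Gamma>: group \<Gamma> by (rule \<Gamma>)
  interpret U: Metric_space U d using U by (simp add: urysohn_space_def)
  define T where "T = insert \<one>\<^bsub>\<Gamma>\<^esub> (S \<union> (\<lambda>s. inv\<^bsub>\<Gamma>\<^esub> s) ` S)"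
  have T: "T \<subseteq> carrier \<Gamma>" "finite T" "\<And>s. s \<in> T \<Longrightarrow> inv\<^bsub>\<Gamma>\<^esub> s \<in> T"
    using S by (auto simp: T_def subset_iff)
  \<comment> \<open>Two errors of size \<open>\<epsilon>\<close> add up: from \<open>x\<close> to the point \<open>(1, x)\<close>, and from \<open>(\<theta> s, x)\<close> to
    \<open>\<sigma> s x\<close>.\<close>
  define \<epsilon> where "\<epsilon> = e / 3"
  have \<epsilon>: "\<epsilon> > 0" using e by (simp add: \<epsilon>_def)
  define Y where "Y = (\<lambda>(s, x). \<sigma> s x) ` (T \<times> X)"
  have \<sigma>U: "\<sigma> s x \<in> U" if "s \<in> carrier \<Gamma>" "x \<in> U" for s x
    using hom_in_carrier[OF \<sigma> that(1)] that(2) by (rule isometry_group_apply_in)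
  have Y: "finite Y" "Y \<subseteq> U" using T X by (auto simp: Y_def intro!: \<sigma>U)
  obtain M where M: "M > 0" "\<And>y y'. y \<in> Y \<Longrightarrow> y' \<in> Y \<Longrightarrow> d y y' \<le> M"
  proof
    let ?A = "insert 1 ((\<lambda>(y, y'). d y y') ` (Y \<times> Y))"
    have fin: "finite ?A" using Y by simp
    have "1 \<le> Max ?A" using fin by (intro Max_ge) auto
    then show "0 < Max ?A" by linarith
    show "d y y' \<le> Max ?A" if "y \<in> Y" "y' \<in> Y" for y y'
      using fin that by (intro Max_ge) auto
  qed
  obtain n :: nat where n: "M \<le> \<epsilon> * real n"
    using real_arch_simple[of "M / \<epsilon>"] \<epsilon> by (auto simp: field_simps)
  \<comment> \<open>The toll of a word with more than \<open>n\<close> letters is at least \<open>M\<close>, so only shorter words matter;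
    two more letters account for the end points of the path.\<close>
  define W where "W = word_product \<Gamma> ` {l. set l \<subseteq> T \<and> length l \<le> n + 2}"
  have "finite W" using finite_lists_length_le[OF T(2)] by (simp add: W_def)
  moreover have "W \<subseteq> carrier \<Gamma>" using T by (auto simp: W_def intro!: \<Gamma>.word_product_closed)
  ultimately obtain H :: "'h monoid" and \<theta> where H: "group H" "finite (carrier H)"
    and \<theta>: "\<theta> \<in> hom \<Gamma> H" and sepW: "\<forall>\<gamma>\<in>W. \<theta> \<gamma> = \<one>\<^bsub>H\<^esub> \<longrightarrow> \<gamma> = \<one>\<^bsub>\<Gamma>\<^esub>"
    using separation[of W] by blast
  have sep: "word_product \<Gamma> l = \<one>\<^bsub>\<Gamma>\<^esub>"
    if "l \<in> lists T" "length l \<le> n + 2" "\<theta> (word_product \<Gamma> l) = \<one>\<^bsub>H\<^esub>" for l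
    using sepW that by (auto simp: W_def)
  interpret H: group H by (rule H)
  interpret R: represented_quotient \<Gamma> H U d \<sigma> \<theta> T \<epsilon> M
    by unfold_locales (use \<sigma> \<theta> T \<epsilon> M in auto)
  define Z where "Z = carrier H \<times> X"
  have Z: "Metric_space Z R.qdist" "finite Z"
    using Metric_space.subspace[OF R.Metric_space_qdist, of Z] X H by (auto simp: Z_def)
  define C where "C = T \<times> X"
  define p where "p = (\<lambda>(s, x). (\<theta> s, x :: 'a))"
  define q where "q = (\<lambda>(s, x). \<sigma> s x)"
  have \<theta>H: "\<theta> s \<in> carrier H" if "s \<in> carrier \<Gamma>" for s using hom_in_carrier[OF \<theta> that] .
  have pq: "p \<in> C \<rightarrow> Z" "q \<in> C \<rightarrow> Y" using T \<theta>H by (auto simp: p_def q_def C_def Z_def Y_def)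
  have approx: "\<bar>R.qdist (p c) (p c') - d (q c) (q c')\<bar> \<le> 2 * \<epsilon>" if c: "c \<in> C" "c' \<in> C" for c c'
  proof -
    obtain s x t y where st: "c = (s, x)" "c' = (t, y)" "s \<in> T" "x \<in> X" "t \<in> T" "y \<in> X"
      using c by (auto simp: C_def)
    have xy: "x \<in> U" "y \<in> U" using st X by auto
    have "d (\<sigma> s x) (\<sigma> t y) \<le> M" using st by (intro M(2)) (auto simp: Y_def)
    then have "d (\<sigma> s x) (\<sigma> t y) \<le> R.qdist (\<theta> s, x) (\<theta> t, y)"
      using sep n st(3,5) xy by (intro R.qdist_lower)
    then show ?thesis using R.qdist_upper[OF st(3,5) xy] \<epsilon> by (simp add: p_def q_def st(1,2))
  qed
  have C: "finite C" "C \<noteq> {}" using T X False by (auto simp: C_def T_def)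
  obtain E where E: "Metric_space (Z <+> Y) E" "\<And>z z'. E (Inl z) (Inl z') = R.qdist z z'"
      "\<And>y y'. E (Inr y) (Inr y') = d y y'" "\<And>c. c \<in> C \<Longrightarrow> E (Inl (p c)) (Inr (q c)) \<le> \<epsilon>"
    using glue_approximate_isometry[OF Z(1) U.subspace[OF Y(2)] C pq \<epsilon> approx] by blast
  \<comment> \<open>The points of \<open>Y\<close> stay where they are in \<open>U\<close>, and \<open>Z\<close> is placed around them.\<close>
  have "isometric_embedding (Inr ` Y) E U d (case_sum undefined id)"
    using Y by (auto simp: isometric_embedding_def E(3))
  then obtain j where j: "isometric_embedding (Z <+> Y) E U d j" "\<And>y. y \<in> Y \<Longrightarrow> j (Inr y) = y"
    using urysohn_space_finite_extension[OF U E(1), of "Inr ` Y" "case_sum undefined id"] Z(2) Y(1) by auto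
  define i where "i z = j (Inl z)" for z
  have iU: "i z \<in> U" if "z \<in> Z" for z using j(1) that by (auto simp: isometric_embedding_def i_def)
  have idist: "d (i z) (i z') = R.qdist z z'" if "z \<in> Z" "z' \<in> Z" for z z'
    using j(1) that by (auto simp: isometric_embedding_def i_def E(2) InlI)
  have near: "d (i (\<theta> s, x)) (\<sigma> s x) \<le> \<epsilon>" if "s \<in> T" "x \<in> X" for s x
  proof -
    have c: "(s, x) \<in> C" using that by (simp add: C_def)
    then have "p (s, x) \<in> Z" "q (s, x) \<in> Y" using pq by auto
    then have "d (j (Inl (p (s, x)))) (j (Inr (q (s, x)))) = E (Inl (p (s, x))) (Inr (q (s, x)))"
      using j(1) by (simp add: isometric_embedding_def InlI InrI)
    then show ?thesis using E(4)[OF c] j(2)[OF \<open>q (s, x) \<in> Y\<close>] by (simp add: i_def p_def q_def)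
  qed
  interpret Z: Metric_space Z R.qdist by (rule Z)
  have inj: "inj_on i Z" using idist iU by (intro inj_onI) (metis Z.zero U.mdist_zero)
  define \<alpha> where "\<alpha> h y = (let (k, x) = inv_into Z i y in i (h \<otimes>\<^bsub>H\<^esub> k, x))" for h y
  have \<alpha>: "\<alpha> h (i (k, x)) = i (h \<otimes>\<^bsub>H\<^esub> k, x)" if "k \<in> carrier H" "x \<in> X" for h k x
    using that inv_into_f_f[OF inj, of "(k, x)"] by (simp add: \<alpha>_def Z_def)
  have "isometric_action_on H (i ` Z) d \<alpha>"
  proof -
    have "d (\<alpha> h (i z)) (\<alpha> h (i z')) = d (i z) (i z')" if h: "h \<in> carrier H" and z: "z \<in> Z" "z' \<in> Z" for h z z'
      using z h X idist[of "(h \<otimes>\<^bsub>H\<^esub> fst z, snd z)" "(h \<otimes>\<^bsub>H\<^esub> fst z', snd z')"] idist[OF z]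
      by (auto simp: Z_def \<alpha> R.qdist_left_invariant subset_iff)
    moreover have "\<alpha> h (i z) \<in> i ` Z" if "h \<in> carrier H" "z \<in> Z" for h z
      using that by (auto simp: Z_def \<alpha>)
    moreover have "\<alpha> \<one>\<^bsub>H\<^esub> (i z) = i z" if "z \<in> Z" for z using that by (auto simp: Z_def \<alpha>)
    moreover have "\<alpha> (h \<otimes>\<^bsub>H\<^esub> k) (i z) = \<alpha> h (\<alpha> k (i z))"
      if "h \<in> carrier H" "k \<in> carrier H" "z \<in> Z" for h k z
      using that by (auto simp: Z_def \<alpha> H.m_assoc)
    ultimately show ?thesis by (auto simp: isometric_action_on_def isometric_embedding_def)
  qed
  then obtain \<tau> where \<tau>: "\<tau> \<in> hom H (isometry_group U d)"
      "\<And>h z. h \<in> carrier H \<Longrightarrow> z \<in> Z \<Longrightarrow> \<tau> h (i z) = \<alpha> h (i z)"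
    using finite_action_extends_to_urysohn_space[OF U H, of "i ` Z" \<alpha>] Z(2) iU by blast
  have "\<tau> \<circ> \<theta> \<in> hom \<Gamma> (isometry_group U d)" using \<theta> \<tau>(1) by (rule Group.hom_compose)
  moreover have "finite ((\<tau> \<circ> \<theta>) ` carrier \<Gamma>)"
    using H(2) \<theta>H finite_subset[of "(\<tau> \<circ> \<theta>) ` carrier \<Gamma>" "\<tau> ` carrier H"] by force
  moreover have "d ((\<tau> \<circ> \<theta>) s x) (\<sigma> s x) < e" if s: "s \<in> S" and x: "x \<in> X" for s x
  proof -
    have sT: "s \<in> T" "s \<in> carrier \<Gamma>" "\<one>\<^bsub>\<Gamma>\<^esub> \<in> T" using s S by (auto simp: T_def)
    have xU: "x \<in> U" using x X by auto
    have \<theta>1: "\<theta> \<one>\<^bsub>\<Gamma>\<^esub> = \<one>\<^bsub>H\<^esub>" using hom_one[OF \<theta> \<Gamma> H(1)] .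
    have zZ: "(\<one>\<^bsub>H\<^esub>, x) \<in> Z" "(\<theta> s, x) \<in> Z" using x \<theta>H[OF sT(2)] by (auto simp: Z_def)
    note g = hom_in_carrier[OF \<tau>(1) \<theta>H[OF sT(2)]]
    have "d (\<tau> (\<theta> s) x) (i (\<theta> s, x)) = d x (i (\<one>\<^bsub>H\<^esub>, x))"
      using isometry_group_dist[OF g xU iU[OF zZ(1)]] \<tau>(2)[OF \<theta>H[OF sT(2)] zZ(1)] x \<theta>H[OF sT(2)]
      by (simp add: \<alpha>)
    also have "\<dots> \<le> \<epsilon>" using near[OF sT(3) x] xU by (simp add: \<theta>1 R.\<sigma>_one U.commute)
    finally have "d (\<tau> (\<theta> s) x) (i (\<theta> s, x)) \<le> \<epsilon>" .
    moreover have "d (i (\<theta> s, x)) (\<sigma> s x) \<le> \<epsilon>" using near[OF sT(1) x] .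
    moreover have "d (\<tau> (\<theta> s) x) (\<sigma> s x) \<le> d (\<tau> (\<theta> s) x) (i (\<theta> s, x)) + d (i (\<theta> s, x)) (\<sigma> s x)"
      using isometry_group_apply_in[OF g xU] iU[OF zZ(2)] \<sigma>U[OF sT(2) xU] by (intro U.triangle)
    ultimately show ?thesis using \<epsilon> by (simp add: \<epsilon>_def)
  qed
  ultimately show ?thesis by blast
qed

section \<open>Products of free groups and their finite quotients\<close>

text \<open>The complements of \<open>A\<close> and \<open>f ` A\<close> in the finite set \<open>W\<close> have the same size, so they can be
  matched.\<close>

lemma partial_injection_extends_to_bijection:
  assumes W: "finite W" and A: "A \<subseteq> W" "f ` A \<subseteq> W" "inj_on f A"
  shows "\<exists>p \<in> Bij W. \<forall>x\<in>A. p x = f x"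
proof -
  have "card (W - A) = card (W - f ` A)"
    using assms by (simp add: card_Diff_subset finite_subset card_image)
  then obtain g where g: "bij_betw g (W - A) (W - f ` A)"
    using W finite_same_card_bij[of "W - A" "W - f ` A"] by auto
  define p where "p = (\<lambda>x\<in>W. if x \<in> A then f x else g x)"
  have "bij_betw p A (f ` A)"
    using A by (subst bij_betw_cong[of _ _ f]) (auto simp: p_def bij_betw_def)
  moreover have "bij_betw p (W - A) (W - f ` A)"
    using g by (subst bij_betw_cong[of _ _ g]) (auto simp: p_def)
  ultimately have "bij_betw p (A \<union> (W - A)) (f ` A \<union> (W - f ` A))"
    by (rule bij_betw_combine) auto
  then have "bij_betw p W W" using A by (simp add: Un_absorb1)
  moreover have "p \<in> extensional W" by (simp add: p_def)
  moreover have "p x = f x" if "x \<in> A" for x using that A by (auto simp: p_def)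
  ultimately show ?thesis unfolding Bij_def by blast
qed

lemma finite_BijGroup: "finite W \<Longrightarrow> finite (carrier (BijGroup W))"
  by (rule finite_subset[of _ "W \<rightarrow>\<^sub>E W"])
    (auto simp: BijGroup_def Bij_def bij_betw_def extensional_def intro!: finite_PiE)

lemma BijGroup_mult_apply:
  "f \<in> carrier (BijGroup W) \<Longrightarrow> g \<in> carrier (BijGroup W) \<Longrightarrow> x \<in> W \<Longrightarrow>
    (f \<otimes>\<^bsub>BijGroup W\<^esub> g) x = f (g x)"
  by (simp add: BijGroup_def compose_def)

text \<open>Left multiplication by a generator is a partial injection on the finite set \<open>W\<close> of
  the reduced words of bounded length in finitely many letters. Completing these partial injections
  to permutations of \<open>W\<close> yields an action of the free group on \<open>W\<close> in which a word \<open>w \<in> W\<close> still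
  moves the empty word to \<open>w\<close>.\<close>

lemma free_group_finite_quotient:
  fixes X :: "'x set"
  assumes K: "finite K" "K \<subseteq> carrier (free_group X)"
  shows "\<exists>W \<theta>. finite (W :: (bool \<times> 'x) list set) \<and> \<theta> \<in> hom (free_group X) (BijGroup W) \<and>
    (\<forall>w\<in>K. \<theta> w = \<one>\<^bsub>BijGroup W\<^esub> \<longrightarrow> w = \<one>\<^bsub>free_group X\<^esub>)"
proof -
  interpret F: group "free_group X" by (rule group_free_group)
  define X0 where "X0 = (\<Union>w\<in>K. snd ` set w)"
  define k where "k = Max (insert 0 (length ` K))"
  define W where "W = {w \<in> carrier (free_group X). snd ` set w \<subseteq> X0 \<and> length w \<le> k}"
  have KW: "K \<subseteq> W" using K by (auto simp: W_def X0_def k_def intro!: Max_ge)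
  have nilW: "[] \<in> W" by (auto simp: W_def free_group_def)
  have tlW: "v \<in> W" if "q # v \<in> W" for q v
    using that by (auto simp: W_def free_group_def successively_Cons)
  have "finite X0" using K(1) by (auto simp: X0_def)
  then have "finite {w :: (bool \<times> 'x) list. set w \<subseteq> UNIV \<times> X0 \<and> length w \<le> k}"
    by (intro finite_lists_length_le) auto
  then have finW: "finite W"
    by (rule finite_subset[rotated]) (auto simp: W_def image_subset_iff)
  interpret P: group "BijGroup W" by (rule group_BijGroup)
  have WF: "w \<in> carrier (free_group X)" if "w \<in> W" for w using that by (simp add: W_def)
  have "\<exists>p\<in>Bij W. \<forall>w\<in>W. cons_reduce (True, x) w \<in> W \<longrightarrow> p w = cons_reduce (True, x) w"
    if x: "x \<in> X" for x
  proof -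
    let ?A = "{w \<in> W. cons_reduce (True, x) w \<in> W}"
    have "inj_on (cons_reduce (True, x)) ?A"
    proof (rule inj_on_inverseI)
      fix w assume "w \<in> ?A"
      then show "cons_reduce (False, x) (cons_reduce (True, x) w) = w"
        using x WF by (intro free_group_cons_reduce(2)[of _ X]) (auto simp: cancels_def)
    qed
    then show ?thesis
      using partial_injection_extends_to_bijection[OF finW, of ?A "cons_reduce (True, x)"] by auto
  qed
  then obtain p where p: "\<And>x. x \<in> X \<Longrightarrow> p x \<in> Bij W"
      "\<And>x w. x \<in> X \<Longrightarrow> w \<in> W \<Longrightarrow> cons_reduce (True, x) w \<in> W \<Longrightarrow> p x w = cons_reduce (True, x) w"
    by metis
  then have pP: "p \<in> X \<rightarrow> carrier (BijGroup W)" by (simp add: BijGroup_def)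
  obtain \<theta> where \<theta>: "\<theta> \<in> hom (free_group X) (BijGroup W)" "\<And>x. x \<in> X \<Longrightarrow> \<theta> [(True, x)] = p x"
    using free_group_universal[OF P.is_group pP] by blast
  have moves: "\<theta> [q] v = q # v" if qv: "q # v \<in> W" for q v
  proof -
    note F = WF[OF qv] and vW = tlW[OF qv]
    obtain b x where q: "q = (b, x)" by (cases q)
    have x: "x \<in> X" using F by (auto simp: q free_group_def)
    have gen: "[(True, x)] \<in> carrier (free_group X)" using x by (simp add: free_group_def)
    show ?thesis
    proof (cases b)
      case True
      have "cons_reduce (True, x) v = q # v"
        using F True by (cases v) (auto simp: q free_group_def successively_Cons)
      then show ?thesis using True p(2)[OF x vW] \<theta>(2)[OF x] qv q by simp
    next
      case False
      have inv: "[q] = inv\<^bsub>free_group X\<^esub> [(True, x)]"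
        using x False by (intro F.inv_equality[symmetric]) (auto simp: free_group_def cancels_def q)
      have "cons_reduce (True, x) (q # v) = v" using False by (simp add: q cancels_def)
      then have v: "\<theta> [(True, x)] (q # v) = v" using p(2)[OF x qv] \<theta>(2)[OF x] vW by simp
      note C = hom_in_carrier[OF \<theta>(1) gen] hom_in_carrier[OF \<theta>(1) F.inv_closed[OF gen]]
      have "\<theta> [q] v = (\<theta> [q] \<otimes>\<^bsub>BijGroup W\<^esub> \<theta> [(True, x)]) (q # v)"
        using BijGroup_mult_apply[OF C(2,1) qv] v by (simp add: inv)
      also have "\<theta> [q] \<otimes>\<^bsub>BijGroup W\<^esub> \<theta> [(True, x)] = \<one>\<^bsub>BijGroup W\<^esub>"
        using gen hom_one[OF \<theta>(1) F.is_group P.is_group]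
        by (simp add: inv hom_mult[OF \<theta>(1), symmetric])
      finally show ?thesis using qv by (simp add: BijGroup_def)
    qed
  qed
  have reach: "\<theta> w [] = w" if "w \<in> W" for w
    using that
  proof (induction w)
    case Nil
    have "\<theta> [] = \<one>\<^bsub>BijGroup W\<^esub>"
      using hom_one[OF \<theta>(1) F.is_group P.is_group] by (simp add: free_group_def)
    then show ?case using nilW by (simp add: BijGroup_def)
  next
    case (Cons q v)
    have C: "[q] \<in> carrier (free_group X)" "v \<in> carrier (free_group X)"
      using WF[OF Cons.prems] by (auto simp: free_group_def successively_Cons)
    have "q # v = [q] \<otimes>\<^bsub>free_group X\<^esub> v"
      using WF[OF Cons.prems] by (cases v) (auto simp: free_group_def)
    then have "\<theta> (q # v) [] = \<theta> [q] (\<theta> v [])"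
      using BijGroup_mult_apply[OF hom_in_carrier[OF \<theta>(1) C(1)] hom_in_carrier[OF \<theta>(1) C(2)] nilW]
      by (simp add: hom_mult[OF \<theta>(1) C])
    then show ?case using Cons.IH[OF tlW[OF Cons.prems]] moves[OF Cons.prems] by simp
  qed
  have "w = \<one>\<^bsub>free_group X\<^esub>" if "w \<in> K" "\<theta> w = \<one>\<^bsub>BijGroup W\<^esub>" for w
    using reach[of w] that KW nilW by (auto simp: BijGroup_def free_group_def)
  then show ?thesis using finW \<theta>(1) by blast
qed

lemma hom_DirProd_map:
  assumes "f \<in> hom G G'" "g \<in> hom H H'"
  shows "map_prod f g \<in> hom (G \<times>\<times> H) (G' \<times>\<times> H')"
proof (rule homI)
  show "map_prod f g p \<in> carrier (G' \<times>\<times> H')" if "p \<in> carrier (G \<times>\<times> H)" for p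
    using that hom_in_carrier[OF assms(1)] hom_in_carrier[OF assms(2)] by auto
  show "map_prod f g (p \<otimes>\<^bsub>G \<times>\<times> H\<^esub> q) = map_prod f g p \<otimes>\<^bsub>G' \<times>\<times> H'\<^esub> map_prod f g q"
    if "p \<in> carrier (G \<times>\<times> H)" "q \<in> carrier (G \<times>\<times> H)" for p q
    using that hom_mult[OF assms(1)] hom_mult[OF assms(2)] by auto
qed

lemma free_group_product_finite_quotient:
  assumes K: "finite K" "K \<subseteq> carrier (free_group (X :: 'x set) \<times>\<times> free_group (Y :: 'y set))"
  shows "\<exists>(H :: (((bool \<times> 'x) list \<Rightarrow> (bool \<times> 'x) list) \<times> ((bool \<times> 'y) list \<Rightarrow> (bool \<times> 'y) list)) monoid) \<theta>.
    group H \<and> finite (carrier H) \<and> \<theta> \<in> hom (free_group X \<times>\<times> free_group Y) H \<and>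
    (\<forall>\<gamma>\<in>K. \<theta> \<gamma> = \<one>\<^bsub>H\<^esub> \<longrightarrow> \<gamma> = \<one>\<^bsub>free_group X \<times>\<times> free_group Y\<^esub>)"
proof -
  have K1: "finite (fst ` K)" "fst ` K \<subseteq> carrier (free_group X)" using K by auto
  obtain W :: "(bool \<times> 'x) list set" and \<theta> where W: "finite W" "\<theta> \<in> hom (free_group X) (BijGroup W)"
      "\<forall>w\<in>fst ` K. \<theta> w = \<one>\<^bsub>BijGroup W\<^esub> \<longrightarrow> w = \<one>\<^bsub>free_group X\<^esub>"
    using free_group_finite_quotient[OF K1] by blast
  have K2: "finite (snd ` K)" "snd ` K \<subseteq> carrier (free_group Y)" using K by auto
  obtain V :: "(bool \<times> 'y) list set" and \<eta> where V: "finite V" "\<eta> \<in> hom (free_group Y) (BijGroup V)"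
      "\<forall>w\<in>snd ` K. \<eta> w = \<one>\<^bsub>BijGroup V\<^esub> \<longrightarrow> w = \<one>\<^bsub>free_group Y\<^esub>"
    using free_group_finite_quotient[OF K2] by blast
  have "group (BijGroup W \<times>\<times> BijGroup V)" by (intro DirProd_group group_BijGroup)
  moreover have "finite (carrier (BijGroup W \<times>\<times> BijGroup V))" using W(1) V(1) by (simp add: finite_BijGroup)
  moreover have "\<forall>\<gamma>\<in>K. map_prod \<theta> \<eta> \<gamma> = \<one>\<^bsub>BijGroup W \<times>\<times> BijGroup V\<^esub> \<longrightarrow>
      \<gamma> = \<one>\<^bsub>free_group X \<times>\<times> free_group Y\<^esub>"
    using W(3) V(3) by (auto simp: image_iff Bex_def)
  ultimately show ?thesis
    using hom_DirProd_map[OF W(2) V(2)]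
    by (intro exI[of _ "BijGroup W \<times>\<times> BijGroup V"] exI[of _ "map_prod \<theta> \<eta>"] conjI)
qed

context group
begin

lemma commutes_with_generate:
  assumes A: "A \<subseteq> carrier G" and b: "b \<in> carrier G" and comm: "\<And>a. a \<in> A \<Longrightarrow> a \<otimes> b = b \<otimes> a"
    and g: "g \<in> generate G A"
  shows "g \<otimes> b = b \<otimes> g"
  using g
proof induction
  case (inv h)
  then have h: "h \<in> carrier G" "h \<otimes> b = b \<otimes> h" using A comm by auto
  have "inv h \<otimes> b = inv h \<otimes> (b \<otimes> h) \<otimes> inv h" using h b by (simp add: m_assoc)
  also have "\<dots> = b \<otimes> inv h" using h b by (simp add: h(2)[symmetric] m_assoc[symmetric])
  finally show ?case .
next
  case (eng g h)
  then have "g \<in> carrier G" "h \<in> carrier G" using generate_in_carrier[OF A] by auto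
  then show ?case using eng.IH b by (metis m_assoc)
next
  case one
  show ?case using b by simp
next
  case (incl h)
  then show ?case by (rule comm)
qed

lemma elementwise_commute_generate:
  assumes A: "A \<subseteq> carrier G" and B: "B \<subseteq> carrier G" and comm: "elementwise_commute G A B"
  shows "elementwise_commute G (generate G A) (generate G B)"
proof -
  have gb: "g \<otimes> b = b \<otimes> g" if g: "g \<in> generate G A" and b: "b \<in> B" for g b
  proof (rule commutes_with_generate[OF A _ _ g])
    show "b \<in> carrier G" using b B by blast
    show "a \<otimes> b = b \<otimes> a" if "a \<in> A" for a
      using comm that b unfolding elementwise_commute_def by blast
  qed
  have "h \<otimes> g = g \<otimes> h" if g: "g \<in> generate G A" and h: "h \<in> generate G B" for g h
  proof (rule commutes_with_generate[OF B _ _ h])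
    show "g \<in> carrier G" using generate_in_carrier[OF A g] .
    show "b \<otimes> g = g \<otimes> b" if "b \<in> B" for b using gb[OF g that] by (rule sym)
  qed
  then show ?thesis unfolding elementwise_commute_def by metis
qed

end

text \<open>Each family extends to its own free factor, and the two extensions commute because their images
  are generated by commuting sets. The bound on the image shows that it is finite if both generated
  groups are.\<close>

lemma free_group_product_universal:
  assumes G: "group G" and f: "f \<in> X \<rightarrow> carrier G" and g: "g \<in> Y \<rightarrow> carrier G"
    and comm: "elementwise_commute G (f ` X) (g ` Y)"
  shows "\<exists>h \<in> hom (free_group X \<times>\<times> free_group Y) G.
    (\<forall>x\<in>X. h ([(True, x)], []) = f x) \<and> (\<forall>y\<in>Y. h ([], [(True, y)]) = g y) \<and>
    h ` carrier (free_group X \<times>\<times> free_group Y) \<subseteq>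
      (\<lambda>(a, b). a \<otimes>\<^bsub>G\<^esub> b) ` (generate G (f ` X) \<times> generate G (g ` Y))"
proof -
  interpret group G by (rule G)
  have extension: "\<exists>h \<in> hom (free_group Z) G. (\<forall>z\<in>Z. h [(True, z)] = k z) \<and>
      h ` carrier (free_group Z) \<subseteq> generate G (k ` Z) \<and> h [] = \<one>\<^bsub>G\<^esub>"
    if k: "k \<in> Z \<rightarrow> carrier G" for Z :: "'z set" and k
  proof -
    obtain h where h: "h \<in> hom (free_group Z) G" "\<forall>z\<in>Z. h [(True, z)] = k z"
      using free_group_universal[OF G k] by blast
    interpret h: group_hom "free_group Z" G h
      using h(1) by (simp add: group_hom_def group_hom_axioms_def group_free_group G)
    have "h ` carrier (free_group Z) = h ` generate (free_group Z) ((\<lambda>x. [(True, x)]) ` Z)"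
      by (simp add: free_group_generated)
    also have "\<dots> = generate G (h ` (\<lambda>x. [(True, x)]) ` Z)"
      by (rule h.generate_img[symmetric]) (auto simp: free_group_def)
    also have "h ` (\<lambda>x. [(True, x)]) ` Z = k ` Z" using h(2) by (auto simp: image_image)
    finally show ?thesis using h h.hom_one by (intro bexI[of _ h]) (auto simp: free_group_def)
  qed
  obtain u where u: "u \<in> hom (free_group X) G" "\<forall>x\<in>X. u [(True, x)] = f x"
      "u ` carrier (free_group X) \<subseteq> generate G (f ` X)" "u [] = \<one>\<^bsub>G\<^esub>"
    using extension[OF f] by blast
  obtain v where v: "v \<in> hom (free_group Y) G" "\<forall>y\<in>Y. v [(True, y)] = g y"
      "v ` carrier (free_group Y) \<subseteq> generate G (g ` Y)" "v [] = \<one>\<^bsub>G\<^esub>"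
    using extension[OF g] by blast
  have comm': "elementwise_commute G (generate G (f ` X)) (generate G (g ` Y))"
    using f g comm by (intro elementwise_commute_generate) auto
  have uG: "u x \<in> carrier G" if "x \<in> carrier (free_group X)" for x using hom_in_carrier[OF u(1) that] .
  have vG: "v y \<in> carrier G" if "y \<in> carrier (free_group Y)" for y using hom_in_carrier[OF v(1) that] .
  have vu: "v y \<otimes>\<^bsub>G\<^esub> u x = u x \<otimes>\<^bsub>G\<^esub> v y"
    if "x \<in> carrier (free_group X)" "y \<in> carrier (free_group Y)" for x y
  proof -
    have "u x \<in> generate G (f ` X)" "v y \<in> generate G (g ` Y)" using u(3) v(3) that by blast+
    then show ?thesis using comm' unfolding elementwise_commute_def by metis
  qed
  define h where "h = (\<lambda>(x, y). u x \<otimes>\<^bsub>G\<^esub> v y)"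
  have "h \<in> hom (free_group X \<times>\<times> free_group Y) G"
  proof (rule homI)
    fix p q assume "p \<in> carrier (free_group X \<times>\<times> free_group Y)" "q \<in> carrier (free_group X \<times>\<times> free_group Y)"
    then obtain x y x' y' where pq: "p = (x, y)" "q = (x', y')"
        "x \<in> carrier (free_group X)" "x' \<in> carrier (free_group X)"
        "y \<in> carrier (free_group Y)" "y' \<in> carrier (free_group Y)"
      by auto
    have "h (p \<otimes>\<^bsub>free_group X \<times>\<times> free_group Y\<^esub> q) = u x \<otimes>\<^bsub>G\<^esub> (u x' \<otimes>\<^bsub>G\<^esub> v y) \<otimes>\<^bsub>G\<^esub> v y'"
      using pq uG vG by (simp add: h_def hom_mult[OF u(1)] hom_mult[OF v(1)] m_assoc)
    also have "\<dots> = h p \<otimes>\<^bsub>G\<^esub> h q"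
      using pq uG vG by (simp add: h_def vu[OF pq(4,5), symmetric] m_assoc)
    finally show "h (p \<otimes>\<^bsub>free_group X \<times>\<times> free_group Y\<^esub> q) = h p \<otimes>\<^bsub>G\<^esub> h q" .
  qed (use uG vG in \<open>auto simp: h_def\<close>)
  moreover have "h ([(True, x)], []) = f x" if "x \<in> X" for x
    using that u(2) v(4) f by (auto simp: h_def Pi_iff)
  moreover have "h ([], [(True, y)]) = g y" if "y \<in> Y" for y
    using that v(2) u(4) g by (auto simp: h_def Pi_iff)
  moreover have "h ` carrier (free_group X \<times>\<times> free_group Y) \<subseteq>
      (\<lambda>(a, b). a \<otimes>\<^bsub>G\<^esub> b) ` (generate G (f ` X) \<times> generate G (g ` Y))"
    using u(3) v(3) by (force simp: h_def)
  ultimately show ?thesis by blast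
qed

section \<open>Approximation of commuting isometries\<close>

text \<open>A basic neighbourhood tests only finitely many points, so one tolerance serves all of them.\<close>

lemma isometry_topology_nbhd:
  assumes M: "Metric_space M d" and V: "openin (isometry_topology M d) V" and g: "g \<in> V"
  shows "\<exists>X e. finite X \<and> X \<subseteq> M \<and> e > 0 \<and>
    (\<forall>h\<in>carrier (isometry_group M d). (\<forall>x\<in>X. d (h x) (g x) < e) \<longrightarrow> h \<in> V)"
proof -
  interpret Metric_space M d by (rule M)
  obtain V' where V': "openin (product_topology (\<lambda>_. mtopology) M) V'"
      "V = V' \<inter> carrier (isometry_group M d)"
    using V by (auto simp: isometry_topology_def openin_subtopology)
  then obtain B where B: "g \<in> Pi\<^sub>E M B" "\<And>x. openin mtopology (B x)" "finite {x. B x \<noteq> M}" "Pi\<^sub>E M B \<subseteq> V'"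
    using product_topology_open_contains_basis[of "\<lambda>_. mtopology" M V' g] g by auto
  define X where "X = {x \<in> M. B x \<noteq> M}"
  have X: "finite X" "X \<subseteq> M" using finite_subset[OF _ B(3), of X] by (auto simp: X_def)
  have "\<exists>r>0. mball (g x) r \<subseteq> B x" if "x \<in> X" for x
    using B(1) B(2)[of x] that X by (auto simp: openin_mtopology PiE_iff)
  then obtain r where r: "\<And>x. x \<in> X \<Longrightarrow> r x > 0" "\<And>x. x \<in> X \<Longrightarrow> mball (g x) (r x) \<subseteq> B x" by metis
  define e where "e = Min (insert 1 (r ` X))"
  have e: "e > 0" using X r by (auto simp: e_def Min_gr_iff)
  have er: "e \<le> r x" if "x \<in> X" for x using that X by (auto simp: e_def intro!: Min_le)
  have gM: "g x \<in> M" if "x \<in> M" for x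
    using g V'(2) that by (auto intro: isometry_group_apply_in)
  have "h \<in> V" if h: "h \<in> carrier (isometry_group M d)" "\<forall>x\<in>X. d (h x) (g x) < e" for h
  proof -
    have "h x \<in> B x" if x: "x \<in> M" for x
    proof (cases "x \<in> X")
      case True
      then have "h x \<in> mball (g x) (r x)"
        using h er[OF True] gM[OF x] isometry_group_apply_in[OF h(1) x] by (auto simp: commute)
      then show ?thesis using r(2)[OF True] by blast
    next
      case False
      then show ?thesis using x isometry_group_apply_in[OF h(1) x] by (simp add: X_def)
    qed
    moreover have "h \<in> extensional M" using h by (simp add: carrier_isometry_group_iff)
    ultimately have "h \<in> Pi\<^sub>E M B" by (simp add: PiE_iff)
    then show ?thesis using B(4) V'(2) h by blast
  qed
  then show ?thesis using X e by (intro exI[of _ X] exI[of _ e]) simp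
qed

text \<open>The first Kirchberg condition with finite groups in place of relatively compact ones. In
  a Hausdorff group this stronger form yields all three conditions, since finite sets are compact
  and closed.\<close>

definition finite_commuting_approximation :: "('g, 'm) monoid_scheme \<Rightarrow> 'g topology \<Rightarrow> bool" where
  "finite_commuting_approximation G T \<longleftrightarrow>
     (\<forall>A B OA OB. finite A \<and> finite B \<and> A \<subseteq> carrier G \<and> B \<subseteq> carrier G \<and> elementwise_commute G A B \<and>
         (\<forall>x\<in>A. openin T (OA x) \<and> x \<in> OA x) \<and> (\<forall>x\<in>B. openin T (OB x) \<and> x \<in> OB x) \<longrightarrow>
       (\<exists>a b. (\<forall>x\<in>A. a x \<in> OA x) \<and> (\<forall>x\<in>B. b x \<in> OB x) \<and> elementwise_commute G (a ` A) (b ` B) \<and>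
         finite (generate G (a ` A)) \<and> finite (generate G (b ` B))))"

text \<open>The representation of \<open>F(A) \<times> F(B)\<close> that sends the generators to themselves is approximated by
  one with finite image; the images of the generators under the latter are the new sets.\<close>

theorem isometry_group_finite_commuting_approximation:
  fixes U :: "'a set"
  assumes U: "urysohn_space U d"
  shows "finite_commuting_approximation (isometry_group U d) (isometry_topology U d)"
  unfolding finite_commuting_approximation_def
proof (intro allI impI)
  let ?G = "isometry_group U d" and ?T = "isometry_topology U d"
  have M: "Metric_space U d" using U by (simp add: urysohn_space_def)
  interpret G: group ?G by (rule group_isometry_group[OF M])
  fix A B OA OB
  assume "finite A \<and> finite B \<and> A \<subseteq> carrier ?G \<and> B \<subseteq> carrier ?G \<and> elementwise_commute ?G A B \<and>
    (\<forall>x\<in>A. openin ?T (OA x) \<and> x \<in> OA x) \<and> (\<forall>x\<in>B. openin ?T (OB x) \<and> x \<in> OB x)"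
  then have fin: "finite A" "finite B" and sub: "A \<subseteq> carrier ?G" "B \<subseteq> carrier ?G"
    and comm: "elementwise_commute ?G A B"
    and OA: "\<And>x. x \<in> A \<Longrightarrow> openin ?T (OA x)" "\<And>x. x \<in> A \<Longrightarrow> x \<in> OA x"
    and OB: "\<And>x. x \<in> B \<Longrightarrow> openin ?T (OB x)" "\<And>x. x \<in> B \<Longrightarrow> x \<in> OB x"
    by auto
  define close where "close V g X e \<longleftrightarrow> finite X \<and> X \<subseteq> U \<and> e > 0 \<and>
      (\<forall>h\<in>carrier ?G. (\<forall>x\<in>X. d (h x) (g x) < e) \<longrightarrow> h \<in> V)"
    for V g X and e :: real
  have "\<exists>X e. close (OA g) g X e" if "g \<in> A" for g
    using isometry_topology_nbhd[OF M OA(1)[OF that] OA(2)[OF that]] by (simp add: close_def)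
  then obtain XA eA where XA: "\<And>g. g \<in> A \<Longrightarrow> close (OA g) g (XA g) (eA g)" by metis
  have "\<exists>X e. close (OB g) g X e" if "g \<in> B" for g
    using isometry_topology_nbhd[OF M OB(1)[OF that] OB(2)[OF that]] by (simp add: close_def)
  then obtain XB eB where XB: "\<And>g. g \<in> B \<Longrightarrow> close (OB g) g (XB g) (eB g)" by metis
  define X where "X = \<Union>(XA ` A) \<union> \<Union>(XB ` B)"
  have XA': "finite (XA g)" "XA g \<subseteq> U" "eA g > 0" if "g \<in> A" for g
    using XA[OF that] by (simp_all add: close_def)
  have XB': "finite (XB g)" "XB g \<subseteq> U" "eB g > 0" if "g \<in> B" for g
    using XB[OF that] by (simp_all add: close_def)
  have X: "finite X" using XA'(1) XB'(1) fin by (simp add: X_def)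
  have XU: "X \<subseteq> U" using XA'(2) XB'(2) unfolding X_def by blast
  define e where "e = Min (insert 1 (eA ` A \<union> eB ` B))"
  have e: "e > 0" using XA'(3) XB'(3) fin by (auto simp: e_def)
  have eA: "e \<le> eA g" if "g \<in> A" for g using that fin by (auto simp: e_def intro!: Min_le)
  have eB: "e \<le> eB g" if "g \<in> B" for g using that fin by (auto simp: e_def intro!: Min_le)

  let ?F = "free_group A \<times>\<times> free_group B"
  have F: "group ?F" by (intro DirProd_group group_free_group)
  have id: "id \<in> A \<rightarrow> carrier ?G" "id \<in> B \<rightarrow> carrier ?G" using sub by auto
  obtain \<sigma> where \<sigma>: "\<sigma> \<in> hom ?F ?G" "\<And>g. g \<in> A \<Longrightarrow> \<sigma> ([(True, g)], []) = g"
      "\<And>g. g \<in> B \<Longrightarrow> \<sigma> ([], [(True, g)]) = g"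
    using free_group_product_universal[OF G.is_group id] comm by (auto simp: image_id)
  define S where "S = (\<lambda>g. ([(True, g)], [])) ` A \<union> (\<lambda>g. ([], [(True, g)])) ` B"
  have S: "finite S" "S \<subseteq> carrier ?F" using fin by (auto simp: S_def free_group_def)
  obtain \<tau> where \<tau>: "\<tau> \<in> hom ?F ?G" "finite (\<tau> ` carrier ?F)"
      "\<And>s x. s \<in> S \<Longrightarrow> x \<in> X \<Longrightarrow> d (\<tau> s x) (\<sigma> s x) < e"
    using finite_representations_dense[OF U F free_group_product_finite_quotient \<sigma>(1) S X XU e] by blast
  interpret \<tau>: group_hom ?F ?G \<tau>
    using \<tau>(1) F G.is_group by (simp add: group_hom_def group_hom_axioms_def)
  define a where "a g = \<tau> ([(True, g)], [])" for g
  define b where "b g = \<tau> ([], [(True, g)])" for g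
  have genF: "([(True, g)], []) \<in> carrier ?F" if "g \<in> A" for g using that by (simp add: free_group_def)
  have genF': "([], [(True, g)]) \<in> carrier ?F" if "g \<in> B" for g using that by (simp add: free_group_def)
  have "a g \<in> OA g" if g: "g \<in> A" for g
  proof -
    have gS: "([(True, g)], []) \<in> S" and XX: "XA g \<subseteq> X" using g by (auto simp: S_def X_def)
    have "a g \<in> carrier ?G" using hom_in_carrier[OF \<tau>(1) genF[OF g]] by (simp add: a_def)
    moreover have "d (a g x) (g x) < eA g" if "x \<in> XA g" for x
      using \<tau>(3)[OF gS subsetD[OF XX that]] eA[OF g] \<sigma>(2)[OF g] by (simp add: a_def)
    ultimately show ?thesis using XA[OF g] by (simp add: close_def)
  qed
  moreover have "b g \<in> OB g" if g: "g \<in> B" for g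
  proof -
    have gS: "([], [(True, g)]) \<in> S" and XX: "XB g \<subseteq> X" using g by (auto simp: S_def X_def)
    have "b g \<in> carrier ?G" using hom_in_carrier[OF \<tau>(1) genF'[OF g]] by (simp add: b_def)
    moreover have "d (b g x) (g x) < eB g" if "x \<in> XB g" for x
      using \<tau>(3)[OF gS subsetD[OF XX that]] eB[OF g] \<sigma>(3)[OF g] by (simp add: b_def)
    ultimately show ?thesis using XB[OF g] by (simp add: close_def)
  qed
  moreover have "elementwise_commute ?G (a ` A) (b ` B)"
  proof -
    have "a g \<otimes>\<^bsub>?G\<^esub> b h = b h \<otimes>\<^bsub>?G\<^esub> a g" if gh: "g \<in> A" "h \<in> B" for g h
    proof -
      have "([(True, g)], []) \<otimes>\<^bsub>?F\<^esub> ([], [(True, h)]) = ([], [(True, h)]) \<otimes>\<^bsub>?F\<^esub> ([(True, g)], [])"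
        by (simp add: free_group_def)
      then show ?thesis
        unfolding a_def b_def \<tau>.hom_mult[OF genF[OF gh(1)] genF'[OF gh(2)], symmetric]
          \<tau>.hom_mult[OF genF'[OF gh(2)] genF[OF gh(1)], symmetric] by simp
    qed
    then show ?thesis unfolding elementwise_commute_def by blast
  qed
  moreover have "finite (generate ?G (a ` A))" "finite (generate ?G (b ` B))"
  proof -
    have sub: "subgroup (\<tau> ` carrier ?F) ?G" by (rule \<tau>.img_is_subgroup)
    have "a ` A \<subseteq> \<tau> ` carrier ?F" "b ` B \<subseteq> \<tau> ` carrier ?F"
      using genF genF' unfolding a_def b_def by blast+
    then show "finite (generate ?G (a ` A))" "finite (generate ?G (b ` B))"
      using G.generate_subgroup_incl[OF _ sub] \<tau>(2) finite_subset by metis+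
  qed
  ultimately show "\<exists>a b. (\<forall>x\<in>A. a x \<in> OA x) \<and> (\<forall>x\<in>B. b x \<in> OB x) \<and> elementwise_commute ?G (a ` A) (b ` B) \<and>
         finite (generate ?G (a ` A)) \<and> finite (generate ?G (b ` B))"
    by blast
qed

section \<open>From commuting finite sets to the Kirchberg property\<close>

lemma relatively_compact_finite:
  assumes "Hausdorff_space X" "finite S" "S \<subseteq> topspace X"
  shows "relatively_compact X S"
proof -
  have "X closure_of S = S" using assms by (simp add: closure_of_eq closedin_Hausdorff_finite)
  then show ?thesis using assms by (simp add: relatively_compact_def finite_imp_compactin)
qed

lemma Hausdorff_space_isometry_topology:
  assumes "Metric_space M d"
  shows "Hausdorff_space (isometry_topology M d)"
  using Metric_space.Hausdorff_space_mtopology[OF assms]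
  by (simp add: isometry_topology_def Hausdorff_space_subtopology Hausdorff_space_product_topology)

lemma finite_commuting_approximationD:
  assumes "finite_commuting_approximation G T" "finite A" "finite B" "A \<subseteq> carrier G" "B \<subseteq> carrier G"
    "elementwise_commute G A B" "\<And>x. x \<in> A \<Longrightarrow> openin T (OA x) \<and> x \<in> OA x"
    "\<And>x. x \<in> B \<Longrightarrow> openin T (OB x) \<and> x \<in> OB x"
  shows "\<exists>a b. (\<forall>x\<in>A. a x \<in> OA x) \<and> (\<forall>x\<in>B. b x \<in> OB x) \<and>
    elementwise_commute G (a ` A) (b ` B) \<and> finite (generate G (a ` A)) \<and> finite (generate G (b ` B))"
  by (rule assms(1)[unfolded finite_commuting_approximation_def, rule_format, of A B OA OB])
    (use assms(2-) in blast)

lemma finite_approximation_imp_kirchberg_finite_sets: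
  assumes T: "topological_group G T" "Hausdorff_space T" and approx: "finite_commuting_approximation G T"
  shows "kirchberg_finite_sets G T"
  unfolding kirchberg_finite_sets_def
proof (intro allI impI)
  interpret group G using T(1) by (simp add: topological_group_def)
  have top: "topspace T = carrier G" using T(1) by (simp add: topological_group_def)
  fix A B OA OB
  assume AB: "finite A \<and> finite B \<and> A \<subseteq> carrier G \<and> B \<subseteq> carrier G \<and> elementwise_commute G A B"
    and O: "(\<forall>x\<in>A. openin T (OA x) \<and> x \<in> OA x) \<and> (\<forall>x\<in>B. openin T (OB x) \<and> x \<in> OB x)"
  obtain a b where ab: "\<And>x. x \<in> A \<Longrightarrow> a x \<in> OA x" "\<And>x. x \<in> B \<Longrightarrow> b x \<in> OB x"
    "elementwise_commute G (a ` A) (b ` B)" "finite (generate G (a ` A))" "finite (generate G (b ` B))"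
    using finite_commuting_approximationD[OF approx, of A B OA OB] AB O by blast
  have "a ` A \<subseteq> carrier G" "b ` B \<subseteq> carrier G" using ab(1,2) O openin_subset[of T] top by blast+
  then have "relatively_compact T (generate G (a ` A))" "relatively_compact T (generate G (b ` B))"
    using relatively_compact_finite[OF T(2)] ab(4,5) generate_incl by (simp_all add: top)
  then show "\<exists>a b. (\<forall>x\<in>A. a x \<in> OA x) \<and> (\<forall>x\<in>B. b x \<in> OB x) \<and> elementwise_commute G (a ` A) (b ` B) \<and>
      relatively_compact T (generate G (a ` A)) \<and> relatively_compact T (generate G (b ` B))"
    using ab by blast
qed

text \<open>A finite family of open sets that meet \<open>H1\<close>, together with one of open sets that meet \<open>H2\<close>,
  describes a basic lower Vietoris neighbourhood of the pair. Approximating one chosen point of the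
  subgroup in each of these sets gives finite commuting groups that meet the same open sets. The net
  is indexed by the pairs of families.\<close>

lemma finite_approximation_imp_kirchberg_subgroups:
  fixes G :: "('g, 'm) monoid_scheme"
  assumes T: "topological_group G T" "Hausdorff_space T" and approx: "finite_commuting_approximation G T"
  shows "kirchberg_subgroups G T"
  unfolding kirchberg_subgroups_def
proof (intro allI impI)
  interpret group G using T(1) by (simp add: topological_group_def)
  have top: "topspace T = carrier G" using T(1) by (simp add: topological_group_def)
  fix H1 H2
  assume H: "subgroup H1 G \<and> closedin T H1 \<and> subgroup H2 G \<and> closedin T H2 \<and> elementwise_commute G H1 H2"
  define fam where "fam H = {\<V>. finite \<V> \<and> (\<forall>V\<in>\<V>. openin T V \<and> H \<inter> V \<noteq> {})}" for H
  define J where "J = fam H1 \<times> fam H2"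
  define leq where "leq p q \<longleftrightarrow> fst p \<subseteq> fst q \<and> snd p \<subseteq> snd q" for p q :: "'g set set \<times> 'g set set"
  have dir: "directed J leq"
    unfolding directed_def
  proof (intro conjI ballI impI)
    have "({}, {}) \<in> J" by (simp add: J_def fam_def)
    then show "J \<noteq> {}" by blast
    fix p q assume "p \<in> J" "q \<in> J"
    then show "\<exists>r\<in>J. leq p r \<and> leq q r"
      by (intro bexI[of _ "(fst p \<union> fst q, snd p \<union> snd q)"]) (auto simp: leq_def J_def fam_def)
  qed (auto simp: leq_def)
  have point: "\<exists>c. \<forall>V\<in>\<V>. c V \<in> H \<inter> V" if "\<V> \<in> fam H" for \<V> H
    using that by (intro bchoice) (auto simp: fam_def)
  have ex: "\<exists>K1 K2. subgroup K1 G \<and> finite K1 \<and> subgroup K2 G \<and> finite K2 \<and> elementwise_commute G K1 K2 \<and>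
      (\<forall>V\<in>fst p. K1 \<inter> V \<noteq> {}) \<and> (\<forall>V\<in>snd p. K2 \<inter> V \<noteq> {})" if p: "p \<in> J" for p
  proof -
    have fam: "fst p \<in> fam H1" "snd p \<in> fam H2" using p by (auto simp: J_def)
    obtain c1 where c1: "\<And>V. V \<in> fst p \<Longrightarrow> c1 V \<in> H1 \<inter> V" using point[OF fam(1)] by blast
    obtain c2 where c2: "\<And>V. V \<in> snd p \<Longrightarrow> c2 V \<in> H2 \<inter> V" using point[OF fam(2)] by blast
    \<comment> \<open>One point may have been chosen for several sets, and its approximation has to stay in all of
      them.\<close>
    define O' where "O' \<V> x = (\<Inter>V\<in>{V \<in> \<V>. x \<in> V}. V) \<inter> topspace T" for \<V> :: "'g set set" and x
    have O': "openin T (O' \<V> x) \<and> x \<in> O' \<V> x" if "\<V> \<in> fam H" "x \<in> carrier G" for \<V> x H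
      using that unfolding O'_def by (intro conjI openin_INT) (auto simp: fam_def top)
    have "c1 ` fst p \<subseteq> H1" "c2 ` snd p \<subseteq> H2" using c1 c2 by auto
    moreover have HG: "H1 \<subseteq> carrier G" "H2 \<subseteq> carrier G" using H subgroup.subset by blast+
    ultimately have c: "c1 ` fst p \<subseteq> carrier G" "c2 ` snd p \<subseteq> carrier G"
      "elementwise_commute G (c1 ` fst p) (c2 ` snd p)"
      using H unfolding elementwise_commute_def by blast+
    have fin: "finite (c1 ` fst p)" "finite (c2 ` snd p)" using fam by (auto simp: fam_def)
    have "\<exists>a b. (\<forall>x\<in>c1 ` fst p. a x \<in> O' (fst p) x) \<and> (\<forall>x\<in>c2 ` snd p. b x \<in> O' (snd p) x) \<and>
        elementwise_commute G (a ` c1 ` fst p) (b ` c2 ` snd p) \<and>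
        finite (generate G (a ` c1 ` fst p)) \<and> finite (generate G (b ` c2 ` snd p))"
    proof (rule finite_commuting_approximationD[OF approx fin c])
      show "openin T (O' (fst p) x) \<and> x \<in> O' (fst p) x" if "x \<in> c1 ` fst p" for x
        using O'[OF fam(1)] c(1) that by blast
      show "openin T (O' (snd p) x) \<and> x \<in> O' (snd p) x" if "x \<in> c2 ` snd p" for x
        using O'[OF fam(2)] c(2) that by blast
    qed
    then obtain a b where ab: "\<forall>x\<in>c1 ` fst p. a x \<in> O' (fst p) x" "\<forall>x\<in>c2 ` snd p. b x \<in> O' (snd p) x"
        "elementwise_commute G (a ` c1 ` fst p) (b ` c2 ` snd p)"
        "finite (generate G (a ` c1 ` fst p))" "finite (generate G (b ` c2 ` snd p))"
      by (elim exE conjE)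
    have sub: "a ` c1 ` fst p \<subseteq> carrier G" "b ` c2 ` snd p \<subseteq> carrier G"
      using ab(1,2) by (auto simp: O'_def top)
    have "a (c1 V) \<in> V" if "V \<in> fst p" for V using ab(1) c1[OF that] that by (auto simp: O'_def)
    then have "\<forall>V\<in>fst p. generate G (a ` c1 ` fst p) \<inter> V \<noteq> {}"
      using generate.incl[of _ "a ` c1 ` fst p" G] by blast
    moreover have "b (c2 V) \<in> V" if "V \<in> snd p" for V using ab(2) c2[OF that] that by (auto simp: O'_def)
    then have "\<forall>V\<in>snd p. generate G (b ` c2 ` snd p) \<inter> V \<noteq> {}"
      using generate.incl[of _ "b ` c2 ` snd p" G] by blast
    ultimately show ?thesis
      using generate_is_subgroup[OF sub(1)] generate_is_subgroup[OF sub(2)] ab(4,5)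
        elementwise_commute_generate[OF sub ab(3)] by blast
  qed
  then obtain K1 K2 where K: "\<And>p. p \<in> J \<Longrightarrow> subgroup (K1 p) G \<and> finite (K1 p) \<and> subgroup (K2 p) G \<and>
      finite (K2 p) \<and> elementwise_commute G (K1 p) (K2 p) \<and>
      (\<forall>V\<in>fst p. K1 p \<inter> V \<noteq> {}) \<and> (\<forall>V\<in>snd p. K2 p \<inter> V \<noteq> {})"
    by metis
  have Ktop: "K1 p \<subseteq> topspace T" "K2 p \<subseteq> topspace T" if "p \<in> J" for p
    using K[OF that] subgroup.subset top by blast+
  have Kcl: "closedin T (K1 p)" "closedin T (K2 p)" "compactin T (K1 p)" "compactin T (K2 p)" if "p \<in> J" for p
    using K[OF that] Ktop[OF that] T(2) by (simp_all add: closedin_Hausdorff_finite finite_imp_compactin)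
  have lims: "limitin (lower_vietoris T) K1 H1 (net_filter J leq)"
    "limitin (lower_vietoris T) K2 H2 (net_filter J leq)"
    unfolding limitin_lower_vietoris eventually_net_filter[OF dir]
  proof -
    have base: "({}, {}) \<in> J" by (simp add: J_def fam_def)
    have "\<exists>i\<in>J. \<forall>j\<in>J. leq i j \<longrightarrow> K1 j \<inter> V \<noteq> {}" if "openin T V" "H1 \<inter> V \<noteq> {}" for V
    proof (intro bexI[of _ "({V}, {})"] ballI impI)
      fix j assume "j \<in> J" "leq ({V}, {}) j"
      then show "K1 j \<inter> V \<noteq> {}" using K[of j] by (auto simp: leq_def)
    qed (use that in \<open>auto simp: J_def fam_def\<close>)
    then show "closedin T H1 \<and> (\<exists>i\<in>J. \<forall>j\<in>J. leq i j \<longrightarrow> closedin T (K1 j)) \<and>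
        (\<forall>V. openin T V \<and> H1 \<inter> V \<noteq> {} \<longrightarrow> (\<exists>i\<in>J. \<forall>j\<in>J. leq i j \<longrightarrow> K1 j \<inter> V \<noteq> {}))"
      using H Kcl(1) base by blast
    have "\<exists>i\<in>J. \<forall>j\<in>J. leq i j \<longrightarrow> K2 j \<inter> V \<noteq> {}" if "openin T V" "H2 \<inter> V \<noteq> {}" for V
    proof (intro bexI[of _ "({}, {V})"] ballI impI)
      fix j assume "j \<in> J" "leq ({}, {V}) j"
      then show "K2 j \<inter> V \<noteq> {}" using K[of j] by (auto simp: leq_def)
    qed (use that in \<open>auto simp: J_def fam_def\<close>)
    then show "closedin T H2 \<and> (\<exists>i\<in>J. \<forall>j\<in>J. leq i j \<longrightarrow> closedin T (K2 j)) \<and>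
        (\<forall>V. openin T V \<and> H2 \<inter> V \<noteq> {} \<longrightarrow> (\<exists>i\<in>J. \<forall>j\<in>J. leq i j \<longrightarrow> K2 j \<inter> V \<noteq> {}))"
      using H Kcl(2) base by blast
  qed
  have "commuting_compact_net G T H1 H2 J leq K1 K2"
    unfolding commuting_compact_net_def using dir lims K Kcl by blast
  then show "\<exists>(I :: ('g set set \<times> 'g set set) set) leq K1 K2. commuting_compact_net G T H1 H2 I leq K1 K2"
    by blast
qed

definition word_value :: "('g, 'm) monoid_scheme \<Rightarrow> ('x \<Rightarrow> 'g) \<Rightarrow> (bool \<times> 'x) list \<Rightarrow> 'g" where
  "word_value G f w = foldr (\<lambda>p g. (if fst p then f (snd p) else inv\<^bsub>G\<^esub> f (snd p)) \<otimes>\<^bsub>G\<^esub> g) w \<one>\<^bsub>G\<^esub>"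

lemma hom_free_group_word_value:
  assumes G: "group G" and h: "h \<in> hom (free_group X) G" and w: "w \<in> carrier (free_group X)"
  shows "h w = word_value G (\<lambda>x. h [(True, x)]) w"
  using w
proof (induction w)
  interpret F: group "free_group X" by (rule group_free_group)
  interpret h: group_hom "free_group X" G h
    using h G by (simp add: group_hom_def group_hom_axioms_def F.is_group)
  case Nil
  then show ?case using h.hom_one by (simp add: word_value_def free_group_def)
next
  interpret F: group "free_group X" by (rule group_free_group)
  interpret h: group_hom "free_group X" G h
    using h G by (simp add: group_hom_def group_hom_axioms_def F.is_group)
  case (Cons q v)
  obtain b x where q: "q = (b, x)" by (cases q)
  have C: "[q] \<in> carrier (free_group X)" "v \<in> carrier (free_group X)" "[(True, x)] \<in> carrier (free_group X)"
    using Cons.prems by (auto simp: free_group_def successively_Cons q)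
  have "q # v = [q] \<otimes>\<^bsub>free_group X\<^esub> v"
    using Cons.prems by (cases v) (auto simp: free_group_def)
  then have "h (q # v) = h [q] \<otimes>\<^bsub>G\<^esub> h v" using C by simp
  moreover have "h [q] = (if b then h [(True, x)] else inv\<^bsub>G\<^esub> h [(True, x)])"
  proof (cases b)
    case False
    have "inv\<^bsub>free_group X\<^esub> [(True, x)] = [q]"
      using C False by (intro F.inv_equality) (auto simp: free_group_def cancels_def q)
    then show ?thesis using False h.hom_inv[OF C(3)] by simp
  qed (simp add: q)
  ultimately show ?case using Cons.IH[OF C(2)] by (simp add: word_value_def q)
qed

lemma continuous_map_word_value:
  assumes T: "topological_group G T" and f: "\<And>x. continuous_map Z T (\<lambda>z. f z x)"
  shows "continuous_map Z T (\<lambda>z. word_value G (f z) w)"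
proof (induction w)
  interpret group G using T by (simp add: topological_group_def)
  case Nil
  show ?case using T by (simp add: word_value_def topological_group_def)
next
  case (Cons q w)
  have mult: "continuous_map (prod_topology T T) T (\<lambda>(x, y). x \<otimes>\<^bsub>G\<^esub> y)" and inv: "continuous_map T T (\<lambda>x. inv\<^bsub>G\<^esub> x)"
    using T by (auto simp: topological_group_def)
  have "continuous_map Z T (\<lambda>z. if fst q then f z (snd q) else inv\<^bsub>G\<^esub> f z (snd q))"
    using f[of "snd q"] continuous_map_compose[OF f[of "snd q"] inv] by (simp add: o_def)
  then have "continuous_map Z T ((\<lambda>(x, y). x \<otimes>\<^bsub>G\<^esub> y) \<circ>
      (\<lambda>z. (if fst q then f z (snd q) else inv\<^bsub>G\<^esub> f z (snd q), word_value G (f z) w)))"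
    using Cons.IH by (intro continuous_map_compose[OF _ mult] continuous_map_pairedI)
  then show ?case by (simp add: o_def word_value_def)
qed

text \<open>The value of a representation at a given element depends continuously on the images of the generators.
  Hence a neighbourhood of a representation only constrains the images of finitely many generators,
  and the remaining generators may be sent to the identity.\<close>

lemma finite_approximation_imp_kirchberg_representations:
  fixes G :: "('g, 'm) monoid_scheme"
  assumes T: "topological_group G T" "Hausdorff_space T" and approx: "finite_commuting_approximation G T"
  shows "kirchberg_representations G T"
proof -
  interpret group G using T(1) by (simp add: topological_group_def)
  have top: "topspace T = carrier G" and mult: "continuous_map (prod_topology T T) T (\<lambda>(x, y). x \<otimes>\<^bsub>G\<^esub> y)"
    using T(1) by (auto simp: topological_group_def)
  define F where "F = free_group (UNIV :: nat set)"
  define \<Gamma> where "\<Gamma> = F \<times>\<times> F"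
  define R where "R = rep_space \<Gamma> G T"
  define S where "S = {h \<in> topspace R. relatively_compact T (h ` carrier \<Gamma>)}"
  interpret F: group F unfolding F_def by (rule group_free_group)
  have Fone: "\<one>\<^bsub>F\<^esub> = []" by (simp add: F_def free_group_def)
  have gen: "[(True, n)] \<in> carrier F" for n by (simp add: F_def free_group_def)
  have nil: "[] \<in> carrier F" using F.one_closed by (simp add: Fone)
  have nn: "[] \<otimes>\<^bsub>F\<^esub> [] = []" by (simp add: F_def free_group_def)
  define val where "val z \<gamma> = word_value G (fst z) (fst \<gamma>) \<otimes>\<^bsub>G\<^esub> word_value G (snd z) (snd \<gamma>)"
    for z :: "(nat \<Rightarrow> 'g) \<times> (nat \<Rightarrow> 'g)" and \<gamma> :: "(bool \<times> nat) list \<times> (bool \<times> nat) list"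
  have hom_val: "h \<gamma> = val (\<lambda>n. h ([(True, n)], []), \<lambda>n. h ([], [(True, n)])) \<gamma>"
    if h: "h \<in> hom \<Gamma> G" and \<gamma>: "\<gamma> \<in> carrier \<Gamma>" for h \<gamma>
  proof -
    obtain v w where vw: "\<gamma> = (v, w)" "v \<in> carrier F" "w \<in> carrier F" using \<gamma> by (auto simp: \<Gamma>_def)
    have h1: "(\<lambda>v. h (v, [])) \<in> hom F G"
      using hom_in_carrier[OF h] hom_mult[OF h, of "(_, [])" "(_, [])"] nil
      by (intro homI) (auto simp: \<Gamma>_def nn)
    have h2: "(\<lambda>w. h ([], w)) \<in> hom F G"
      using hom_in_carrier[OF h] hom_mult[OF h, of "([], _)" "([], _)"] nil
      by (intro homI) (auto simp: \<Gamma>_def nn)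
    have "h (v, w) = h (v, []) \<otimes>\<^bsub>G\<^esub> h ([], w)"
      using hom_mult[OF h, of "(v, [])" "([], w)"] vw nil
        F.r_one[OF vw(2), unfolded Fone] F.l_one[OF vw(3), unfolded Fone] by (simp add: \<Gamma>_def)
    then show ?thesis
      using hom_free_group_word_value[OF is_group h1[unfolded F_def], of v]
        hom_free_group_word_value[OF is_group h2[unfolded F_def], of w] vw
      by (simp add: val_def F_def)
  qed
  let ?P = "product_topology (\<lambda>_. T) (UNIV :: nat set)"
  have val_cont: "continuous_map (prod_topology ?P ?P) T (\<lambda>z. val z \<gamma>)" for \<gamma>
  proof -
    have "continuous_map (prod_topology ?P ?P) T (\<lambda>z. fst z n)" for n
      using continuous_map_compose[OF continuous_map_fst continuous_map_product_projection[of n UNIV "\<lambda>_. T"]]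
      by (simp add: o_def)
    moreover have "continuous_map (prod_topology ?P ?P) T (\<lambda>z. snd z n)" for n
      using continuous_map_compose[OF continuous_map_snd continuous_map_product_projection[of n UNIV "\<lambda>_. T"]]
      by (simp add: o_def)
    ultimately have "continuous_map (prod_topology ?P ?P) T ((\<lambda>(x, y). x \<otimes>\<^bsub>G\<^esub> y) \<circ>
        (\<lambda>z. (word_value G (fst z) (fst \<gamma>), word_value G (snd z) (snd \<gamma>))))"
      by (intro continuous_map_compose[OF _ mult] continuous_map_pairedI continuous_map_word_value T(1))
    then show ?thesis by (simp add: o_def val_def)
  qed
  have "h \<in> R closure_of S" if h: "h \<in> topspace R" for h
    unfolding in_closure_of
  proof (intro conjI h allI impI)
    fix V assume V: "h \<in> V \<and> openin R V"
    obtain V' where V': "openin (product_topology (\<lambda>_. T) (carrier \<Gamma>)) V'" "V = V' \<inter> hom \<Gamma> G"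
      using V by (auto simp: R_def rep_space_def openin_subtopology)
    then obtain B where B: "h \<in> Pi\<^sub>E (carrier \<Gamma>) B" "\<And>\<gamma>. openin T (B \<gamma>)" "finite {\<gamma>. B \<gamma> \<noteq> topspace T}"
        "Pi\<^sub>E (carrier \<Gamma>) B \<subseteq> V'"
      using product_topology_open_contains_basis[of "\<lambda>_. T" "carrier \<Gamma>" V' h] V by auto
    have hhom: "h \<in> hom \<Gamma> G" using V V'(2) by blast
    define K where "K = {\<gamma> \<in> carrier \<Gamma>. B \<gamma> \<noteq> topspace T}"
    have K: "finite K" using finite_subset[OF _ B(3), of K] by (auto simp: K_def)
    define f0 where "f0 n = h ([(True, n)], [])" for n
    define g0 where "g0 n = h ([], [(True, n)])" for n
    have f0G: "f0 n \<in> carrier G" and g0G: "g0 n \<in> carrier G" for n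
      using hom_in_carrier[OF hhom] gen nil by (auto simp: f0_def g0_def \<Gamma>_def)
    define Q where "Q = (\<Inter>\<gamma>\<in>K. {z \<in> topspace (prod_topology ?P ?P). val z \<gamma> \<in> B \<gamma>}) \<inter> topspace (prod_topology ?P ?P)"
    have "openin (prod_topology ?P ?P) Q"
      unfolding Q_def by (intro openin_INT K openin_continuous_map_preimage[OF val_cont B(2)])
    moreover have "(f0, g0) \<in> Q"
    proof -
      have "val (f0, g0) \<gamma> \<in> B \<gamma>" if "\<gamma> \<in> K" for \<gamma>
        using that B(1) hom_val[OF hhom, of \<gamma>] unfolding K_def f0_def g0_def by (auto simp: PiE_iff)
      then show ?thesis using f0G g0G by (auto simp: Q_def top)
    qed
    ultimately obtain P1 P2 where P12: "openin ?P P1" "openin ?P P2" "f0 \<in> P1" "g0 \<in> P2" "P1 \<times> P2 \<subseteq> Q"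
      unfolding openin_prod_topology_alt by metis
    obtain VA where VA: "f0 \<in> Pi\<^sub>E UNIV VA" "\<And>n. openin T (VA n)" "finite {n. VA n \<noteq> topspace T}" "Pi\<^sub>E UNIV VA \<subseteq> P1"
      using product_topology_open_contains_basis[OF P12(1,3)] by auto
    obtain VB where VB: "g0 \<in> Pi\<^sub>E UNIV VB" "\<And>n. openin T (VB n)" "finite {n. VB n \<noteq> topspace T}" "Pi\<^sub>E UNIV VB \<subseteq> P2"
      using product_topology_open_contains_basis[OF P12(2,4)] by auto
    define NA where "NA = {n. VA n \<noteq> topspace T}"
    define NB where "NB = {n. VB n \<noteq> topspace T}"
    \<comment> \<open>Generators with the same image are moved together, so all their constraints apply.\<close>
    define OA where "OA x = (\<Inter>n\<in>{n \<in> NA. f0 n = x}. VA n) \<inter> topspace T" for x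
    define OB where "OB x = (\<Inter>n\<in>{n \<in> NB. g0 n = x}. VB n) \<inter> topspace T" for x
    have OA: "openin T (OA x) \<and> x \<in> OA x" if x: "x \<in> f0 ` NA" for x
    proof
      have "finite {n \<in> NA. f0 n = x}" using VA(3) by (simp add: NA_def)
      then show "openin T (OA x)" unfolding OA_def by (intro openin_INT VA(2))
      have "x \<in> VA n" if "f0 n = x" for n using VA(1) that by (auto simp: PiE_iff)
      then show "x \<in> OA x" using x f0G by (auto simp: OA_def top)
    qed
    have OB: "openin T (OB x) \<and> x \<in> OB x" if x: "x \<in> g0 ` NB" for x
    proof
      have "finite {n \<in> NB. g0 n = x}" using VB(3) by (simp add: NB_def)
      then show "openin T (OB x)" unfolding OB_def by (intro openin_INT VB(2))
      have "x \<in> VB n" if "g0 n = x" for n using VB(1) that by (auto simp: PiE_iff)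
      then show "x \<in> OB x" using x g0G by (auto simp: OB_def top)
    qed
    have "f0 n \<otimes>\<^bsub>G\<^esub> g0 m = g0 m \<otimes>\<^bsub>G\<^esub> f0 n" for m n
    proof -
      have "([(True, n)], []) \<in> carrier \<Gamma>" "([], [(True, m)]) \<in> carrier \<Gamma>" using gen nil by (auto simp: \<Gamma>_def)
      moreover have "([(True, n)], []) \<otimes>\<^bsub>\<Gamma>\<^esub> ([], [(True, m)]) = ([], [(True, m)]) \<otimes>\<^bsub>\<Gamma>\<^esub> ([(True, n)], [])"
        by (simp add: \<Gamma>_def F_def free_group_def)
      ultimately show ?thesis unfolding f0_def g0_def by (metis hom_mult[OF hhom])
    qed
    then have comm: "elementwise_commute G (f0 ` NA) (g0 ` NB)" unfolding elementwise_commute_def by blast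
    have finN: "finite (f0 ` NA)" "finite (g0 ` NB)" using VA(3) VB(3) by (auto simp: NA_def NB_def)
    have sub: "f0 ` NA \<subseteq> carrier G" "g0 ` NB \<subseteq> carrier G" using f0G g0G by auto
    have "\<exists>a b. (\<forall>x\<in>f0 ` NA. a x \<in> OA x) \<and> (\<forall>x\<in>g0 ` NB. b x \<in> OB x) \<and>
        elementwise_commute G (a ` f0 ` NA) (b ` g0 ` NB) \<and>
        finite (generate G (a ` f0 ` NA)) \<and> finite (generate G (b ` g0 ` NB))"
      by (rule finite_commuting_approximationD[OF approx finN sub comm]) (fact OA, fact OB)
    then obtain a b where ab: "\<forall>x\<in>f0 ` NA. a x \<in> OA x" "\<forall>x\<in>g0 ` NB. b x \<in> OB x"
        "elementwise_commute G (a ` f0 ` NA) (b ` g0 ` NB)"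
        "finite (generate G (a ` f0 ` NA))" "finite (generate G (b ` g0 ` NB))"
      by (elim exE conjE)
    define f1 where "f1 n = (if n \<in> NA then a (f0 n) else \<one>\<^bsub>G\<^esub>)" for n
    define g1 where "g1 n = (if n \<in> NB then b (g0 n) else \<one>\<^bsub>G\<^esub>)" for n
    have f1V: "f1 n \<in> VA n" for n
      using ab(1) by (auto simp: f1_def OA_def NA_def top)
    have g1V: "g1 n \<in> VB n" for n
      using ab(2) by (auto simp: g1_def OB_def NB_def top)
    have f1G: "f1 \<in> UNIV \<rightarrow> carrier G" and g1G: "g1 \<in> UNIV \<rightarrow> carrier G"
      using f1V g1V openin_subset[OF VA(2)] openin_subset[OF VB(2)] top by blast+
    have sub': "a ` f0 ` NA \<subseteq> carrier G" "b ` g0 ` NB \<subseteq> carrier G"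
      using ab(1,2) by (auto simp: OA_def OB_def top)
    have f1gen: "range f1 \<subseteq> generate G (a ` f0 ` NA)" and g1gen: "range g1 \<subseteq> generate G (b ` g0 ` NB)"
      unfolding f1_def g1_def by (auto intro: generate.one generate.incl)
    have "elementwise_commute G (range f1) (range g1)"
      using elementwise_commute_generate[OF sub' ab(3)] f1gen g1gen unfolding elementwise_commute_def by blast
    then obtain h1 where h1: "h1 \<in> hom \<Gamma> G" "\<And>n. h1 ([(True, n)], []) = f1 n" "\<And>n. h1 ([], [(True, n)]) = g1 n"
        "h1 ` carrier \<Gamma> \<subseteq> (\<lambda>(a, b). a \<otimes>\<^bsub>G\<^esub> b) ` (generate G (range f1) \<times> generate G (range g1))"
      using free_group_product_universal[OF is_group f1G g1G] unfolding \<Gamma>_def F_def by auto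
    define h' where "h' = restrict h1 (carrier \<Gamma>)"
    have \<Gamma>grp: "group \<Gamma>" unfolding \<Gamma>_def by (intro DirProd_group F.is_group)
    have h'hom: "h' \<in> hom \<Gamma> G"
      using h1(1) group.is_monoid[OF \<Gamma>grp] by (auto simp: hom_def h'_def monoid.m_closed)
    have "h' \<in> Pi\<^sub>E (carrier \<Gamma>) B"
    proof (rule PiE_I)
      fix \<gamma> assume \<gamma>: "\<gamma> \<in> carrier \<Gamma>"
      show "h' \<gamma> \<in> B \<gamma>"
      proof (cases "\<gamma> \<in> K")
        case True
        have "f1 \<in> Pi\<^sub>E UNIV VA" "g1 \<in> Pi\<^sub>E UNIV VB" using f1V g1V by auto
        then have "(f1, g1) \<in> Q" using VA(4) VB(4) P12(5) by blast
        then show ?thesis using True hom_val[OF h1(1) \<gamma>] \<gamma> by (simp add: Q_def h1(2,3) h'_def)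
      next
        case False
        then show ?thesis using \<gamma> hom_in_carrier[OF h'hom \<gamma>] by (simp add: K_def top)
      qed
    qed (simp add: h'_def)
    then have h'V: "h' \<in> V" using B(4) V'(2) h'hom by blast
    moreover have "h' \<in> topspace R" using h'V V openin_subset by blast
    moreover have "relatively_compact T (h' ` carrier \<Gamma>)"
    proof (rule relatively_compact_finite[OF T(2)])
      have "generate G (range f1) \<subseteq> generate G (a ` f0 ` NA)" "generate G (range g1) \<subseteq> generate G (b ` g0 ` NB)"
        using generate_subgroup_incl[OF f1gen generate_is_subgroup[OF sub'(1)]]
          generate_subgroup_incl[OF g1gen generate_is_subgroup[OF sub'(2)]] by auto
      then have "finite (generate G (range f1) \<times> generate G (range g1))"
        using ab(4,5) finite_subset by blast
      then show "finite (h' ` carrier \<Gamma>)" using finite_subset[OF h1(4)] by (simp add: h'_def)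
      show "h' ` carrier \<Gamma> \<subseteq> topspace T" using hom_in_carrier[OF h'hom] by (auto simp: top)
    qed
    ultimately show "\<exists>y. y \<in> S \<and> y \<in> V" unfolding S_def by blast
  qed
  then have "R closure_of S = topspace R"
    using closure_of_subset_topspace[of R S] by blast
  then show ?thesis
    by (simp add: kirchberg_representations_def Let_def R_def S_def \<Gamma>_def F_def)
qed

theorem corollary3:
  fixes U :: "'a set" and d :: "'a \<Rightarrow> 'a \<Rightarrow> real"
  assumes "urysohn_space U d"
  shows "kirchberg_property (isometry_group U d) (isometry_topology U d)"
proof -
  have M: "Metric_space U d" using assms by (simp add: urysohn_space_def)
  note T = topological_group_isometry_group[OF M] Hausdorff_space_isometry_topology[OF M]
    isometry_group_finite_commuting_approximation[OF assms]
  show ?thesis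
    unfolding kirchberg_property_def
    using T(1) finite_approximation_imp_kirchberg_finite_sets[OF T]
      finite_approximation_imp_kirchberg_subgroups[OF T]
      finite_approximation_imp_kirchberg_representations[OF T]
    by (intro conjI)
qed

end
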